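(* If $X,Y$ are log-concave uncorrelated real random variables, then for $\alpha>1$ one has $$\mathcal{N}_\alpha(X+Y)\ \leq\ \frac{C_+(\alpha)}{C_-(\alpha)}\left(\mathcal{N}_\alpha(X)+\mathcal{N}_\alpha(Y)\right),$$ where $$C_-(\alpha)=\alpha^{\frac{2}{\alpha-1}},\qquad C_+(\alpha)=\frac{3\alpha-1}{\alpha-1}\left(\frac{2\alpha}{3\alpha-1}\right)^{\frac{2}{1-\alpha}}B\left(\frac12,\frac{\alpha}{\alpha-1}\right)^2 .$$
   Context: A real random variable $X$ is log-concave if its density is of the form $f=e^{-V}$, where $V:\mathbb{R}\to(-\infty,\infty]$ is convex. For $\alpha\in(0,\infty)\setminus\{1\}$, the Rényi entropy of order $\alpha$ of a real random variable $X$ with density $f$ is $h_\alpha(X)=\frac{1}{1-\alpha}\log\left(\int f^\alpha(x)\,dx\right)$ (with $\log$ the natural logarithm), assuming that the integral converges. The Rényi entropy power is $\mathcal{N}_\alpha(X)=\exp(2h_\alpha(X))$ (no normalizing constant). $B(x,y)=\frac{\Gamma(x)\Gamma(y)}{\Gamma(x+y)}$ is the Beta function. Uncorrelated means $\operatorname{Cov}(X,Y)=0$. *)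

theory Defs
  imports "HOL-Probability.Probability"
begin

definition exp_ereal :: "ereal \<Rightarrow> ennreal" where
  "exp_ereal x = (case x of ereal r \<Rightarrow> ennreal (exp r) | PInfty \<Rightarrow> \<infinity> | MInfty \<Rightarrow> 0)"

text \<open>Convexity of a function with values in \<open>(-\<infinity>, \<infinity>]\<close>. In \<^typ>\<open>ereal\<close> we have
  \<open>0 * \<infinity> = 0\<close>, so the cases \<open>t = 0\<close> and \<open>t = 1\<close> impose no condition.\<close>

definition convex_extended :: "(real \<Rightarrow> ereal) \<Rightarrow> bool" where
  "convex_extended V \<longleftrightarrow>
     (\<forall>x. V x \<noteq> -\<infinity>) \<and>
     (\<forall>x y t. 0 \<le> t \<and> t \<le> 1 \<longrightarrow>
        V ((1 - t) * x + t * y) \<le> ereal (1 - t) * V x + ereal t * V y)"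

definition log_concave_rv :: "'a measure \<Rightarrow> ('a \<Rightarrow> real) \<Rightarrow> bool" where
  "log_concave_rv M X \<longleftrightarrow>
     (\<exists>V. convex_extended V \<and> distributed M lborel X (\<lambda>x. exp_ereal (- V x)))"

text \<open>The covariance is meaningful only for square integrable variables; log-concave
  variables have moments of all orders, so nothing is assumed about integrability here.\<close>

definition covariance :: "'a measure \<Rightarrow> ('a \<Rightarrow> real) \<Rightarrow> ('a \<Rightarrow> real) \<Rightarrow> real" where
  "covariance M X Y =
     (\<integral>\<omega>. (X \<omega> - (\<integral>\<omega>'. X \<omega>' \<partial>M)) * (Y \<omega> - (\<integral>\<omega>'. Y \<omega>' \<partial>M)) \<partial>M)"

definition uncorrelated :: "'a measure \<Rightarrow> ('a \<Rightarrow> real) \<Rightarrow> ('a \<Rightarrow> real) \<Rightarrow> bool" where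
  "uncorrelated M X Y \<longleftrightarrow> covariance M X Y = 0"

text \<open>The Renyi entropy of order \<open>\<alpha>\<close> of \<open>X\<close> is defined when \<open>X\<close> has a density \<open>f\<close> and
  \<open>\<integral> f\<^sup>\<alpha>\<close> converges.\<close>

definition has_renyi_entropy :: "'a measure \<Rightarrow> real \<Rightarrow> ('a \<Rightarrow> real) \<Rightarrow> bool" where
  "has_renyi_entropy M \<alpha> X \<longleftrightarrow>
     (\<exists>f. (\<forall>x. 0 \<le> f x) \<and> distributed M lborel X (\<lambda>x. ennreal (f x)) \<and>
          integrable lborel (\<lambda>x. f x powr \<alpha>))"

text \<open>The density is taken to be the Radon-Nikodym derivative of the law of \<open>X\<close>;
  \<open>renyi_entropy_distributed\<close> below shows that any other version gives the same value.
  Outside of \<^const>\<open>has_renyi_entropy\<close> the value is a meaningless default.\<close>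

definition renyi_entropy :: "'a measure \<Rightarrow> real \<Rightarrow> ('a \<Rightarrow> real) \<Rightarrow> real" where
  "renyi_entropy M \<alpha> X =
     1 / (1 - \<alpha>) *
     ln (\<integral>x. enn2real (RN_deriv lborel (distr M lborel X) x) powr \<alpha> \<partial>lborel)"

definition renyi_entropy_power :: "'a measure \<Rightarrow> real \<Rightarrow> ('a \<Rightarrow> real) \<Rightarrow> real" where
  "renyi_entropy_power M \<alpha> X = exp (2 * renyi_entropy M \<alpha> X)"

lemma (in prob_space) renyi_entropy_distributed:
  assumes X: "distributed M lborel X (\<lambda>x. ennreal (f x))" and nonneg: "\<And>x. 0 \<le> f x"
  shows "renyi_entropy M \<alpha> X = 1 / (1 - \<alpha>) * ln (\<integral>x. f x powr \<alpha> \<partial>lborel)"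
proof -
  have [measurable]: "f \<in> borel_measurable lborel"
    using distributed_real_measurable[OF _ X] nonneg by auto
  have "AE x in lborel. RN_deriv lborel (distr M lborel X) x = ennreal (f x)"
    using distributed_RN_deriv[OF X] distributed_distr_eq_density[OF X] by simp
  then have "AE x in lborel. enn2real (RN_deriv lborel (distr M lborel X) x) powr \<alpha> = f x powr \<alpha>"
    by eventually_elim (simp add: nonneg)
  then have "(\<integral>x. enn2real (RN_deriv lborel (distr M lborel X) x) powr \<alpha> \<partial>lborel)
      = (\<integral>x. f x powr \<alpha> \<partial>lborel)"
    by (intro integral_cong_AE) measurable
  then show ?thesis
    by (simp add: renyi_entropy_def)
qed

definition C_minus :: "real \<Rightarrow> real" where
  "C_minus \<alpha> = \<alpha> powr (2 / (\<alpha> - 1))"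

definition C_plus :: "real \<Rightarrow> real" where
  "C_plus \<alpha> =
     (3 * \<alpha> - 1) / (\<alpha> - 1) * (2 * \<alpha> / (3 * \<alpha> - 1)) powr (2 / (1 - \<alpha>)) *
     (Beta (1 / 2) (\<alpha> / (\<alpha> - 1)))\<^sup>2"

end

theory Submission
  imports Defs
begin

text \<open>
The variance mediates between the two sides. Among all densities of variance \<open>v\<close>, the Renyi
entropy of order \<open>\<alpha> > 1\<close> is largest for a multiple of \<open>(1 - x\<^sup>2/R\<^sup>2)\<^sub>+ powr (1/(\<alpha> - 1))\<close>, so
\<open>N(X + Y) \<le> C\<^sub>+ Var (X + Y)\<close>; among log-concave densities of variance \<open>v\<close> it is smallest for the
exponential one, so \<open>C\<^sub>- Var X \<le> N(X)\<close> and likewise for \<open>Y\<close>. Variances of uncorrelated variables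
add, and the theorem follows. The constants are the values of \<open>N / Var\<close> at the two extremal densities.

The upper bound (\<open>power_integral_lower_bound\<close>) is Young's inequality
\<open>\<alpha> y s \<le> y powr \<alpha> + (\<alpha> - 1) s powr (\<alpha>/(\<alpha> - 1))\<close> applied pointwise to the density and to a
truncated parabola, whose power integral is a Beta value.

The lower bound (\<open>log_concave_renyi_variance\<close>) is the main part. Let \<open>f\<close> be log-concave with
supremum \<open>M\<close>, and let \<open>a\<close>, \<open>b\<close> be the masses to the left and to the right of its mode. Each half,
suitably rescaled, is a nonincreasing log-concave density \<open>g\<close> on \<open>(0, \<infinity>)\<close> with supremum \<open>1\<close>. Let
\<open>S\<close> be its tail. The estimates rest on two monotonicity properties: \<open>g\<close> decreases from \<open>1\<close>, while
the hazard rate \<open>g/S\<close> increases from \<open>1\<close>. With \<open>d = 1 + \<integral> g ln g\<close>, a number in \<open>[0, 1]\<close> that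
vanishes for the exponential density, three estimates hold:

  \<^item> the mean is at most \<open>1 - d/2\<close> (\<open>mean_le_of_entropy\<close>);
  \<^item> \<open>\<alpha> \<integral> g powr \<alpha> \<le> 1 + (\<alpha> - 1) d\<close> (\<open>powr_integral_le\<close>);
  \<^item> the variance is at most \<open>exp (-2 d)\<close>, which comes from the inequality
    \<open>\<integral> x\<^sup>2 g \<le> 2 m\<^sup>2 (h - ln m)\<close> between the second moment, the mean \<open>m\<close> and the entropy \<open>h = 1 - d\<close>
    (\<open>second_moment_le\<close>).

The first two compare \<open>g\<close> and \<open>S/g\<close>, as functions of the tail mass \<open>s\<close>, with \<open>min 1 (c s)\<close>
(\<open>integral_unimodal_le\<close>). The third integrates the derivative of an explicit function of \<open>S\<close> and of
the tail \<open>H\<close> of \<open>S\<close>. Put \<open>D = a d\<^sub>L + b d\<^sub>R\<close>. Glueing the halves together gives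
\<open>M\<^sup>2 Var \<le> exp (-2 D)\<close> by the elementary inequality \<open>split_variance_bound\<close>, and
\<open>\<alpha> \<integral> f powr \<alpha> \<le> M powr (\<alpha> - 1) (1 + (\<alpha> - 1) D) \<le> (M exp D) powr (\<alpha> - 1)\<close>; the product of the
matching powers of these two bounds no longer contains \<open>M\<close> and \<open>D\<close>, and is \<open>1\<close>.
\<close>

section \<open>An elementary inequality for the two halves of a density\<close>

text \<open>The quotient \<open>(exp (-x) - 1 + x) / x\<^sup>2\<close> decreases on \<open>(0, 1]\<close>, and equals \<open>exp (-1)\<close> at \<open>x = 1\<close>.\<close>

lemma exp_minus_ge_quadratic:
  fixes a :: real
  assumes "0 \<le> a" "a \<le> 1"
  shows "1 - a + a\<^sup>2 * exp (-1) \<le> exp (- a)"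
proof (cases "a = 0")
  case False
  with assms have a: "0 < a" by simp
  have numerator: "2 - x - (2 + x) * exp (- x) \<le> 0" if "0 \<le> x" for x :: real
  proof -
    have "(2 + 0) * exp (- 0) - (2 - 0) \<le> (2 + x) * exp (- x) - (2 - x)"
    proof (rule DERIV_nonneg_imp_nondecreasing[OF that])
      fix t :: real assume t: "0 \<le> t" "t \<le> x"
      have "((\<lambda>x. (2 + x) * exp (- x) - (2 - x)) has_real_derivative 1 - (1 + t) * exp (- t)) (at t)"
        by (auto intro!: derivative_eq_intros simp: algebra_simps)
      moreover have "(1 + t) * exp (- t) \<le> exp t * exp (- t)"
        by (intro mult_right_mono) (use t in auto)
      ultimately show "\<exists>y. ((\<lambda>x. (2 + x) * exp (- x) - (2 - x)) has_real_derivative y) (at t) \<and> 0 \<le> y"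
        by (auto simp flip: exp_add)
    qed
    then show ?thesis by simp
  qed
  have "(exp (- 1) - 1 + 1) / 1\<^sup>2 \<le> (exp (- a) - 1 + a) / a\<^sup>2"
  proof (rule DERIV_nonpos_imp_nonincreasing[OF assms(2)])
    fix x :: real assume x: "a \<le> x" "x \<le> 1"
    have "((\<lambda>x. (exp (- x) - 1 + x) / x\<^sup>2) has_real_derivative
            (2 - x - (2 + x) * exp (- x)) / x ^ 3) (at x)"
      using a x by (auto intro!: derivative_eq_intros simp: field_simps power2_eq_square power3_eq_cube)
    moreover have "(2 - x - (2 + x) * exp (- x)) / x ^ 3 \<le> 0"
      using numerator[of x] a x by (auto intro!: divide_nonpos_nonneg)
    ultimately show "\<exists>y. ((\<lambda>x. (exp (- x) - 1 + x) / x\<^sup>2) has_real_derivative y) (at x) \<and> y \<le> 0"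
      by blast
  qed
  with a show ?thesis by (simp add: field_simps)
qed simp

lemma exp_le_chord:
  fixes c t :: real
  assumes "0 \<le> t" "t \<le> 1"
  shows "exp (t * c) \<le> (1 - t) + t * exp c"
  using convex_onD[OF exp_convex, of t 0 c] assms by simp

text \<open>The extreme case of \<open>exponential_mixture_bound\<close>: one half is uniform and the other exponential.
Squaring \<open>exp_minus_ge_quadratic\<close> loses only \<open>a\<^sup>2 b k (1 - a k)\<close> with \<open>k = exp (-1)\<close>.\<close>

lemma split_weights_bound:
  fixes a b :: real
  assumes "0 \<le> a" "0 \<le> b" "a + b = 1"
  shows "a ^ 3 * exp (-2) + b ^ 3 + a\<^sup>2 * b * exp (-1) + a * b\<^sup>2 \<le> exp (- 2 * a)"
proof -
  define k :: real where "k = exp (-1)"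
  have k: "0 < k" "k \<le> 1" "exp (-2) = k\<^sup>2"
    by (auto simp: k_def power2_eq_square simp flip: exp_add)
  have b: "b = 1 - a" using assms by simp
  have "(1 - a + a\<^sup>2 * k)\<^sup>2 \<le> exp (- a) ^ 2"
    using exp_minus_ge_quadratic[of a] assms k by (intro power_mono) (auto simp: k_def)
  also have "exp (- a) ^ 2 = exp (- 2 * a)"
    by (simp add: power2_eq_square flip: exp_add)
  finally have 1: "(b + a\<^sup>2 * k)\<^sup>2 \<le> exp (- 2 * a)" by (simp add: b)
  have "(b + a\<^sup>2 * k)\<^sup>2 - (a ^ 3 * k\<^sup>2 + b ^ 3 + a\<^sup>2 * b * k + a * b\<^sup>2) = a\<^sup>2 * b * k * (1 - a * k)"
    unfolding b by (simp add: algebra_simps power2_eq_square power3_eq_cube)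
  moreover have "a * k \<le> 1 * 1" using assms k by (intro mult_mono) auto
  ultimately have "a ^ 3 * k\<^sup>2 + b ^ 3 + a\<^sup>2 * b * k + a * b\<^sup>2 \<le> (b + a\<^sup>2 * k)\<^sup>2"
    using assms k by (smt (verit) mult_nonneg_nonneg zero_le_power2)
  with 1 k show ?thesis by (simp add: k_def)
qed

text \<open>After division by the right-hand side, the left-hand side is at most a combination of exponentials
in \<open>t = c - d\<close>, because \<open>c \<le> 1\<close>. This combination is convex in \<open>t\<close>, so it suffices to look at
\<open>t = 0\<close> and \<open>t = 1\<close>: the first case needs \<open>exp 1 \<le> 3\<close>, the second is \<open>split_weights_bound\<close>.\<close>

lemma exponential_mixture_bound:
  fixes a b c d :: real
  assumes ab: "0 \<le> a" "0 \<le> b" "a + b = 1" and cd: "0 \<le> d" "d \<le> c" "c \<le> 1"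
  shows "a ^ 3 * exp (- 2 * c) + b ^ 3 * exp (- 2 * d) + a * b * (a * exp (- c) + b * exp (- d))
    \<le> exp (- 2 * (a * c + b * d))"
proof -
  define t where "t = c - d"
  have t: "0 \<le> t" "t \<le> 1" using cd by (auto simp: t_def)
  have b: "b = 1 - a" using ab by simp
  define R where "R = exp (2 * (a * c + b * d))"
  have chord: "exp (t * x) \<le> (1 - t) + t * exp x" for x :: real
    using exp_le_chord t by blast
  have e3: "exp 1 \<le> (3::real)" by (rule exp_le)
  have 1: "exp (- 2 * c) * R = exp (t * (- 2 * b))" "exp (- 2 * d) * R = exp (t * (2 * a))"
    "exp (- c) * R = exp (c - 2 * b * t)" "exp (- d) * R = exp (c + (2 * a - 1) * t)"
    by (simp_all add: R_def t_def b algebra_simps flip: exp_add)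
  have 2: "exp (c - 2 * b * t) \<le> exp 1 * exp (t * (- 2 * b))"
    using cd by (simp add: algebra_simps flip: exp_add)
  have 3: "exp (c + (2 * a - 1) * t) \<le> exp 1 * exp (t * (2 * a - 1))"
    using cd by (simp add: algebra_simps flip: exp_add)
  have "(a ^ 3 * exp (- 2 * c) + b ^ 3 * exp (- 2 * d) + a * b * (a * exp (- c) + b * exp (- d))) * R
    = a ^ 3 * (exp (- 2 * c) * R) + b ^ 3 * (exp (- 2 * d) * R)
      + a * b * (a * (exp (- c) * R) + b * (exp (- d) * R))"
    by (simp add: algebra_simps)
  also have "\<dots> \<le> a ^ 3 * ((1 - t) + t * exp (- 2 * b)) + b ^ 3 * ((1 - t) + t * exp (2 * a))
      + a * b * (a * (exp 1 * ((1 - t) + t * exp (- 2 * b))) + b * (exp 1 * ((1 - t) + t * exp (2 * a - 1))))"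
    unfolding 1 using ab chord chord[of "- (2 * b)"]
    by (intro add_mono mult_left_mono order.trans[OF 2] order.trans[OF 3]) auto
  also have "\<dots> = (1 - t) * (a ^ 3 + b ^ 3 + a * b * exp 1 * (a + b))
      + t * (a ^ 3 * exp (- 2 * b) + b ^ 3 * exp (2 * a) + a\<^sup>2 * b * (exp 1 * exp (- 2 * b))
             + a * b\<^sup>2 * (exp 1 * exp (2 * a - 1)))"
    by (simp add: algebra_simps power2_eq_square)
  also have "exp 1 * exp (- 2 * b) = exp (2 * a) * exp (-1)"
    by (simp add: b flip: exp_add)
  also have "exp 1 * exp (2 * a - 1) = exp (2 * a)"
    by (simp flip: exp_add)
  also have "exp (- 2 * b) = exp (2 * a) * exp (-2)"
    by (simp add: b flip: exp_add)
  also have "a ^ 3 * (exp (2 * a) * exp (-2)) + b ^ 3 * exp (2 * a) + a\<^sup>2 * b * (exp (2 * a) * exp (-1))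
      + a * b\<^sup>2 * exp (2 * a)
    = exp (2 * a) * (a ^ 3 * exp (-2) + b ^ 3 + a\<^sup>2 * b * exp (-1) + a * b\<^sup>2)"
    by (simp add: algebra_simps)
  also have "(1 - t) * (a ^ 3 + b ^ 3 + a * b * exp 1 * (a + b))
      + t * (exp (2 * a) * (a ^ 3 * exp (-2) + b ^ 3 + a\<^sup>2 * b * exp (-1) + a * b\<^sup>2))
    \<le> (1 - t) * 1 + t * (exp (2 * a) * exp (- 2 * a))"
  proof (intro add_mono mult_left_mono split_weights_bound ab)
    have "a * b * exp 1 \<le> a * b * 3" using ab e3 by (intro mult_left_mono) auto
    moreover have "a ^ 3 + b ^ 3 + a * b * 3 = 1"
      unfolding b by (simp add: algebra_simps power3_eq_cube)
    ultimately show "a ^ 3 + b ^ 3 + a * b * exp 1 * (a + b) \<le> 1"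
      using ab by (simp add: algebra_simps)
  qed (use t in auto)
  also have "\<dots> = exp (- 2 * (a * c + b * d)) * R"
    by (simp add: R_def flip: exp_add)
  finally show ?thesis by (simp add: R_def)
qed

text \<open>The left-hand side is the variance of a mixture with weights \<open>a\<close> and \<open>b\<close>: two variables with means
\<open>EL\<close>, \<open>ER\<close> and variances \<open>VL\<close>, \<open>VR\<close> are scaled by their own weights and put back to back at the
origin, the first one reflected. Convexity of the square separates the means, and
\<open>1 - d/2 \<le> exp (-d/2)\<close> turns everything into exponentials.\<close>

lemma split_variance_bound:
  fixes a b dL dR VL VR EL ER :: real
  assumes ab: "0 \<le> a" "0 \<le> b" "a + b = 1"
    and d: "0 \<le> dL" "dL \<le> 1" "0 \<le> dR" "dR \<le> 1"
    and V: "VL \<le> exp (- 2 * dL)" "VR \<le> exp (- 2 * dR)"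
    and E: "0 \<le> EL" "EL \<le> 1 - dL / 2" "0 \<le> ER" "ER \<le> 1 - dR / 2"
  shows "a ^ 3 * VL + b ^ 3 * VR + a * b * (a * EL + b * ER)\<^sup>2 \<le> exp (- 2 * (a * dL + b * dR))"
proof -
  have sq: "x\<^sup>2 \<le> exp (- y)" if "0 \<le> x" "x \<le> 1 - y / 2" for x y :: real
  proof -
    have "x \<le> exp (- y / 2)"
      using that exp_ge_add_one_self[of "- y / 2"] by linarith
    then have "x\<^sup>2 \<le> (exp (- y / 2))\<^sup>2" using that by (intro power_mono)
    also have "\<dots> = exp (- y)" by (simp add: power2_eq_square flip: exp_add)
    finally show ?thesis .
  qed
  have b: "b = 1 - a" using ab by simp
  have "(a * EL + b * ER)\<^sup>2 = a * EL\<^sup>2 + b * ER\<^sup>2 - a * b * (EL - ER)\<^sup>2"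
    unfolding b by (simp add: algebra_simps power2_eq_square)
  also have "\<dots> \<le> a * EL\<^sup>2 + b * ER\<^sup>2" using ab by simp
  also have "\<dots> \<le> a * exp (- dL) + b * exp (- dR)"
    using ab E sq by (intro add_mono mult_left_mono) auto
  finally have "a ^ 3 * VL + b ^ 3 * VR + a * b * (a * EL + b * ER)\<^sup>2
    \<le> a ^ 3 * exp (- 2 * dL) + b ^ 3 * exp (- 2 * dR) + a * b * (a * exp (- dL) + b * exp (- dR))"
    using ab V by (intro add_mono mult_left_mono) auto
  also have "\<dots> \<le> exp (- 2 * (a * dL + b * dR))"
  proof (cases "dR \<le> dL")
    case True
    then show ?thesis using exponential_mixture_bound[of a b dR dL] ab d by simp
  next
    case False
    then show ?thesis using exponential_mixture_bound[of b a dL dR] ab d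
      by (simp add: algebra_simps)
  qed
  finally show ?thesis .
qed

text \<open>The logarithm lies above its chord over \<open>[1, 2]\<close>, whose slope is \<open>ln 2\<close>.\<close>

lemma ln_ge_two_thirds:
  fixes v :: real
  assumes "1 \<le> v" "v \<le> 2"
  shows "2 / 3 * (v - 1) \<le> ln v"
proof -
  have "2 / 3 * (v - 1) \<le> ln 2 * (v - 1)"
    using assms ln2_ge_two_thirds by (intro mult_right_mono) auto
  also have "\<dots> = (1 - (v - 1)) * ln 1 + (v - 1) * ln 2" by (simp add: mult.commute)
  also have "\<dots> \<le> ln ((1 - (v - 1)) *\<^sub>R 1 + (v - 1) *\<^sub>R 2)"
    using concave_onD[OF ln_concave, of "v - 1" 1 2] assms by simp
  finally show ?thesis by simp
qed

section \<open>Increments bounded by Lebesgue integrals, and tails of integrals\<close>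

text \<open>A one-sided fundamental theorem of calculus on an open interval, written as an increasing union of
compact ones. The derivatives \<open>\<Psi>'\<close> to which it is applied have logarithmic singularities at the
ends, so integrability is asked of the bound \<open>\<phi>\<close>.\<close>

lemma set_integral_ge_increment:
  fixes \<phi> \<Psi> \<Psi>' :: "real \<Rightarrow> real" and l r :: "nat \<Rightarrow> real"
  assumes exhaust: "incseq r" "decseq l" "\<And>n. l n < r n" "T = (\<Union>n. {l n..r n})"
    and int: "set_integrable lborel T \<phi>"
    and N: "finite N" and cont: "continuous_on T \<Psi>"
    and der: "\<And>x. x \<in> T - N \<Longrightarrow> (\<Psi> has_real_derivative \<Psi>' x) (at x)"
    and le: "\<And>x. x \<in> T - N \<Longrightarrow> \<Psi>' x \<le> \<phi> x"
    and lim: "(\<lambda>n. \<Psi> (l n)) \<longlonglongrightarrow> A" "(\<lambda>n. \<Psi> (r n)) \<longlonglongrightarrow> B"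
  shows "B - A \<le> (LINT x:T|lborel. \<phi> x)"
proof (rule LIMSEQ_le)
  show "(\<lambda>n. \<Psi> (r n) - \<Psi> (l n)) \<longlonglongrightarrow> B - A"
    using lim by (intro tendsto_intros)
  show "(\<lambda>n. LINT x:{l n..r n}|lborel. \<phi> x) \<longlonglongrightarrow> (LINT x:T|lborel. \<phi> x)"
    unfolding exhaust(4)
  proof (rule set_integral_cont_up)
    show "incseq (\<lambda>n. {l n..r n})"
      using exhaust(1,2) by (auto simp: incseq_def decseq_def intro: order_trans)
  qed (use int exhaust(4) in auto)
  have "\<Psi> (r n) - \<Psi> (l n) \<le> (LINT x:{l n..r n}|lborel. \<phi> x)" for n
  proof -
    have sub: "{l n..r n} \<subseteq> T" unfolding exhaust(4) by blast
    have "set_integrable lborel {l n..r n} \<phi>"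
      by (rule set_integrable_subset[OF int _ sub]) simp
    note \<phi> = set_borel_integral_eq_integral[OF this]
    have "(\<Psi>' has_integral \<Psi> (r n) - \<Psi> (l n)) {l n..r n}"
    proof (rule fundamental_theorem_of_calculus_strong[OF N])
      show "continuous_on {l n..r n} \<Psi>" using cont sub by (rule continuous_on_subset)
    qed (use sub exhaust(3) der in \<open>auto simp: less_imp_le has_real_derivative_iff_has_vector_derivative\<close>)
    moreover have "((\<lambda>x. if x \<in> N then \<Psi>' x else \<phi> x) has_integral integral {l n..r n} \<phi>) {l n..r n}"
      by (rule has_integral_spike_finite[OF N _ integrable_integral[OF \<phi>(1)]]) auto
    ultimately have "\<Psi> (r n) - \<Psi> (l n) \<le> integral {l n..r n} \<phi>"
      by (rule has_integral_le) (use sub le in auto)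
    with \<phi>(2) show ?thesis by simp
  qed
  then show "\<exists>N. \<forall>n\<ge>N. \<Psi> (r n) - \<Psi> (l n) \<le> (LINT x:{l n..r n}|lborel. \<phi> x)" by blast
qed

lemma abs_mult_ln_le_sqrt:
  fixes y :: real
  assumes "0 \<le> y" "y \<le> 1"
  shows "\<bar>y * ln y\<bar> \<le> 2 * sqrt y"
proof (cases "y = 0")
  case False
  then have y: "0 < y" using assms by simp
  define z where "z = sqrt y"
  have z: "0 < z" "y = z * z" using y by (auto simp: z_def)
  have "ln (1 / z) \<le> 1 / z - 1" using z by (intro ln_le_minus_one) auto
  then have "z * (- ln z) \<le> 1" using z by (simp add: ln_div field_simps)
  moreover have "\<bar>y * ln y\<bar> = 2 * z * (z * (- ln z))"
  proof -
    have "z \<le> 1" using assms by (simp add: z_def)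
    then have "\<bar>ln z\<bar> = - ln z" using z by simp
    then show ?thesis using z by (simp add: abs_mult ln_mult)
  qed
  moreover have "z * (z * (- ln z)) \<le> z * 1"
    using z \<open>z * (- ln z) \<le> 1\<close> by (intro mult_left_mono) auto
  ultimately show ?thesis by (simp add: z_def[symmetric])
qed simp

lemma tendsto_mult_ln_zero:
  fixes s :: "'a \<Rightarrow> real"
  assumes "\<forall>\<^sub>F x in F. 0 \<le> s x" "(s \<longlongrightarrow> 0) F"
  shows "((\<lambda>x. s x * ln (s x)) \<longlongrightarrow> 0) F"
proof (rule Lim_null_comparison)
  have "\<forall>\<^sub>F x in F. s x < 1" using assms(2) by (rule order_tendstoD) simp
  with assms(1) show "\<forall>\<^sub>F x in F. norm (s x * ln (s x)) \<le> 2 * sqrt (s x)"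
    by eventually_elim (use abs_mult_ln_le_sqrt in auto)
  show "((\<lambda>x. 2 * sqrt (s x)) \<longlongrightarrow> 0) F"
    using tendsto_mult[OF tendsto_const tendsto_real_sqrt[OF assms(2)], of 2] by simp
qed

lemma tail_integral_has_derivative:
  fixes \<phi> :: "real \<Rightarrow> real"
  assumes int: "set_integrable lborel {0<..} \<phi>" and x: "0 < x" and cont: "isCont \<phi> x"
  shows "((\<lambda>y. LINT t:{y<..}|lborel. \<phi> t) has_real_derivative - \<phi> x) (at x)"
proof -
  define a b where "a = x / 2" and "b = x + 1"
  have ab: "0 < a" "a < x" "x < b" using x by (auto simp: a_def b_def)
  have si: "set_integrable lborel A \<phi>" if "A \<subseteq> {0<..}" "A \<in> sets borel" for A
    by (rule set_integrable_subset[OF int]) (use that in auto)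
  have meas: "set_borel_measurable lborel A \<phi>" if "A \<subseteq> {0<..}" "A \<in> sets borel" for A
    unfolding set_borel_measurable_def
    by (rule borel_measurable_integrable[OF si[OF that, unfolded set_integrable_def]])
  have split: "(LINT t:{y<..}|lborel. \<phi> t) = (LINT t:{a<..}|lborel. \<phi> t) - integral {a..y} \<phi>"
    if "y \<in> {a..b}" for y
  proof -
    have "(LINT t:{a<..y} \<union> {y<..}|lborel. \<phi> t)
        = (LINT t:{a<..y}|lborel. \<phi> t) + (LINT t:{y<..}|lborel. \<phi> t)"
      by (rule set_integral_Un) (use ab that in \<open>auto intro!: si\<close>)
    moreover have "{a<..y} \<union> {y<..} = {a<..}" using that by auto
    ultimately have "(LINT t:{a<..}|lborel. \<phi> t) = (LINT t:{a<..y}|lborel. \<phi> t) + (LINT t:{y<..}|lborel. \<phi> t)"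
      by metis
    moreover have "(LINT t:{a<..y}|lborel. \<phi> t) = (LINT t:{a..y}|lborel. \<phi> t)"
    proof (rule set_integral_cong_set)
      show "AE t in lborel. t \<in> {a..y} \<longleftrightarrow> t \<in> {a<..y}"
        using AE_lborel_singleton[of a] by eventually_elim auto
    qed (use ab in \<open>auto intro!: meas\<close>)
    moreover have "(LINT t:{a..y}|lborel. \<phi> t) = integral {a..y} \<phi>"
      by (rule set_borel_integral_eq_integral(2)[OF si]) (use ab in auto)
    ultimately show ?thesis by simp
  qed
  have "\<phi> integrable_on {a..b}"
    by (rule set_borel_integral_eq_integral(1)[OF si]) (use ab in auto)
  then have "((\<lambda>u. integral {a..u} \<phi>) has_vector_derivative \<phi> x) (at x within {a..b})"
    using integral_has_vector_derivative_continuous_at[of \<phi> a b x "{}"] ab cont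
    by (simp add: continuous_at_imp_continuous_within)
  then have "((\<lambda>u. integral {a..u} \<phi>) has_real_derivative \<phi> x) (at x within {a..b})"
    by (simp add: has_real_derivative_iff_has_vector_derivative)
  then have "((\<lambda>u. integral {a..u} \<phi>) has_real_derivative \<phi> x) (at x)"
    using ab by (subst (asm) at_within_Icc_at) auto
  then have "((\<lambda>y. (LINT t:{a<..}|lborel. \<phi> t) - integral {a..y} \<phi>) has_real_derivative 0 - \<phi> x) (at x)"
    by (intro derivative_intros)
  moreover have "\<forall>\<^sub>F y in nhds x. (LINT t:{y<..}|lborel. \<phi> t) = (LINT t:{a<..}|lborel. \<phi> t) - integral {a..y} \<phi>"
    using eventually_nhds_in_open[of "{a<..<b}" x] ab
    by (auto elim!: eventually_mono intro!: split)
  ultimately show ?thesis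
    by (subst DERIV_cong_ev[OF refl _ refl]) auto
qed


lemma set_integrable_exp_bound:
  fixes \<phi> :: "real \<Rightarrow> real"
  assumes [measurable]: "\<phi> \<in> borel_measurable borel" and "0 < k"
    and "\<And>x. 0 < x \<Longrightarrow> \<bar>\<phi> x\<bar> \<le> C * exp (- (k * x))"
  shows "set_integrable lborel {0<..} \<phi>"
proof (rule set_integrable_bound)
  show "set_integrable lborel {0<..} (\<lambda>x. C * exp (- (k * x)))"
    using integrable_I0i_exp_mscale[OF \<open>0 < k\<close>] by (simp add: mult.commute)
  show "AE x in lborel. x \<in> {0<..} \<longrightarrow> norm (\<phi> x) \<le> norm (C * exp (- (k * x)))"
    using assms(3) by (force intro!: AE_I2)
qed (simp add: set_borel_measurable_def)

text \<open>\<open>y \<le> exp y\<close> at \<open>y = k x / (2 n)\<close>, raised to the power \<open>n\<close>.\<close>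

lemma power_mult_exp_bound:
  fixes k :: real
  assumes "0 < k"
  shows "\<exists>C\<ge>0. \<forall>x>0. x ^ n * exp (- (k * x)) \<le> C * exp (- (k / 2 * x))"
proof -
  define C where "C = (real n * 2 / k) ^ n"
  have "x ^ n * exp (- (k * x)) \<le> C * exp (- (k / 2 * x))" if x: "0 < x" for x
  proof (cases "n = 0")
    case False
    have "k * x / (2 * n) \<le> exp (k * x / (2 * n))"
      using exp_ge_add_one_self[of "k * x / (2 * n)"] by linarith
    then have "(k * x / (2 * n)) ^ n \<le> exp (k * x / (2 * n)) ^ n"
      using x assms by (intro power_mono) auto
    also have "\<dots> = exp (k / 2 * x)"
      using False by (simp flip: exp_of_nat_mult)
    finally have "x ^ n \<le> C * exp (k / 2 * x)"
      using assms False unfolding C_def by (simp add: field_simps)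
    then have "x ^ n * exp (- (k * x)) \<le> C * exp (k / 2 * x) * exp (- (k * x))"
      by (intro mult_right_mono) auto
    also have "\<dots> = C * exp (- (k / 2 * x))"
      by (simp add: mult.assoc flip: exp_add)
    finally show ?thesis .
  qed (use x assms in \<open>simp add: C_def\<close>)
  moreover have "0 \<le> C" using assms by (simp add: C_def)
  ultimately show ?thesis by blast
qed

section \<open>Normalised decreasing log-concave densities on the half-line\<close>

text \<open>Replacing \<open>f x\<close> by \<open>f (c x) / M\<close> brings one half of a unimodal log-concave density into this form.
The supremum \<open>1\<close> need not be attained: the value of a log-concave function at the left end of its
support may be smaller than its limit there.\<close>

locale decreasing_log_concave =
  fixes g :: "real \<Rightarrow> real"
  assumes integrable: "integrable lborel g" and total: "(\<integral>x. g x \<partial>lborel) = 1"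
    and nonneg: "0 \<le> g x" and outside: "x \<le> 0 \<Longrightarrow> g x = 0" and le_1: "g x \<le> 1"
    and antimono: "0 < x \<Longrightarrow> x \<le> y \<Longrightarrow> g y \<le> g x"
    and sup_1: "c < 1 \<Longrightarrow> \<exists>x>0. c < g x"
    and log_concave: "0 < x \<Longrightarrow> 0 < y \<Longrightarrow> 0 < t \<Longrightarrow> t < 1 \<Longrightarrow>
      g x powr (1 - t) * g y powr t \<le> g ((1 - t) * x + t * y)"
begin

lemma measurable_g [measurable]: "g \<in> borel_measurable borel"
  using integrable by simp

text \<open>The points \<open>x\<close> and \<open>z + s\<close> lie between \<open>z\<close> and \<open>x + s\<close> and have the same sum, so they
are convex combinations of the outer points with exchanged weights.\<close>

lemma four_points:
  assumes "0 < z" "z \<le> x" "0 \<le> s"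
  shows "g (x + s) * g z \<le> g x * g (z + s)"
proof (cases "z = x \<or> s = 0")
  case False
  define t where "t = (x - z) / (x - z + s)"
  have pos: "0 < x - z" "0 < s" using False assms by auto
  have t: "0 < t" "t < 1" using pos by (auto simp: t_def)
  have "t * (x - z + s) = x - z" using pos by (simp add: t_def)
  then have eq: "(1 - t) * z + t * (x + s) = x" "(1 - (1 - t)) * z + (1 - t) * (x + s) = z + s"
    by (simp_all add: algebra_simps)
  have "(g z powr (1 - t) * g (x + s) powr t) * (g z powr t * g (x + s) powr (1 - t)) \<le> g x * g (z + s)"
    using log_concave[of z "x + s" t] log_concave[of z "x + s" "1 - t"] assms t nonneg
    unfolding eq by (intro mult_mono) auto
  also have "(g z powr (1 - t) * g (x + s) powr t) * (g z powr t * g (x + s) powr (1 - t))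
      = g z powr (1 - t + t) * g (x + s) powr (t + (1 - t))"
    unfolding powr_add by (simp only: ac_simps)
  also have "\<dots> = g (x + s) * g z" using nonneg by simp
  finally show ?thesis .
qed auto

text \<open>The inequality \<open>four_points\<close> as \<open>z\<close> tends to \<open>0\<close>, where \<open>g z\<close> tends to \<open>1\<close>.\<close>

lemma submultiplicative:
  assumes "0 < x" "0 < y"
  shows "g (x + y) \<le> g x * g y"
proof (rule field_le_mult_one_interval)
  fix c :: real assume c: "0 < c" "c < 1"
  obtain z where z: "0 < z" "c < g z" using sup_1 c by blast
  define w where "w = min z x"
  have w: "0 < w" "w \<le> x" "c \<le> g w" using z assms antimono[of w z] by (auto simp: w_def)
  have "c * g (x + y) \<le> g w * g (x + y)" using w nonneg by (intro mult_right_mono) auto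
  also have "\<dots> \<le> g x * g (w + y)" using four_points[of w x y] w assms by (simp add: mult.commute)
  also have "\<dots> \<le> g x * g y" using w assms nonneg by (intro mult_left_mono antimono) auto
  finally show "c * g (x + y) \<le> g x * g y" .
qed

text \<open>By \<open>submultiplicative\<close>, \<open>g\<close> is at most \<open>2 powr (-n)\<close> at \<open>n y\<close> as soon as \<open>g y \<le> 1/2\<close>.\<close>

lemma exponential_decay: "\<exists>k>0. \<forall>x. g x \<le> 2 * exp (- (k * x))"
proof -
  have "\<exists>y>0. g y \<le> 1 / 2"
  proof (rule ccontr)
    assume "\<not> ?thesis"
    then have half: "1 / 2 < g y" if "0 < y" for y using that by force
    have "(\<integral>x. indicator {0<..3::real} x * (1 / 2) \<partial>lborel) \<le> (\<integral>x. g x \<partial>lborel)"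
    proof (intro integral_mono integrable integrable_mult_left integrable_real_indicator)
      show "indicator {0<..3} x * (1 / 2) \<le> g x" for x :: real
        using half[of x] nonneg[of x] by (auto simp: indicator_def)
    qed auto
    then show False using total by simp
  qed
  then obtain y where y: "0 < y" "g y \<le> 1 / 2" by blast
  have pow: "g (real (Suc n) * y) \<le> (1 / 2) ^ Suc n" for n
  proof (induction n)
    case (Suc n)
    have "g (real (Suc n) * y + y) \<le> g (real (Suc n) * y) * g y"
      using y by (intro submultiplicative) auto
    also have "\<dots> \<le> (1 / 2) ^ Suc n * (1 / 2)"
      using Suc y nonneg by (intro mult_mono) auto
    finally show ?case by (simp add: algebra_simps)
  qed (use y in simp)
  define k where "k = ln 2 / y"
  have "g x \<le> 2 * exp (- (k * x))" for x
  proof (cases "x \<le> 0")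
    case True
    then show ?thesis using outside by simp
  next
    case x: False
    define n where "n = nat \<lfloor>x / y\<rfloor>"
    have n: "real n \<le> x / y" "x / y < real n + 1"
      using x y by (auto simp: n_def)
    have "g x \<le> (1 / 2) ^ n"
    proof (cases n)
      case 0
      then show ?thesis using le_1 by simp
    next
      case (Suc m)
      have "0 < real (Suc m) * y" using y by simp
      then have "g x \<le> g (real (Suc m) * y)"
        using n y by (intro antimono) (auto simp: Suc field_simps)
      then show ?thesis using pow[of m] Suc by simp
    qed
    also have "(1 / 2) ^ n = exp (- (real n * ln 2))"
      by (simp add: exp_minus exp_of_nat_mult inverse_eq_divide power_one_over)
    also have "\<dots> \<le> exp (ln 2 - x / y * ln 2)"
    proof -
      have "x / y * ln 2 \<le> (real n + 1) * ln 2" using n by (intro mult_right_mono) auto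
      then show ?thesis by (simp add: algebra_simps)
    qed
    also have "\<dots> = 2 * exp (- (k * x))"
      by (simp add: exp_diff exp_minus k_def field_simps)
    finally show ?thesis .
  qed
  moreover have "0 < k" using y by (simp add: k_def)
  ultimately show ?thesis by blast
qed

lemma moment_integrable: "set_integrable lborel {0<..} (\<lambda>x. x ^ n * g x)"
proof -
  obtain k where k: "0 < k" "\<And>x. g x \<le> 2 * exp (- (k * x))" using exponential_decay by blast
  obtain C where C: "\<And>x. 0 < x \<Longrightarrow> x ^ n * exp (- (k * x)) \<le> C * exp (- (k / 2 * x))"
    using power_mult_exp_bound[OF k(1)] by blast
  show ?thesis
  proof (rule set_integrable_exp_bound[where k = "k / 2" and C = "2 * C"])
    fix x :: real assume x: "0 < x"
    have "x ^ n * g x \<le> x ^ n * (2 * exp (- (k * x)))"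
      using x k by (intro mult_left_mono) auto
    also have "\<dots> = 2 * (x ^ n * exp (- (k * x)))" by simp
    also have "\<dots> \<le> 2 * (C * exp (- (k / 2 * x)))"
      using C[OF x] by (intro mult_left_mono) auto
    finally show "\<bar>x ^ n * g x\<bar> \<le> 2 * C * exp (- (k / 2 * x))"
      using x nonneg[of x] by (simp add: abs_mult)
  qed (use k in auto)
qed

lemma entropy_integrable: "set_integrable lborel {0<..} (\<lambda>x. g x * ln (g x))"
proof -
  obtain k where k: "0 < k" "\<And>x. g x \<le> 2 * exp (- (k * x))" using exponential_decay by blast
  show ?thesis
  proof (rule set_integrable_exp_bound[where k = "k / 2" and C = "2 * sqrt 2"])
    fix x :: real assume x: "0 < x"
    have "\<bar>g x * ln (g x)\<bar> \<le> 2 * sqrt (g x)" using nonneg le_1 by (intro abs_mult_ln_le_sqrt)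
    also have "\<dots> \<le> 2 * sqrt (2 * exp (- (k * x)))" using k by simp
    also have "\<dots> = 2 * sqrt 2 * exp (- (k / 2 * x))"
    proof -
      have "sqrt (exp (- (k * x))) = exp (- (k / 2 * x))"
        by (rule real_sqrt_unique) (auto simp: power2_eq_square simp flip: exp_add)
      then show ?thesis by (simp add: real_sqrt_mult)
    qed
    finally show "\<bar>g x * ln (g x)\<bar> \<le> 2 * sqrt 2 * exp (- (k / 2 * x))" .
  qed (use k in auto)
qed

text \<open>The survival function; \<open>g / S\<close> is the hazard rate.\<close>

definition S :: "real \<Rightarrow> real" where "S x = (LINT t:{x<..}|lborel. g t)"

lemma set_integrable_g: "A \<in> sets borel \<Longrightarrow> set_integrable lborel A g"
  using integrable_mult_indicator[OF _ integrable, of A] by (simp add: set_integrable_def)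

lemma S_0: "S 0 = 1"
proof -
  have "(\<integral>x. indicator {0<..} x *\<^sub>R g x \<partial>lborel) = (\<integral>x. g x \<partial>lborel)"
    using outside by (intro Bochner_Integration.integral_cong) (auto simp: indicator_def)
  then show ?thesis by (simp add: S_def set_lebesgue_integral_def total)
qed

lemma S_nonneg: "0 \<le> S x"
  unfolding S_def set_lebesgue_integral_def by (intro Bochner_Integration.integral_nonneg) (auto simp: nonneg)

lemma S_antimono: "x \<le> y \<Longrightarrow> S y \<le> S x"
  unfolding S_def set_lebesgue_integral_def
  by (intro integral_mono set_integrable_g[unfolded set_integrable_def])
     (auto simp: nonneg indicator_def)

lemma measurable_S [measurable]: "S \<in> borel_measurable borel"
proof -
  have "(\<lambda>x. - S x) \<in> borel_measurable borel"
    by (rule borel_measurable_mono) (auto simp: mono_def S_antimono)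
  then show ?thesis using borel_measurable_uminus[of "\<lambda>x. - S x"] by simp
qed

lemma S_shift:
  shows "set_integrable lborel {0<..} (\<lambda>s. g (x + s))" and "S x = (LINT s:{0<..}|lborel. g (x + s))"
proof -
  have eq: "indicator {x<..} (x + 1 * s) *\<^sub>R g (x + 1 * s) = indicator {0<..} s *\<^sub>R g (x + s)" for s
    by (simp add: indicator_def)
  show "set_integrable lborel {0<..} (\<lambda>s. g (x + s))"
    using lborel_integrable_real_affine[OF set_integrable_g[of "{x<..}", unfolded set_integrable_def], of 1 x]
    unfolding eq set_integrable_def by simp
  show "S x = (LINT s:{0<..}|lborel. g (x + s))"
    using lborel_integral_real_affine[of 1 "\<lambda>t. indicator {x<..} t *\<^sub>R g t" x]
    unfolding eq S_def set_lebesgue_integral_def by simp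
qed

lemma S_le_g: "0 < x \<Longrightarrow> S x \<le> g x"
proof -
  assume x: "0 < x"
  have "S x \<le> (LINT s:{0<..}|lborel. g x * g s)"
    unfolding S_shift(2) using x submultiplicative
    by (intro set_integral_mono S_shift) (auto intro!: set_integrable_g)
  also have "\<dots> = g x" using S_0 by (simp add: S_def)
  finally show ?thesis .
qed

text \<open>The inequality \<open>four_points\<close>, integrated over \<open>s\<close>.\<close>

lemma hazard_mono: "0 < x \<Longrightarrow> x \<le> y \<Longrightarrow> S y * g x \<le> S x * g y"
proof -
  assume xy: "0 < x" "x \<le> y"
  have "(LINT s:{0<..}|lborel. g (y + s) * g x) \<le> (LINT s:{0<..}|lborel. g (x + s) * g y)"
    using xy four_points[of x y] by (intro set_integral_mono) (auto intro: S_shift simp: mult.commute)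
  then show ?thesis by (simp add: S_shift(2))
qed

text \<open>The interior of the support of \<open>g\<close>, an interval that starts at \<open>0\<close>.\<close>

definition T :: "real set" where "T = {x. 0 < x \<and> (\<exists>y>x. 0 < g y)}"
text \<open>The quotient \<open>H / S\<close> is the mean residual life \<open>E (X - x | X > x)\<close>; in particular \<open>H 0\<close> is the mean.\<close>

definition H :: "real \<Rightarrow> real" where "H x = (LINT t:{x<..}|lborel. S t)"

lemma T_pos: "x \<in> T \<Longrightarrow> 0 < x"
  by (simp add: T_def)

lemma g_pos: "x \<in> T \<Longrightarrow> 0 < g x"
proof -
  assume "x \<in> T"
  then obtain y where "0 < x" "x < y" "0 < g y" by (auto simp: T_def)
  then show ?thesis using antimono[of x y] by linarith
qed

lemma T_downward: "x \<in> T \<Longrightarrow> 0 < z \<Longrightarrow> z \<le> x \<Longrightarrow> z \<in> T"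
proof -
  assume "x \<in> T" and z: "0 < z" "z \<le> x"
  then obtain y where "x < y" "0 < g y" by (auto simp: T_def)
  with z have "z < y \<and> 0 < g y" by simp
  with z(1) show ?thesis unfolding T_def by blast
qed

lemma open_T: "open T"
proof -
  have "T = {0<..} \<inter> (\<Union>y\<in>{y. 0 < g y}. {..<y})" unfolding T_def by blast
  moreover have "open (\<Union>y\<in>{y. 0 < g y}. {..<y})" by (intro open_UN ballI open_lessThan)
  ultimately show ?thesis by (simp add: open_Int)
qed

lemma T_nonempty: "\<exists>x. x \<in> T"
proof -
  obtain y where "0 < y" "0 < g y" using sup_1[of 0] by auto
  then have "y / 2 \<in> T" by (auto simp: T_def intro!: exI[of _ y])
  then show ?thesis ..
qed

lemma convex_T: "convex T"
proof (rule convexI)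
  fix x y u v :: real
  assume xy: "x \<in> T" "y \<in> T" and uv: "0 \<le> u" "0 \<le> v" "u + v = 1"
  have "u * x + v * y \<le> u * max x y + v * max x y"
    using uv by (intro add_mono mult_left_mono) auto
  then have le: "u * x + v * y \<le> max x y" using uv by (simp flip: distrib_right)
  have "u * min x y + v * min x y \<le> u * x + v * y"
    using uv by (intro add_mono mult_left_mono) auto
  then have "min x y \<le> u * x + v * y" using uv by (simp flip: distrib_right)
  then have pos: "0 < u * x + v * y" using xy[THEN T_pos] by linarith
  have "max x y \<in> T" using xy by (simp add: max_def)
  from T_downward[OF this pos le] show "u *\<^sub>R x + v *\<^sub>R y \<in> T" by simp
qed

text \<open>A convex function on an open set, here \<open>- ln g\<close>, is continuous.\<close>

lemma isCont_g: "x \<in> T \<Longrightarrow> isCont g x"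
proof -
  assume x: "x \<in> T"
  have "convex_on T (\<lambda>x. - ln (g x))"
  proof (rule convex_onI)
    fix t x y :: real assume t: "0 < t" "t < 1" and xy: "x \<in> T" "y \<in> T"
    have "ln (g x powr (1 - t) * g y powr t) \<le> ln (g ((1 - t) * x + t * y))"
      using xy[THEN g_pos] xy[THEN T_pos] log_concave t by (intro ln_mono) auto
    then show "- ln (g ((1 - t) *\<^sub>R x + t *\<^sub>R y)) \<le> (1 - t) * - ln (g x) + t * - ln (g y)"
      using xy[THEN g_pos] by (simp add: ln_mult ln_powr)
  qed (rule convex_T)
  then have "continuous_on T (\<lambda>x. - ln (g x))"
    by (intro convex_on_continuous open_T)
  then have "continuous_on T (\<lambda>x. exp (- (- ln (g x))))"
    by (rule continuous_on_exp[OF continuous_on_minus])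
  then have "continuous_on T g"
    by (rule continuous_on_eq) (use g_pos in auto)
  then show "isCont g x" using x open_T by (simp add: continuous_on_eq_continuous_at)
qed

text \<open>The exceptional \<open>u\<close> is the right end of the support, where \<open>g\<close> may be positive.\<close>

lemma off_T: "\<exists>u. \<forall>x>0. x \<notin> T \<longrightarrow> x \<noteq> u \<longrightarrow> (\<forall>y\<ge>x. g y = 0)"
proof (cases "\<exists>u>0. u \<notin> T \<and> g u \<noteq> 0")
  case True
  then obtain u where u: "0 < u" "u \<notin> T" "g u \<noteq> 0" by blast
  have "g y = 0" if "0 < x" "x \<notin> T" "x \<noteq> u" "x \<le> y" for x y
  proof -
    have "\<not> x < u" using that u nonneg[of u] by (auto simp: T_def less_le)
    then have "u < y" using that by auto
    then show ?thesis using u nonneg[of y] by (auto simp: T_def less_le)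
  qed
  then show ?thesis by blast
next
  case False
  have "g y = 0" if "0 < x" "x \<notin> T" "x \<le> y" for x y
    using False that nonneg[of y] by (cases "x = y") (auto simp: T_def less_le)
  then show ?thesis by blast
qed

lemma set_integrable_S: "set_integrable lborel {0<..} S"
proof -
  obtain k where k: "0 < k" "\<And>x. g x \<le> 2 * exp (- (k * x))" using exponential_decay by blast
  show ?thesis
    by (rule set_integrable_exp_bound[where k = k and C = 2])
       (use k S_le_g S_nonneg order_trans in \<open>fastforce+\<close>)
qed

lemma S_has_derivative: "x \<in> T \<Longrightarrow> (S has_real_derivative - g x) (at x)"
  unfolding S_def[abs_def]
  by (intro tail_integral_has_derivative set_integrable_g isCont_g T_pos) auto

lemma H_has_derivative: "x \<in> T \<Longrightarrow> (H has_real_derivative - S x) (at x)"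
  unfolding H_def[abs_def]
  by (intro tail_integral_has_derivative set_integrable_S DERIV_isCont[OF S_has_derivative] T_pos) auto

lemma S_pos: "x \<in> T \<Longrightarrow> 0 < S x"
proof -
  assume x: "x \<in> T"
  obtain y where y: "x < y" "0 < g y" using x by (auto simp: T_def)
  have x0: "0 < x" using x by (rule T_pos)
  have "(LINT t:{x<..y}|lborel. g y) \<le> S x"
    unfolding S_def set_lebesgue_integral_def
  proof (intro integral_mono set_integrable_g[unfolded set_integrable_def])
    show "indicator {x<..y} t *\<^sub>R g y \<le> indicator {x<..} t *\<^sub>R g t" for t
      using antimono[of t y] x0 nonneg by (auto simp: indicator_def)
    show "integrable lborel (\<lambda>t. indicator {x<..y} t *\<^sub>R g y)"
      unfolding real_scaleR_def using y by (intro integrable_mult_left integrable_real_indicator) auto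
  qed auto
  moreover have "(LINT t:{x<..y}|lborel. g y) = (y - x) * g y"
    using y by (simp add: set_integral_const measure_def)
  ultimately show ?thesis using y by (smt (verit) mult_pos_pos)
qed

lemma H_nonneg: "0 \<le> H x"
  unfolding H_def set_lebesgue_integral_def
  by (intro Bochner_Integration.integral_nonneg) (auto simp: S_nonneg)

text \<open>Since the hazard rate increases, the mean residual life \<open>H / S\<close> is at most \<open>S / g\<close>.\<close>

lemma H_mult_g_le: "0 < x \<Longrightarrow> H x * g x \<le> (S x)\<^sup>2"
proof -
  assume x: "0 < x"
  have "(LINT t:{x<..}|lborel. S t * g x) \<le> (LINT t:{x<..}|lborel. S x * g t)"
  proof (intro set_integral_mono)
    have "set_integrable lborel {x<..} S"
      by (rule set_integrable_subset[OF set_integrable_S]) (use x in auto)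
    then show "set_integrable lborel {x<..} (\<lambda>t. S t * g x)" by simp
    show "set_integrable lborel {x<..} (\<lambda>t. S x * g t)"
      using set_integrable_g[of "{x<..}"] by simp
  qed (use x hazard_mono in auto)
  then show ?thesis by (simp add: H_def S_def power2_eq_square)
qed

text \<open>Sequences that exhaust \<open>T\<close> express limits at its ends alike for bounded and unbounded support.\<close>

definition exhausts :: "(nat \<Rightarrow> real) \<Rightarrow> (nat \<Rightarrow> real) \<Rightarrow> bool" where
  "exhausts l r \<longleftrightarrow> incseq r \<and> decseq l \<and> (\<forall>n. l n < r n) \<and> T = (\<Union>n. {l n..r n})"

lemma exhausts_exists: "\<exists>l r. exhausts l r"
proof -
  define u where "u = (SUP y\<in>{y. 0 < g y}. ereal y)"
  have less_u: "ereal x < u \<longleftrightarrow> (\<exists>y>x. 0 < g y)" for x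
    by (auto simp: u_def less_SUP_iff)
  have T: "T = einterval 0 u" by (auto simp: T_def einterval_def less_u)
  obtain x where x: "x \<in> T" using T_nonempty by blast
  then have "ereal 0 < ereal x" "ereal x < u" by (auto simp: T einterval_def zero_ereal_def)
  then have "0 < u" unfolding zero_ereal_def by (rule less_trans)
  obtain r l :: "nat \<Rightarrow> real"
    where "einterval 0 u = (\<Union>i. {l i .. r i})" "incseq r" "decseq l" "\<And>i. l i < r i"
    by (rule einterval_Icc_approximation[OF \<open>0 < u\<close>]) (rule that)
  then have "exhausts l r" unfolding exhausts_def T by simp
  then show ?thesis by blast
qed

lemma exhausts_in_T:
  assumes "exhausts l r"
  shows "l n \<in> T" "r n \<in> T"
proof -
  have "{l n..r n} \<subseteq> T" "l n \<le> r n"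
    using assms by (auto simp: exhausts_def less_imp_le)
  then show "l n \<in> T" "r n \<in> T" by auto
qed

lemma exhausts_eventually:
  assumes e: "exhausts l r" and t: "t \<in> T"
  shows "\<forall>\<^sub>F n in sequentially. t \<le> r n" "\<forall>\<^sub>F n in sequentially. l n < t"
proof -
  obtain m where "t \<le> r m" using e t by (auto simp: exhausts_def)
  moreover have "r m \<le> r n" if "m \<le> n" for n
    using e that by (simp add: exhausts_def incseq_def)
  ultimately have "t \<le> r n" if "m \<le> n" for n
    using that by (meson order_trans)
  then show "\<forall>\<^sub>F n in sequentially. t \<le> r n" unfolding eventually_sequentially by blast
  have "t / 2 \<in> T" using T_downward[OF t, of "t / 2"] T_pos[OF t] by auto
  then obtain k where "l k \<le> t / 2" using e by (auto simp: exhausts_def)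
  moreover have "l n \<le> l k" if "k \<le> n" for n
    using e that by (simp add: exhausts_def decseq_def)
  ultimately have "l n < t" if "k \<le> n" for n
    using that T_pos[OF t] by (smt (verit) field_sum_of_halves)
  then show "\<forall>\<^sub>F n in sequentially. l n < t" unfolding eventually_sequentially by blast
qed

lemma exhausts_left: "exhausts l r \<Longrightarrow> l \<longlonglongrightarrow> 0"
proof (rule LIMSEQ_I)
  fix e :: real assume ex: "exhausts l r" and e: "0 < e"
  obtain x where x: "x \<in> T" using T_nonempty by blast
  have "min x e \<in> T" using T_downward[OF x, of "min x e"] T_pos[OF x] e by auto
  from exhausts_eventually(2)[OF ex this] obtain N where "\<And>n. N \<le> n \<Longrightarrow> l n < e"
    by (auto simp: eventually_sequentially)
  moreover have "0 < l n" for n using T_pos exhausts_in_T(1)[OF ex] by blast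
  ultimately have "\<forall>n\<ge>N. norm (l n - 0) < e" by (simp add: abs_of_pos)
  then show "\<exists>N. \<forall>n\<ge>N. norm (l n - 0) < e" ..
qed

lemma tail_limits:
  fixes \<phi> :: "real \<Rightarrow> real"
  assumes e: "exhausts l r" and int: "set_integrable lborel {0<..} \<phi>"
    and off: "\<And>x. 0 < x \<Longrightarrow> (\<forall>y\<ge>x. g y = 0) \<Longrightarrow> \<phi> x = 0"
  shows "(\<lambda>n. LINT t:{r n<..}|lborel. \<phi> t) \<longlonglongrightarrow> 0"
    and "(\<lambda>n. LINT t:{l n<..}|lborel. \<phi> t) \<longlonglongrightarrow> (LINT t:{0<..}|lborel. \<phi> t)"
proof -
  obtain u where u: "\<And>x. 0 < x \<Longrightarrow> x \<notin> T \<Longrightarrow> x \<noteq> u \<Longrightarrow> \<phi> x = 0" using off_T off by blast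
  have sub: "set_integrable lborel {a<..} \<phi>" if "0 \<le> a" for a
    by (rule set_integrable_subset[OF int]) (use that in auto)
  have pos: "0 < l n" "0 < r n" for n using T_pos exhausts_in_T[OF e] by auto
  have "(\<lambda>n. LINT t:{r n<..}|lborel. \<phi> t) \<longlonglongrightarrow> (\<integral>t. 0 \<partial>(lborel :: real measure))"
    unfolding set_lebesgue_integral_def
  proof (rule integral_dominated_convergence)
    show "integrable lborel (\<lambda>t. norm (indicator {0<..} t *\<^sub>R \<phi> t))"
      using int unfolding set_integrable_def by (rule integrable_norm)
    show "AE t in lborel. (\<lambda>n. indicator {r n<..} t *\<^sub>R \<phi> t) \<longlonglongrightarrow> 0"
      using AE_lborel_singleton[of u]
    proof eventually_elim
      case (elim t)
      consider "t \<in> T" | "t \<le> 0" | "0 < t" "t \<notin> T" by fastforce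
      then have "\<forall>\<^sub>F n in sequentially. indicator {r n<..} t *\<^sub>R \<phi> t = 0"
      proof cases
        case 1
        then show ?thesis by (rule eventually_mono[OF exhausts_eventually(1)[OF e]]) auto
      next
        case 2
        then have "\<not> r n < t" for n using pos(2)[of n] by linarith
        then show ?thesis by simp
      next
        case 3
        then show ?thesis using u elim by simp
      qed
      then show ?case by (rule tendsto_eventually)
    qed
    show "AE t in lborel. norm (indicator {r n<..} t *\<^sub>R \<phi> t) \<le> norm (indicator {0<..} t *\<^sub>R \<phi> t)" for n
      using pos(2)[of n] by (auto simp: indicator_def)
    show "(\<lambda>t. indicator {r n<..} t *\<^sub>R \<phi> t) \<in> borel_measurable lborel" for n
      using sub[of "r n"] pos(2)[of n] unfolding set_integrable_def
      by (intro borel_measurable_integrable) simp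
  qed auto
  then show "(\<lambda>n. LINT t:{r n<..}|lborel. \<phi> t) \<longlonglongrightarrow> 0" by simp
  show "(\<lambda>n. LINT t:{l n<..}|lborel. \<phi> t) \<longlonglongrightarrow> (LINT t:{0<..}|lborel. \<phi> t)"
    unfolding set_lebesgue_integral_def
  proof (rule integral_dominated_convergence)
    show "integrable lborel (\<lambda>t. norm (indicator {0<..} t *\<^sub>R \<phi> t))"
      using int unfolding set_integrable_def by (rule integrable_norm)
    show "AE t in lborel. (\<lambda>n. indicator {l n<..} t *\<^sub>R \<phi> t) \<longlonglongrightarrow> indicator {0<..} t *\<^sub>R \<phi> t"
      using AE_lborel_singleton[of u]
    proof eventually_elim
      case (elim t)
      consider "t \<in> T" | "t \<le> 0" | "0 < t" "t \<notin> T" by fastforce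
      then have "\<forall>\<^sub>F n in sequentially. indicator {l n<..} t *\<^sub>R \<phi> t = indicator {0<..} t *\<^sub>R \<phi> t"
      proof cases
        case 1
        then show ?thesis
          by (intro eventually_mono[OF exhausts_eventually(2)[OF e 1]]) (auto simp: T_pos)
      next
        case 2
        then have "\<not> l n < t" for n using pos(1)[of n] by linarith
        then show ?thesis using 2 by simp
      next
        case 3
        then show ?thesis using u elim by simp
      qed
      then show ?case by (rule tendsto_eventually)
    qed
    show "AE t in lborel. norm (indicator {l n<..} t *\<^sub>R \<phi> t) \<le> norm (indicator {0<..} t *\<^sub>R \<phi> t)" for n
      using pos(1)[of n] by (auto simp: indicator_def)
    show "(\<lambda>t. indicator {l n<..} t *\<^sub>R \<phi> t) \<in> borel_measurable lborel" for n
      using sub[of "l n"] pos(1)[of n] unfolding set_integrable_def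
      by (intro borel_measurable_integrable) simp
    show "(\<lambda>t. indicator {0<..} t *\<^sub>R \<phi> t) \<in> borel_measurable lborel"
      using int unfolding set_integrable_def by (rule borel_measurable_integrable)
  qed
qed

lemma S_off: "0 < x \<Longrightarrow> \<forall>y\<ge>x. g y = 0 \<Longrightarrow> S x = 0"
  unfolding S_def set_lebesgue_integral_def
  by (rule integral_eq_zero_AE) (auto simp: indicator_def)

lemma S_limits:
  assumes "exhausts l r"
  shows "(\<lambda>n. S (l n)) \<longlonglongrightarrow> 1" "(\<lambda>n. S (r n)) \<longlonglongrightarrow> 0"
  using tail_limits[OF assms set_integrable_g[of "{0<..}"]] S_0 by (simp_all add: S_def)

lemma H_limits:
  assumes "exhausts l r"
  shows "(\<lambda>n. H (l n)) \<longlonglongrightarrow> H 0" "(\<lambda>n. H (r n)) \<longlonglongrightarrow> 0"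
  using tail_limits[OF assms set_integrable_S S_off] by (simp_all add: H_def)

text \<open>The form in which \<open>set_integral_ge_increment\<close> is used: integrands that vanish beyond the support
have the same integral over \<open>T\<close> and over the half-line.\<close>

lemma integral_ge_increment:
  assumes int: "set_integrable lborel {0<..} \<phi>"
    and off: "\<And>x. 0 < x \<Longrightarrow> \<forall>y\<ge>x. g y = 0 \<Longrightarrow> \<phi> x = 0"
    and N: "finite N" and cont: "continuous_on T \<Psi>"
    and der: "\<And>x. x \<in> T - N \<Longrightarrow> (\<Psi> has_real_derivative \<Psi>' x) (at x)"
    and le: "\<And>x. x \<in> T - N \<Longrightarrow> \<Psi>' x \<le> \<phi> x"
    and lim: "\<And>l r. exhausts l r \<Longrightarrow> (\<lambda>n. \<Psi> (l n)) \<longlonglongrightarrow> A"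
      "\<And>l r. exhausts l r \<Longrightarrow> (\<lambda>n. \<Psi> (r n)) \<longlonglongrightarrow> B"
  shows "B - A \<le> (LINT x:{0<..}|lborel. \<phi> x)"
proof -
  obtain l r where e: "exhausts l r" using exhausts_exists by blast
  obtain u where u: "\<And>x. 0 < x \<Longrightarrow> x \<notin> T \<Longrightarrow> x \<noteq> u \<Longrightarrow> \<phi> x = 0" using off_T off by blast
  have T_sets: "T \<in> sets borel" using open_T by simp
  have intT: "set_integrable lborel T \<phi>"
    by (rule set_integrable_subset[OF int]) (use T_sets T_pos in auto)
  have "B - A \<le> (LINT x:T|lborel. \<phi> x)"
    using e lim[OF e] unfolding exhausts_def
    by (intro set_integral_ge_increment[OF _ _ _ _ intT N cont der le]) auto
  also have "(LINT x:T|lborel. \<phi> x) = (LINT x:{0<..}|lborel. \<phi> x)"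
    unfolding set_lebesgue_integral_def
  proof (rule integral_cong_AE)
    show "AE x in lborel. indicator T x *\<^sub>R \<phi> x = indicator {0<..} x *\<^sub>R \<phi> x"
      using AE_lborel_singleton[of u] by eventually_elim (use u T_pos in \<open>auto simp: indicator_def\<close>)
  qed (use int intT in \<open>auto simp: set_integrable_def simp del: measurable_lborel1 intro!: borel_measurable_integrable\<close>)
  finally show ?thesis .
qed

section \<open>Mean, second moment and power integral against entropy\<close>

lemma T_interval: "x \<in> T \<Longrightarrow> y \<in> T \<Longrightarrow> {x..y} \<subseteq> T"
  using T_downward T_pos by (meson atLeastAtMost_iff less_le_trans subsetI)

lemma S_strict:
  assumes "x \<in> T" "y \<in> T" "x < y"
  shows "S y < S x"
proof (rule DERIV_neg_imp_decreasing[OF assms(3)])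
  fix t assume "x \<le> t" "t \<le> y"
  then have "t \<in> T" using T_interval[OF assms(1,2)] by auto
  then show "\<exists>d. (S has_real_derivative d) (at t) \<and> d < 0"
    using S_has_derivative g_pos by (intro exI[of _ "- g t"]) auto
qed

text \<open>The derivative of \<open>2 g(x) H - S\<^sup>2\<close>, with \<open>x\<close> fixed, is \<open>2 S (g - g(x)) \<le> 0\<close> to the right of \<open>x\<close>, and
the function tends to \<open>0\<close>. Together with \<open>H_mult_g_le\<close> this confines \<open>S\<^sup>2 / (g H)\<close> to \<open>[1, 2]\<close>.\<close>

lemma S_sq_le: 
  assumes x: "x \<in> T"
  shows "(S x)\<^sup>2 \<le> 2 * g x * H x"
proof -
  obtain l r where e: "exhausts l r" using exhausts_exists by blast
  have "0 \<le> 2 * g x * H x - (S x)\<^sup>2"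
  proof (rule tendsto_upperbound)
    have "(\<lambda>n. 2 * g x * H (r n) - (S (r n))\<^sup>2) \<longlonglongrightarrow> 2 * g x * 0 - 0\<^sup>2"
      using S_limits(2)[OF e] H_limits(2)[OF e] by (intro tendsto_intros)
    then show "(\<lambda>n. 2 * g x * H (r n) - (S (r n))\<^sup>2) \<longlonglongrightarrow> 0" by simp
    show "\<forall>\<^sub>F n in sequentially. 2 * g x * H (r n) - (S (r n))\<^sup>2 \<le> 2 * g x * H x - (S x)\<^sup>2"
      using exhausts_eventually(1)[OF e x]
    proof eventually_elim
      case (elim n)
      show ?case
      proof (rule DERIV_nonpos_imp_nonincreasing[OF elim])
        fix t assume t: "x \<le> t" "t \<le> r n"
        then have tT: "t \<in> T" using T_interval[OF x exhausts_in_T(2)[OF e, of n]] by auto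
        have "((\<lambda>t. 2 * g x * H t - (S t)\<^sup>2) has_real_derivative 2 * S t * (g t - g x)) (at t)"
          by (auto intro!: derivative_eq_intros S_has_derivative H_has_derivative tT simp: algebra_simps)
        moreover have "2 * S t * (g t - g x) \<le> 0"
          using S_nonneg[of t] antimono[OF T_pos[OF x] t(1)] by (simp add: mult_nonneg_nonpos)
        ultimately show "\<exists>d. ((\<lambda>t. 2 * g x * H t - (S t)\<^sup>2) has_real_derivative d) (at t) \<and> d \<le> 0"
          by blast
      qed
    qed
  qed simp
  then show ?thesis by simp
qed

lemma H_pos:
  assumes "x \<in> T"
  shows "0 < H x"
proof -
  have "0 < 2 * g x * H x" using S_sq_le[OF assms] S_pos[OF assms] by (smt (verit) zero_less_power2)
  then show ?thesis using g_pos[OF assms] by (simp add: zero_less_mult_iff)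
qed

text \<open>The mean residual life decreases, by \<open>H_mult_g_le\<close>.\<close>

lemma H_le_S:
  assumes x: "x \<in> T"
  shows "H x \<le> H 0 * S x"
proof -
  obtain l r where e: "exhausts l r" using exhausts_exists by blast
  have "H x / S x \<le> H 0"
  proof (rule tendsto_lowerbound)
    have "(\<lambda>n. H (l n) / S (l n)) \<longlonglongrightarrow> H 0 / 1"
      using S_limits(1)[OF e] H_limits(1)[OF e] by (intro tendsto_intros) auto
    then show "(\<lambda>n. H (l n) / S (l n)) \<longlonglongrightarrow> H 0" by simp
    show "\<forall>\<^sub>F n in sequentially. H x / S x \<le> H (l n) / S (l n)"
      using exhausts_eventually(2)[OF e x]
    proof eventually_elim
      case (elim n)
      show ?case
      proof (rule DERIV_nonpos_imp_nonincreasing[of "l n" x])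
        show "l n \<le> x" using elim by simp
        fix t assume t: "l n \<le> t" "t \<le> x"
        then have tT: "t \<in> T" using T_interval[OF exhausts_in_T(1)[OF e, of n] x] by auto
        have "((\<lambda>t. H t / S t) has_real_derivative (H t * g t - (S t)\<^sup>2) / (S t)\<^sup>2) (at t)"
          using S_pos[OF tT]
          by (auto intro!: derivative_eq_intros S_has_derivative H_has_derivative tT
              simp: power2_eq_square algebra_simps)
        moreover have "(H t * g t - (S t)\<^sup>2) / (S t)\<^sup>2 \<le> 0"
          using H_mult_g_le[OF T_pos[OF tT]] by (intro divide_nonpos_nonneg) auto
        ultimately show "\<exists>d. ((\<lambda>t. H t / S t) has_real_derivative d) (at t) \<and> d \<le> 0"
          by blast
      qed
    qed
  qed simp
  then show ?thesis using S_pos[OF x] by (simp add: field_simps)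
qed

lemma H_0_pos: "0 < H 0"
  using T_nonempty H_le_S H_pos S_pos by (metis less_le_trans zero_less_mult_pos2)

lemma moment_tail:
  fixes \<phi> :: "real \<Rightarrow> real"
  assumes e: "exhausts l r" and int: "set_integrable lborel {0<..} \<phi>"
    and intk: "set_integrable lborel {0<..} (\<lambda>t. t ^ k * \<phi> t)" and nonneg: "\<And>t. 0 \<le> \<phi> t"
    and off: "\<And>x. 0 < x \<Longrightarrow> (\<forall>y\<ge>x. g y = 0) \<Longrightarrow> \<phi> x = 0"
  shows "(\<lambda>n. r n ^ k * (LINT t:{r n<..}|lborel. \<phi> t)) \<longlonglongrightarrow> 0"
proof (rule tendsto_sandwich[OF _ _ tendsto_const])
  have pos: "0 < r n" for n using T_pos exhausts_in_T(2)[OF e] by blast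
  show "(\<lambda>n. LINT t:{r n<..}|lborel. t ^ k * \<phi> t) \<longlonglongrightarrow> 0"
    by (rule tail_limits(1)[OF e intk]) (simp add: off)
  have sub: "set_integrable lborel {r n<..} f" if "set_integrable lborel {0<..} f" for n and f :: "real \<Rightarrow> real"
    by (rule set_integrable_subset[OF that]) (use pos[of n] in auto)
  have "r n ^ k * (LINT t:{r n<..}|lborel. \<phi> t) \<le> (LINT t:{r n<..}|lborel. t ^ k * \<phi> t)" for n
  proof -
    have "(LINT t:{r n<..}|lborel. r n ^ k * \<phi> t) \<le> (LINT t:{r n<..}|lborel. t ^ k * \<phi> t)"
    proof (rule set_integral_mono)
      show "set_integrable lborel {r n<..} (\<lambda>t. r n ^ k * \<phi> t)" using sub[OF int] by simp
      show "r n ^ k * \<phi> t \<le> t ^ k * \<phi> t" if "t \<in> {r n<..}" for t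
        using that pos[of n] nonneg by (intro mult_right_mono power_mono) auto
    qed (rule sub[OF intk])
    then show ?thesis by simp
  qed
  then show "\<forall>\<^sub>F n in sequentially. r n ^ k * (LINT t:{r n<..}|lborel. \<phi> t) \<le> (LINT t:{r n<..}|lborel. t ^ k * \<phi> t)"
    by simp
  have "0 \<le> (LINT t:{r n<..}|lborel. \<phi> t)" for n
    unfolding set_lebesgue_integral_def using nonneg
    by (intro Bochner_Integration.integral_nonneg) (simp add: indicator_def)
  then show "\<forall>\<^sub>F n in sequentially. 0 \<le> r n ^ k * (LINT t:{r n<..}|lborel. \<phi> t)"
    using pos by (simp add: less_imp_le)
qed

lemma set_integrable_moment_S: "set_integrable lborel {0<..} (\<lambda>t. t ^ k * S t)"
proof (rule set_integrable_bound[OF moment_integrable[of k]])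
  show "AE x in lborel. x \<in> {0<..} \<longrightarrow> norm (x ^ k * S x) \<le> norm (x ^ k * g x)"
    using S_le_g S_nonneg nonneg by (auto intro!: AE_I2 mult_left_mono simp: abs_mult)
qed (simp add: set_borel_measurable_def)

lemma moment_S_limit:
  assumes "exhausts l r"
  shows "(\<lambda>n. r n ^ k * S (r n)) \<longlonglongrightarrow> 0" "(\<lambda>n. r n ^ k * H (r n)) \<longlonglongrightarrow> 0"
  using moment_tail[OF assms set_integrable_g moment_integrable nonneg, of k]
    moment_tail[OF assms set_integrable_S set_integrable_moment_S S_nonneg S_off, of k]
  by (simp_all add: S_def H_def)

text \<open>Integration by parts: the derivative of \<open>x S(x)\<close> is \<open>S - x g\<close>, and \<open>x S(x)\<close> vanishes at both ends.\<close>

lemma mean_eq: "(LINT x:{0<..}|lborel. x * g x) = H 0"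
proof -
  have int: "set_integrable lborel {0<..} (\<lambda>x. x * g x)" using moment_integrable[of 1] by simp
  have der: "((\<lambda>x. x * S x) has_real_derivative S x - x * g x) (at x)" if "x \<in> T" for x
    using that by (auto intro!: derivative_eq_intros S_has_derivative simp: algebra_simps)
  have cont: "continuous_on T (\<lambda>x. x * S x)"
    using der by (meson DERIV_isCont continuous_at_imp_continuous_on)
  have lim: "(\<lambda>n. l n * S (l n)) \<longlonglongrightarrow> 0" "(\<lambda>n. r n * S (r n)) \<longlonglongrightarrow> 0" if "exhausts l r" for l r
    using tendsto_mult[OF exhausts_left[OF that] S_limits(1)[OF that]]
      moment_S_limit(1)[OF that, of 1] by simp_all
  have "0 - 0 \<le> (LINT x:{0<..}|lborel. S x - x * g x)"
    by (rule integral_ge_increment[where N = "{}" and \<Psi> = "\<lambda>x. x * S x" and \<Psi>' = "\<lambda>x. S x - x * g x"])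
       (use set_integrable_S int der cont lim in \<open>auto simp: S_off\<close>)
  moreover have "- 0 - (- 0) \<le> (LINT x:{0<..}|lborel. x * g x - S x)"
  proof (rule integral_ge_increment[where N = "{}" and \<Psi> = "\<lambda>x. - (x * S x)" and \<Psi>' = "\<lambda>x. x * g x - S x"])
    show "continuous_on T (\<lambda>x. - (x * S x))" using cont by (rule continuous_on_minus)
    show "((\<lambda>x. - (x * S x)) has_real_derivative x * g x - S x) (at x)" if "x \<in> T - {}" for x
      using DERIV_minus[OF der[of x]] that by simp
    show "(\<lambda>n. - (l n * S (l n))) \<longlonglongrightarrow> - 0" "(\<lambda>n. - (r n * S (r n))) \<longlonglongrightarrow> - 0"
      if "exhausts l r" for l r
      using tendsto_minus[OF lim(1)[OF that]] tendsto_minus[OF lim(2)[OF that]] by simp_all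
  qed (use set_integrable_S int in \<open>auto simp: S_off\<close>)
  ultimately show ?thesis using set_integrable_S int by (simp add: H_def)
qed

text \<open>Since \<open>S \<le> g\<close>, it suffices that \<open>\<integral> g ln S = - 1\<close>, and \<open>g ln S\<close> is the derivative of \<open>S - S ln S\<close>.\<close>

lemma entropy_le_1: "- 1 \<le> (LINT x:{0<..}|lborel. g x * ln (g x))"
proof -
  have der: "((\<lambda>x. S x - S x * ln (S x)) has_real_derivative g x * ln (S x)) (at x)" if "x \<in> T" for x
    using S_pos[OF that] that by (auto intro!: derivative_eq_intros S_has_derivative simp: field_simps)
  have "0 - 1 \<le> (LINT x:{0<..}|lborel. g x * ln (g x))"
  proof (rule integral_ge_increment[where N = "{}" and \<Psi> = "\<lambda>x. S x - S x * ln (S x)"])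
    show "continuous_on T (\<lambda>x. S x - S x * ln (S x))"
      using der by (meson DERIV_isCont continuous_at_imp_continuous_on)
    fix x assume "x \<in> T - {}"
    then have x: "x \<in> T" by simp
    show "((\<lambda>x. S x - S x * ln (S x)) has_real_derivative g x * ln (S x)) (at x)" by (rule der[OF x])
    show "g x * ln (S x) \<le> g x * ln (g x)"
      using S_pos[OF x] S_le_g[OF T_pos[OF x]] g_pos[OF x] by (intro mult_left_mono ln_mono) auto
  next
    fix l r assume e: "exhausts l r"
    have "(\<lambda>n. S (l n) - S (l n) * ln (S (l n))) \<longlonglongrightarrow> 1 - 1 * ln 1"
      using S_limits(1)[OF e] by (intro tendsto_intros) auto
    then show "(\<lambda>n. S (l n) - S (l n) * ln (S (l n))) \<longlonglongrightarrow> 1" by simp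
    have "(\<lambda>n. S (r n) - S (r n) * ln (S (r n))) \<longlonglongrightarrow> 0 - 0"
      using S_limits(2)[OF e] S_nonneg by (intro tendsto_diff tendsto_mult_ln_zero) auto
    then show "(\<lambda>n. S (r n) - S (r n) * ln (S (r n))) \<longlonglongrightarrow> 0" by simp
  qed (use entropy_integrable in auto)
  then show ?thesis by simp
qed

text \<open>With equality for exponential densities. The integrand \<open>- g ln g - x\<^sup>2 g / (2 m\<^sup>2)\<close>, where \<open>m = H 0\<close>,
is bounded below by the derivative of an explicit function \<open>\<Psi>\<close> of \<open>x\<close>, \<open>S\<close> and \<open>H\<close>, whose values at
the ends of \<open>T\<close> are \<open>- ln m\<close> and \<open>0\<close>. To find \<open>\<Psi>\<close>, write \<open>- ln g = ln v + ln H - 2 ln S\<close> with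
\<open>v = S\<^sup>2 / (g H)\<close>, and replace \<open>ln v\<close> by a lower bound that is linear in \<open>v\<close>, namely
\<open>v - 4/3 + e\<^sup>2 (2 - v)/3\<close> with \<open>e = H / (m S)\<close>. As \<open>g v\<close> equals \<open>S\<^sup>2 / H\<close>, the result is an exact
derivative. The lower bound holds since \<open>e \<le> 1\<close> and \<open>ln v \<ge> 2/3 (v - 1)\<close> for \<open>1 \<le> v \<le> 2\<close>.\<close>

lemma second_moment_le:
  "(LINT x:{0<..}|lborel. x\<^sup>2 * g x)
    \<le> 2 * (H 0)\<^sup>2 * (- (LINT x:{0<..}|lborel. g x * ln (g x)) - ln (H 0))"
proof -
  define m where "m = H 0"
  have m: "0 < m" using H_0_pos by (simp add: m_def)
  define \<Psi> where "\<Psi> x = 2 * (S x * ln (S x)) - S x * ln (H x) + 2 / 3 * ((H x)\<^sup>2 / (S x * m\<^sup>2) - S x)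
      + (x * H x + x\<^sup>2 * S x / 2) / m\<^sup>2" for x
  define \<Psi>' where "\<Psi>' x = - 2 * g x * ln (S x) - 2 * g x + g x * ln (H x) + (S x)\<^sup>2 / H x
      + 2 / 3 * ((- 2 * H x + (H x)\<^sup>2 * g x / (S x)\<^sup>2) / m\<^sup>2 + g x) + H x / m\<^sup>2 - x\<^sup>2 * g x / (2 * m\<^sup>2)" for x
  have int: "set_integrable lborel {0<..} (\<lambda>x. g x * ln (g x))"
    "set_integrable lborel {0<..} (\<lambda>x. x\<^sup>2 * g x / (2 * m\<^sup>2))"
    using entropy_integrable moment_integrable[of 2] by simp_all
  have int': "set_integrable lborel {0<..} (\<lambda>x. - (g x * ln (g x)))"
    using int(1) unfolding set_integrable_def by simp
  have der: "(\<Psi> has_real_derivative \<Psi>' x) (at x)" if x: "x \<in> T" for x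
  proof -
    note pos = S_pos[OF x] H_pos[OF x]
    have 1: "((\<lambda>x. S x * ln (S x)) has_real_derivative - g x * ln (S x) - g x) (at x)"
      using pos by (auto intro!: derivative_eq_intros S_has_derivative H_has_derivative x simp: field_simps power2_eq_square)
    have 2: "((\<lambda>x. S x * ln (H x)) has_real_derivative - g x * ln (H x) - (S x)\<^sup>2 / H x) (at x)"
      using pos by (auto intro!: derivative_eq_intros S_has_derivative H_has_derivative x simp: field_simps power2_eq_square)
    have 3: "((\<lambda>x. (H x)\<^sup>2 / S x) has_real_derivative - 2 * H x + (H x)\<^sup>2 * g x / (S x)\<^sup>2) (at x)"
      using pos by (auto intro!: derivative_eq_intros S_has_derivative H_has_derivative x simp: field_simps power2_eq_square)
    have 4: "((\<lambda>x. x * H x + x\<^sup>2 * S x / 2) has_real_derivative H x - x\<^sup>2 * g x / 2) (at x)"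
      by (auto intro!: derivative_eq_intros S_has_derivative H_has_derivative x simp: field_simps power2_eq_square)
    have "((\<lambda>x. 2 * (S x * ln (S x)) - S x * ln (H x) + 2 / 3 * ((H x)\<^sup>2 / S x / m\<^sup>2 - S x)
        + (x * H x + x\<^sup>2 * S x / 2) / m\<^sup>2) has_real_derivative
        2 * (- g x * ln (S x) - g x) - (- g x * ln (H x) - (S x)\<^sup>2 / H x)
        + 2 / 3 * ((- 2 * H x + (H x)\<^sup>2 * g x / (S x)\<^sup>2) / m\<^sup>2 - (- g x))
        + (H x - x\<^sup>2 * g x / 2) / m\<^sup>2) (at x)"
      by (intro DERIV_add DERIV_diff DERIV_cmult DERIV_cdivide 1 2 3 4 S_has_derivative x)
    then show ?thesis
      unfolding \<Psi>_def[abs_def] \<Psi>'_def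
      by (simp add: algebra_simps diff_divide_distrib)
  qed
  have le: "\<Psi>' x \<le> - (g x * ln (g x)) - x\<^sup>2 * g x / (2 * m\<^sup>2)" if x: "x \<in> T" for x
  proof -
    note pos = S_pos[OF x] H_pos[OF x] g_pos[OF x]
    define v where "v = (S x)\<^sup>2 / (g x * H x)"
    define e where "e = H x / (S x * m)"
    have v: "1 \<le> v" "v \<le> 2"
      using H_mult_g_le[OF T_pos[OF x]] S_sq_le[OF x] pos by (auto simp: v_def field_simps)
    have e: "0 < e" "e \<le> 1" using H_le_S[OF x] pos m by (auto simp: e_def m_def field_simps)
    have lnv: "ln v = 2 * ln (S x) - ln (g x) - ln (H x)"
      using pos by (simp add: v_def ln_div ln_mult ln_realpow)
    have e2: "e\<^sup>2 \<le> 1" using e by (simp add: power_le_one)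
    \<comment> \<open>This is the linear lower bound for \<open>ln v\<close>.\<close>
    have key: "- ln v + v - 4 / 3 + e\<^sup>2 * (2 - v) / 3 \<le> 0"
    proof -
      have "e\<^sup>2 * (2 - v) \<le> 1 * (2 - v)" using e2 v by (intro mult_right_mono) auto
      then show ?thesis using ln_ge_two_thirds[OF v] by (simp add: field_simps)
    qed
    have 1: "(S x)\<^sup>2 / H x = g x * v" "(H x)\<^sup>2 * g x / (S x)\<^sup>2 / m\<^sup>2 = g x * e\<^sup>2" "H x / m\<^sup>2 = g x * (e\<^sup>2 * v)"
      using pos m by (simp_all add: v_def e_def field_simps power2_eq_square)
    have "\<Psi>' x + g x * ln (g x) + x\<^sup>2 * g x / (2 * m\<^sup>2)
        = g x * (- (2 * ln (S x) - ln (g x) - ln (H x))) - 4 / 3 * g x + (S x)\<^sup>2 / H x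
          + 2 / 3 * ((H x)\<^sup>2 * g x / (S x)\<^sup>2 / m\<^sup>2) - (H x / m\<^sup>2) / 3"
      unfolding \<Psi>'_def by (simp add: algebra_simps add_divide_distrib diff_divide_distrib)
    also have "\<dots> = g x * (- ln v + v - 4 / 3 + e\<^sup>2 * (2 - v) / 3)"
      unfolding 1 lnv by (simp add: field_simps)
    also have "\<dots> \<le> 0" using key pos by (simp add: mult_nonneg_nonpos)
    finally show ?thesis by simp
  qed
  have "0 - (- ln m) \<le> (LINT x:{0<..}|lborel. - (g x * ln (g x)) - x\<^sup>2 * g x / (2 * m\<^sup>2))"
  proof (rule integral_ge_increment[where N = "{}" and \<Psi> = \<Psi> and \<Psi>' = \<Psi>'])
    show "continuous_on T \<Psi>"
      using der by (meson DERIV_isCont continuous_at_imp_continuous_on)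
    show "set_integrable lborel {0<..} (\<lambda>x. - (g x * ln (g x)) - x\<^sup>2 * g x / (2 * m\<^sup>2))"
      using int' int(2) by (rule set_integral_diff)
  next
    fix l r assume e: "exhausts l r"
    have "(\<lambda>n. \<Psi> (l n)) \<longlonglongrightarrow> 2 * (1 * ln 1) - 1 * ln m + 2 / 3 * (m\<^sup>2 / (1 * m\<^sup>2) - 1)
      + (0 * m + 0\<^sup>2 * 1 / 2) / m\<^sup>2"
      unfolding \<Psi>_def using S_limits(1)[OF e] H_limits(1)[OF e, folded m_def] exhausts_left[OF e] m
      by (intro tendsto_intros) auto
    then show "(\<lambda>n. \<Psi> (l n)) \<longlonglongrightarrow> - ln m" using m by simp
    have rT: "r n \<in> T" for n by (rule exhausts_in_T(2)[OF e])
    have SlnS: "(\<lambda>n. S (r n) * ln (S (r n))) \<longlonglongrightarrow> 0"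
      using S_limits(2)[OF e] S_nonneg by (intro tendsto_mult_ln_zero) auto
    have SlnH: "(\<lambda>n. S (r n) * ln (H (r n))) \<longlonglongrightarrow> 0"
    proof (rule tendsto_sandwich)
      have "S (r n) * (2 * ln (S (r n)) - ln 2) \<le> S (r n) * ln (H (r n))" for n
      proof -
        note S_sq_le[OF rT[of n]]
        also have "2 * g (r n) * H (r n) \<le> 2 * 1 * H (r n)"
          using le_1 H_nonneg by (intro mult_right_mono mult_left_mono) auto
        finally have "ln ((S (r n))\<^sup>2 / 2) \<le> ln (H (r n))"
          using S_pos[OF rT[of n]] by (intro ln_mono) auto
        then show ?thesis using S_pos[OF rT[of n]]
          by (intro mult_left_mono) (auto simp: ln_div ln_realpow)
      qed
      then show "\<forall>\<^sub>F n in sequentially. 2 * (S (r n) * ln (S (r n))) - S (r n) * ln 2 \<le> S (r n) * ln (H (r n))"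
        by (simp add: algebra_simps)
      show "(\<lambda>n. 2 * (S (r n) * ln (S (r n))) - S (r n) * ln 2) \<longlonglongrightarrow> 0"
        using tendsto_diff[OF tendsto_mult[OF tendsto_const[of 2] SlnS]
            tendsto_mult[OF S_limits(2)[OF e] tendsto_const[of "ln 2"]]] by simp
      have "S (r n) * ln (H (r n)) \<le> S (r n) * (ln m + ln (S (r n)))" for n
      proof -
        have "ln (H (r n)) \<le> ln (m * S (r n))"
          using H_le_S[OF rT[of n]] H_pos[OF rT[of n]] by (intro ln_mono) (auto simp: m_def)
        also have "\<dots> = ln m + ln (S (r n))" using m S_pos[OF rT[of n]] by (simp add: ln_mult)
        finally show ?thesis using S_nonneg by (intro mult_left_mono)
      qed
      then show "\<forall>\<^sub>F n in sequentially. S (r n) * ln (H (r n)) \<le> S (r n) * ln m + S (r n) * ln (S (r n))"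
        by (simp add: algebra_simps)
      show "(\<lambda>n. S (r n) * ln m + S (r n) * ln (S (r n))) \<longlonglongrightarrow> 0"
        using tendsto_add[OF tendsto_mult[OF S_limits(2)[OF e] tendsto_const[of "ln m"]] SlnS] by simp
    qed
    have HHS: "(\<lambda>n. (H (r n))\<^sup>2 / (S (r n) * m\<^sup>2)) \<longlonglongrightarrow> 0"
    proof (rule tendsto_sandwich[OF _ _ tendsto_const])
      show "(\<lambda>n. H (r n) * (1 / m)) \<longlonglongrightarrow> 0"
        using tendsto_mult[OF H_limits(2)[OF e] tendsto_const[of "1 / m"]] by simp
      have "(H (r n))\<^sup>2 / (S (r n) * m\<^sup>2) \<le> H (r n) * (1 / m)" for n
      proof -
        have "H (r n) * H (r n) \<le> H (r n) * (m * S (r n))"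
          using H_le_S[OF rT[of n]] H_nonneg by (intro mult_left_mono) (auto simp: m_def)
        then have "(H (r n))\<^sup>2 / (S (r n) * m\<^sup>2) \<le> H (r n) * (m * S (r n)) / (S (r n) * m\<^sup>2)"
          using S_nonneg by (intro divide_right_mono) (auto simp: power2_eq_square)
        also have "\<dots> = H (r n) * (1 / m)"
          using m S_pos[OF rT[of n]] by (simp add: power2_eq_square)
        finally show ?thesis .
      qed
      then show "\<forall>\<^sub>F n in sequentially. (H (r n))\<^sup>2 / (S (r n) * m\<^sup>2) \<le> H (r n) * (1 / m)" by simp
      show "\<forall>\<^sub>F n in sequentially. 0 \<le> (H (r n))\<^sup>2 / (S (r n) * m\<^sup>2)"
        using S_nonneg by (simp add: divide_nonneg_nonneg)
    qed
    have "(\<lambda>n. \<Psi> (r n)) \<longlonglongrightarrow> 2 * 0 - 0 + 2 / 3 * (0 - 0) + (0 + 0 / 2) / m\<^sup>2"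
      unfolding \<Psi>_def
      using S_limits(2)[OF e] moment_S_limit(1)[OF e, of 2] moment_S_limit(2)[OF e, of 1] m
      by (intro tendsto_intros SlnS SlnH HHS) auto
    then show "(\<lambda>n. \<Psi> (r n)) \<longlonglongrightarrow> 0" by simp
  qed (use der le in auto)
  also have "\<dots> = - (LINT x:{0<..}|lborel. g x * ln (g x)) - (LINT x:{0<..}|lborel. x\<^sup>2 * g x) / (2 * m\<^sup>2)"
    using int' int by (simp add: set_integral_uminus)
  finally have "(LINT x:{0<..}|lborel. x\<^sup>2 * g x) / (2 * m\<^sup>2) \<le> - (LINT x:{0<..}|lborel. g x * ln (g x)) - ln m"
    by simp
  then have "(LINT x:{0<..}|lborel. x\<^sup>2 * g x) \<le> (- (LINT x:{0<..}|lborel. g x * ln (g x)) - ln m) * (2 * m\<^sup>2)"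
    using m by (subst (asm) pos_divide_le_eq) auto
  then show ?thesis by (simp add: m_def mult.commute)
qed

text \<open>Regard \<open>\<phi>\<close> as a function of the tail mass \<open>s = S x\<close>, which is uniformly distributed on \<open>[0, 1]\<close>
under the density \<open>g\<close>. It increases, \<open>\<phi>(s)/s\<close> decreases, and \<open>s \<le> \<phi>(s) \<le> 1\<close>. Let \<open>\<zeta>\<close> be smallest
at \<open>y\<close>, and let \<open>\<phi>\<close> pass the value \<open>y\<close> at \<open>s = y/c\<close>. Then \<open>\<phi>(s)\<close> lies between \<open>y\<close> and
\<open>min 1 (c s)\<close> for every \<open>s\<close>, whence \<open>\<zeta>(\<phi>(s)) \<le> \<zeta>(min 1 (c s))\<close>. The integral of the
right-hand side over \<open>s\<close> is \<open>\<zeta> 1\<close> for every \<open>c \<ge> 1\<close>, because the integral of \<open>\<zeta>\<close> over \<open>(0, 1)\<close> is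
\<open>Z 1 = \<zeta> 1\<close>. If \<open>\<phi>\<close> stays above \<open>y\<close>, then \<open>\<zeta>(\<phi>) \<le> \<zeta> 1\<close> throughout.

The term \<open>\<kappa>\<close>, with antiderivative \<open>K\<close>, is subtracted from \<open>\<zeta>(\<phi>)\<close> so that the integrability
hypothesis concerns only the difference.\<close>

lemma integral_unimodal_le:
  fixes \<zeta> Z K \<kappa> \<phi> F :: "real \<Rightarrow> real"
  assumes y: "0 < y" "y \<le> 1"
    and dec: "\<And>u v. 0 < u \<Longrightarrow> u \<le> v \<Longrightarrow> v \<le> y \<Longrightarrow> \<zeta> v \<le> \<zeta> u"
    and inc: "\<And>u v. y \<le> u \<Longrightarrow> u \<le> v \<Longrightarrow> v \<le> 1 \<Longrightarrow> \<zeta> u \<le> \<zeta> v"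
    and Z: "\<And>u. 0 < u \<Longrightarrow> (Z has_real_derivative \<zeta> u) (at u)" "(Z \<longlongrightarrow> 0) (at_right 0)" "Z 1 = \<zeta> 1"
    and K: "\<And>u. 0 < u \<Longrightarrow> (K has_real_derivative \<kappa> u) (at u)" "(K \<longlongrightarrow> 0) (at_right 0)"
    and \<phi>: "\<And>x. x \<in> T \<Longrightarrow> S x \<le> \<phi> x" "\<And>x. x \<in> T \<Longrightarrow> \<phi> x \<le> 1"
      "\<And>x x'. x \<in> T \<Longrightarrow> x' \<in> T \<Longrightarrow> x \<le> x' \<Longrightarrow> \<phi> x' \<le> \<phi> x"
      "\<And>x x'. x \<in> T \<Longrightarrow> x' \<in> T \<Longrightarrow> x \<le> x' \<Longrightarrow> \<phi> x * S x' \<le> \<phi> x' * S x"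
    and F: "set_integrable lborel {0<..} F" "\<And>x. 0 < x \<Longrightarrow> \<forall>y\<ge>x. g y = 0 \<Longrightarrow> F x = 0"
      "\<And>x. x \<in> T \<Longrightarrow> F x = g x * (\<zeta> (\<phi> x) - \<kappa> (S x))"
  shows "(LINT x:{0<..}|lborel. F x) \<le> \<zeta> 1 - K 1"
proof -
  define B where "B = \<zeta> 1"
  have S_cont: "continuous_on T S"
    using S_has_derivative by (meson DERIV_isCont continuous_at_imp_continuous_on)
  have Z_cont: "continuous_on {0<..} Z" and K_cont: "continuous_on {0<..} K"
    using Z(1) K(1) by (auto intro!: continuous_at_imp_continuous_on DERIV_isCont)
  have KS_cont: "continuous_on T (\<lambda>x. K (S x))"
    by (rule continuous_on_compose2[OF K_cont S_cont]) (use S_pos in auto)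
  have KS_der: "((\<lambda>x. K (S x)) has_real_derivative \<kappa> (S x) * - g x) (at x)" if "x \<in> T" for x
    by (rule DERIV_chain2[OF K(1)[OF S_pos[OF that]] S_has_derivative[OF that]])
  have S_right: "filterlim (\<lambda>n. S (r n)) (at_right 0) sequentially" if e: "exhausts l r" for l r
    by (rule tendsto_imp_filterlim_at_right[OF S_limits(2)[OF e]])
       (simp add: S_pos[OF exhausts_in_T(2)[OF e]])
  have K_lim: "(\<lambda>n. K (S (l n))) \<longlonglongrightarrow> K 1" "(\<lambda>n. K (S (r n))) \<longlonglongrightarrow> 0" if e: "exhausts l r" for l r
    using isCont_tendsto_compose[OF DERIV_isCont[OF K(1)[of 1]] S_limits(1)[OF e]]
      filterlim_compose[OF K(2) S_right[OF e]] by auto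
  have intF: "set_integrable lborel {0<..} (\<lambda>x. - F x)"
    using F(1) unfolding set_integrable_def by simp
  have "K 1 - B \<le> (LINT x:{0<..}|lborel. - F x)"
  proof (cases "\<forall>x\<in>T. y \<le> \<phi> x")
    case True
    have "0 - (B - K 1) \<le> (LINT x:{0<..}|lborel. - F x)"
    proof (rule integral_ge_increment[OF intF, where N = "{}" and \<Psi> = "\<lambda>x. B * S x - K (S x)"
          and \<Psi>' = "\<lambda>x. B * - g x - \<kappa> (S x) * - g x"])
      show "continuous_on T (\<lambda>x. B * S x - K (S x))"
        by (intro continuous_intros S_cont KS_cont)
      fix x assume "x \<in> T - {}"
      then have x: "x \<in> T" by simp
      show "((\<lambda>x. B * S x - K (S x)) has_real_derivative B * - g x - \<kappa> (S x) * - g x) (at x)"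
        by (intro DERIV_diff DERIV_cmult S_has_derivative KS_der x)
      have "\<zeta> (\<phi> x) \<le> B" unfolding B_def by (rule inc) (use x True \<phi>(2) in auto)
      then have "g x * \<zeta> (\<phi> x) \<le> g x * B" using nonneg by (rule mult_left_mono)
      then show "B * - g x - \<kappa> (S x) * - g x \<le> - F x"
        using F(3)[OF x] by (simp add: algebra_simps)
    next
      fix l r assume e: "exhausts l r"
      show "(\<lambda>n. B * S (l n) - K (S (l n))) \<longlonglongrightarrow> B - K 1"
        using tendsto_diff[OF tendsto_mult[OF tendsto_const S_limits(1)[OF e]] K_lim(1)[OF e], of B] by simp
      show "(\<lambda>n. B * S (r n) - K (S (r n))) \<longlonglongrightarrow> 0"
        using tendsto_diff[OF tendsto_mult[OF tendsto_const S_limits(2)[OF e]] K_lim(2)[OF e], of B] by simp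
    qed (use F(2) in auto)
    then show ?thesis by simp
  next
    case False
    then obtain x0 where x0: "x0 \<in> T" "\<phi> x0 < y" by force
    define A where "A = insert 1 ((\<lambda>x. \<phi> x / S x) ` {x \<in> T. y \<le> \<phi> x})"
    \<comment> \<open>The slope at which the line \<open>c S\<close> meets \<open>\<phi>\<close> at height \<open>y\<close>, if \<open>\<phi>\<close> is continuous there.
      The element \<open>1\<close> of \<open>A\<close> covers the case that \<open>\<phi>\<close> stays below \<open>y\<close>.\<close>
    define c where "c = Sup A"
    have ratio: "\<phi> x / S x \<le> \<phi> x' / S x'" if "x \<in> T" "x' \<in> T" "x \<le> x'" for x x'
      using \<phi>(4)[OF that] S_pos that by (simp add: field_simps)
    have upper: "a \<le> \<phi> x / S x" if a: "a \<in> A" and x: "x \<in> T" "\<phi> x < y" for a x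
    proof -
      have "x' \<le> x" if "x' \<in> T" "y \<le> \<phi> x'" for x'
        using \<phi>(3)[OF x(1) that(1)] that x(2) by (meson less_le_trans linear not_le)
      moreover have "1 \<le> \<phi> x / S x" using \<phi>(1) S_pos x by simp
      ultimately show ?thesis using a ratio x by (auto simp: A_def)
    qed
    have bdd: "bdd_above A" by (rule bdd_aboveI) (rule upper[OF _ x0])
    have c1: "1 \<le> c" unfolding c_def by (rule cSup_upper[OF _ bdd]) (simp add: A_def)
    have c_upper: "\<phi> x \<le> c * S x" if "x \<in> T" "y \<le> \<phi> x" for x
    proof -
      have "\<phi> x / S x \<le> c" unfolding c_def by (rule cSup_upper[OF _ bdd]) (use that in \<open>simp add: A_def\<close>)
      then show ?thesis using S_pos[OF that(1)] by (simp add: field_simps)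
    qed
    have c_lower: "c * S x \<le> \<phi> x" if "x \<in> T" "\<phi> x < y" for x
    proof -
      have "c \<le> \<phi> x / S x" unfolding c_def by (rule cSup_least) (use that upper in \<open>auto simp: A_def\<close>)
      then show ?thesis using S_pos[OF that(1)] by (simp add: field_simps)
    qed
    have \<zeta>_le: "\<zeta> (\<phi> x) \<le> \<zeta> (min 1 (c * S x))" if x: "x \<in> T" for x
    proof (cases "y \<le> \<phi> x")
      case True
      then show ?thesis using c_upper[OF x] \<phi>(2)[OF x] by (intro inc) auto
    next
      case False
      then have "min 1 (c * S x) \<le> \<phi> x" "\<phi> x \<le> y" using c_lower[OF x] by auto
      then show ?thesis using S_pos[OF x] c1 by (intro dec) auto
    qed
    \<comment> \<open>The integral of \<open>\<zeta>(min 1 (c s))\<close> over \<open>s\<close> from \<open>0\<close> to \<open>S x\<close>.\<close>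
    define W where "W x = Z (min 1 (c * S x)) / c + B * (S x - min 1 (c * S x) / c)" for x
    \<comment> \<open>The point where \<open>min 1 (c S)\<close> has a kink.\<close>
    define N where "N = {x \<in> T. c * S x = 1}"
    have "finite N"
    proof (cases "N = {}")
      case False
      then obtain x where x: "x \<in> T" "c * S x = 1" by (auto simp: N_def)
      have "x' = x" if "x' \<in> N" for x'
      proof -
        have "x' \<in> T" "S x' = S x" using that x c1 by (auto simp: N_def) (metis mult_cancel_left zero_neq_one mult_zero_left)
        then show ?thesis using S_strict[OF x(1), of x'] S_strict[OF _ x(1), of x'] by (metis less_irrefl linorder_neqE)
      qed
      then have "N \<subseteq> {x}" by blast
      then show ?thesis by (rule finite_subset) simp
    qed simp
    have W_der: "(W has_real_derivative \<zeta> (min 1 (c * S x)) * - g x) (at x)" if x: "x \<in> T" "x \<notin> N" for x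
    proof -
      have S_nhds: "((\<lambda>x. c * S x) \<longlongrightarrow> c * S x) (nhds x)"
        using DERIV_isCont[OF S_has_derivative[OF x(1)]]
        by (intro tendsto_intros) (simp add: isCont_def tendsto_at_iff_tendsto_nhds)
      consider "c * S x < 1" | "1 < c * S x" using x by (fastforce simp: N_def)
      then show ?thesis
      proof cases
        case 1
        have "((\<lambda>x. Z (c * S x) / c) has_real_derivative \<zeta> (c * S x) * (c * - g x) / c) (at x)"
          using c1 S_pos[OF x(1)]
          by (intro DERIV_cdivide DERIV_chain2[where f = Z] Z(1) DERIV_cmult S_has_derivative x) auto
        then have d: "((\<lambda>x. Z (c * S x) / c) has_real_derivative \<zeta> (c * S x) * - g x) (at x)"
          using c1 by simp
        have "\<forall>\<^sub>F t in nhds x. W t = Z (c * S t) / c"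
          using order_tendstoD(2)[OF S_nhds 1] by eventually_elim (use c1 in \<open>simp add: W_def\<close>)
        then show ?thesis using d 1 by (subst DERIV_cong_ev[OF refl _ refl]) auto
      next
        case 2
        have d: "((\<lambda>x. Z 1 / c + B * (S x - 1 / c)) has_real_derivative B * - g x) (at x)"
          by (auto intro!: derivative_eq_intros S_has_derivative x)
        have "\<forall>\<^sub>F t in nhds x. W t = Z 1 / c + B * (S t - 1 / c)"
          using order_tendstoD(1)[OF S_nhds 2] by eventually_elim (simp add: W_def)
        then show ?thesis using d 2 by (subst DERIV_cong_ev[OF refl _ refl]) (auto simp: B_def)
      qed
    qed
    have "0 - (B - K 1) \<le> (LINT x:{0<..}|lborel. - F x)"
    proof (rule integral_ge_increment[OF intF _ \<open>finite N\<close>, where \<Psi> = "\<lambda>x. W x - K (S x)"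
          and \<Psi>' = "\<lambda>x. \<zeta> (min 1 (c * S x)) * - g x - \<kappa> (S x) * - g x"])
      have "continuous_on T (\<lambda>x. Z (min 1 (c * S x)))"
        by (rule continuous_on_compose2[OF Z_cont]) (use S_pos c1 in \<open>auto intro!: continuous_intros S_cont\<close>)
      then show "continuous_on T (\<lambda>x. W x - K (S x))"
        unfolding W_def[abs_def] using c1 by (auto intro!: continuous_intros S_cont KS_cont)
      fix x assume "x \<in> T - N"
      then have x: "x \<in> T" "x \<notin> N" by auto
      show "((\<lambda>x. W x - K (S x)) has_real_derivative \<zeta> (min 1 (c * S x)) * - g x - \<kappa> (S x) * - g x) (at x)"
        by (intro DERIV_diff W_der KS_der x)
      have "g x * \<zeta> (\<phi> x) \<le> g x * \<zeta> (min 1 (c * S x))" using \<zeta>_le[OF x(1)] nonneg by (rule mult_left_mono)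
      then show "\<zeta> (min 1 (c * S x)) * - g x - \<kappa> (S x) * - g x \<le> - F x"
        using F(3)[OF x(1)] by (simp add: algebra_simps)
    next
      fix l r assume e: "exhausts l r"
      have "(\<lambda>n. min 1 (c * S (l n))) \<longlonglongrightarrow> min 1 (c * 1)"
        using S_limits(1)[OF e] by (intro tendsto_intros)
      then have m: "(\<lambda>n. min 1 (c * S (l n))) \<longlonglongrightarrow> 1" using c1 by simp
      have "(\<lambda>n. W (l n) - K (S (l n))) \<longlonglongrightarrow> Z 1 / c + B * (1 - 1 / c) - K 1"
        unfolding W_def using c1
        by (intro tendsto_intros m isCont_tendsto_compose[OF DERIV_isCont[OF Z(1)] m] S_limits(1)[OF e] K_lim(1)[OF e]) auto
      then show "(\<lambda>n. W (l n) - K (S (l n))) \<longlonglongrightarrow> B - K 1"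
        using c1 Z(3) by (simp add: B_def algebra_simps)
      have "(\<lambda>n. min 1 (c * S (r n))) \<longlonglongrightarrow> min 1 (c * 0)"
        using S_limits(2)[OF e] by (intro tendsto_intros)
      then have m: "(\<lambda>n. min 1 (c * S (r n))) \<longlonglongrightarrow> 0" by simp
      have "filterlim (\<lambda>n. min 1 (c * S (r n))) (at_right 0) sequentially"
        by (rule tendsto_imp_filterlim_at_right[OF m]) (use S_pos[OF exhausts_in_T(2)[OF e]] c1 in simp)
      note Zm = filterlim_compose[OF Z(2) this]
      have "(\<lambda>n. W (r n) - K (S (r n))) \<longlonglongrightarrow> 0 / c + B * (0 - 0 / c) - 0"
        unfolding W_def using c1
        by (intro tendsto_intros m Zm S_limits(2)[OF e] K_lim(2)[OF e]) auto
      then show "(\<lambda>n. W (r n) - K (S (r n))) \<longlonglongrightarrow> 0" by simp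
    qed (use F(2) in auto)
    then show ?thesis by simp
  qed
  then show ?thesis by (simp add: set_integral_uminus[OF F(1)] B_def)
qed


text \<open>Apply \<open>integral_unimodal_le\<close> to \<open>\<zeta> u = 2 u - ln u\<close> and to \<open>\<phi> = S / g\<close>. The logarithm of \<open>S\<close> that
this produces is removed by \<open>\<kappa>\<close>, since \<open>\<integral> g ln S = - 1\<close>.\<close>

lemma mean_le_of_entropy: "2 * H 0 \<le> 1 - (LINT x:{0<..}|lborel. g x * ln (g x))"
proof -
  define F where "F x = 2 * S x + g x * ln (g x)" for x
  have "(LINT x:{0<..}|lborel. F x) \<le> (2 * 1 - ln 1) - (1 - 1 * ln 1)"
  proof (rule integral_unimodal_le[where y = "1 / 2" and \<zeta> = "\<lambda>u. 2 * u - ln u"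
        and Z = "\<lambda>u. u\<^sup>2 - u * ln u + u" and K = "\<lambda>u. u - u * ln u" and \<kappa> = "\<lambda>u. - ln u"
        and \<phi> = "\<lambda>x. S x / g x"])
    fix u v :: real assume u: "0 < u" "u \<le> v" "v \<le> 1 / 2"
    show "2 * v - ln v \<le> 2 * u - ln u"
    proof (rule DERIV_nonpos_imp_nonincreasing[OF u(2)])
      fix x assume x: "u \<le> x" "x \<le> v"
      have "((\<lambda>u. 2 * u - ln u) has_real_derivative 2 - 1 / x) (at x)"
        using x u by (auto intro!: derivative_eq_intros)
      moreover have "2 - 1 / x \<le> 0" using x u by (simp add: field_simps)
      ultimately show "\<exists>d. ((\<lambda>u. 2 * u - ln u) has_real_derivative d) (at x) \<and> d \<le> 0" by blast
    qed
  next
    fix u v :: real assume u: "1 / 2 \<le> u" "u \<le> v" "v \<le> 1"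
    show "2 * u - ln u \<le> 2 * v - ln v"
    proof (rule DERIV_nonneg_imp_nondecreasing[OF u(2)])
      fix x assume x: "u \<le> x" "x \<le> v"
      have "((\<lambda>u. 2 * u - ln u) has_real_derivative 2 - 1 / x) (at x)"
        using x u by (auto intro!: derivative_eq_intros)
      moreover have "0 \<le> 2 - 1 / x" using x u by (simp add: field_simps)
      ultimately show "\<exists>d. ((\<lambda>u. 2 * u - ln u) has_real_derivative d) (at x) \<and> 0 \<le> d" by blast
    qed
  next
    fix u :: real assume u: "0 < u"
    show "((\<lambda>u. u\<^sup>2 - u * ln u + u) has_real_derivative 2 * u - ln u) (at u)"
      using u by (auto intro!: derivative_eq_intros)
    show "((\<lambda>u. u - u * ln u) has_real_derivative - ln u) (at u)"
      using u by (auto intro!: derivative_eq_intros)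
  next
    have id: "((\<lambda>u::real. u) \<longlongrightarrow> 0) (at_right 0)" by (rule tendsto_ident_at)
    have ln: "((\<lambda>u::real. u * ln u) \<longlongrightarrow> 0) (at_right 0)"
      by (rule tendsto_mult_ln_zero[OF _ id]) (simp add: eventually_at_right_less eventually_at_filter)
    show "((\<lambda>u::real. u\<^sup>2 - u * ln u + u) \<longlongrightarrow> 0) (at_right 0)"
      using tendsto_add[OF tendsto_diff[OF tendsto_power[OF id, of 2] ln] id] by simp
    show "((\<lambda>u::real. u - u * ln u) \<longlongrightarrow> 0) (at_right 0)"
      using tendsto_diff[OF id ln] by simp
  next
    fix x assume x: "x \<in> T"
    note pos = S_pos[OF x] g_pos[OF x]
    show "S x \<le> S x / g x" using pos le_1[of x] by (simp add: field_simps)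
    show "S x / g x \<le> 1" using pos S_le_g[OF T_pos[OF x]] by simp
    show "F x = g x * (2 * (S x / g x) - ln (S x / g x) - - ln (S x))"
      using pos by (simp add: F_def ln_div algebra_simps)
  next
    fix x x' assume x: "x \<in> T" "x' \<in> T" "x \<le> x'"
    note pos = S_pos[OF x(1)] g_pos[OF x(1)] S_pos[OF x(2)] g_pos[OF x(2)]
    show "S x' / g x' \<le> S x / g x"
      using hazard_mono[OF T_pos[OF x(1)] x(3)] pos by (simp add: field_simps)
    show "S x / g x * S x' \<le> S x' / g x' * S x"
      using antimono[OF T_pos[OF x(1)] x(3)] pos by (simp add: field_simps mult_left_mono)
  qed (use set_integrable_S entropy_integrable in \<open>auto simp: F_def S_off\<close>)
  moreover have "(LINT x:{0<..}|lborel. F x) = 2 * H 0 + (LINT x:{0<..}|lborel. g x * ln (g x))"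
    unfolding F_def using set_integrable_S entropy_integrable by (simp add: H_def)
  ultimately show ?thesis by simp
qed

lemma set_integrable_powr:
  assumes "1 \<le> p"
  shows "set_integrable lborel {0<..} (\<lambda>x. g x powr p)"
proof (rule set_integrable_bound[OF set_integrable_g])
  have "g x powr p \<le> g x" for x
    using powr_mono'[OF assms nonneg le_1, of x] nonneg by simp
  then show "AE x in lborel. x \<in> {0<..} \<longrightarrow> norm (g x powr p) \<le> norm (g x)"
    using nonneg by (auto intro!: AE_I2)
qed (auto simp: set_borel_measurable_def)

text \<open>Apply \<open>integral_unimodal_le\<close> to \<open>\<zeta> u = (1 + q) u powr q - q ln u\<close> and to \<open>\<phi> = g\<close>.\<close>

lemma powr_integral_le:
  assumes q: "0 < q"
  shows "(1 + q) * (LINT x:{0<..}|lborel. g x powr (1 + q))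
    \<le> 1 + q * (1 + (LINT x:{0<..}|lborel. g x * ln (g x)))"
proof -
  define F where "F x = (1 + q) * g x powr (1 + q) - q * (g x * ln (g x))" for x
  define y where "y = (1 + q) powr (- 1 / q)"
  have "1 \<le> (1 + q) powr (1 / q)" using q by (intro ge_one_powr_ge_zero) auto
  moreover have "y = 1 / (1 + q) powr (1 / q)" by (simp add: y_def powr_minus_divide flip: minus_divide_left)
  ultimately have y: "0 < y" "y \<le> 1" using q by auto
  have yq: "y powr q = 1 / (1 + q)" unfolding y_def powr_powr using q by (simp add: powr_minus_divide)
  define \<zeta> where "\<zeta> u = (1 + q) * u powr q - q * ln u" for u
  have \<zeta>_der: "(\<zeta> has_real_derivative q / u * ((1 + q) * u powr q - 1)) (at u)" if "0 < u" for u
    using that q unfolding \<zeta>_def[abs_def]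
    by (auto intro!: derivative_eq_intros simp: field_simps powr_diff)
  have "(LINT x:{0<..}|lborel. F x) \<le> \<zeta> 1 - 0"
  proof (rule integral_unimodal_le[where y = y and \<zeta> = \<zeta>
        and Z = "\<lambda>u. u powr (1 + q) - q * (u * ln u) + q * u" and K = "\<lambda>u. 0" and \<kappa> = "\<lambda>u. 0"
        and \<phi> = "g"])
    fix u v :: real assume u: "0 < u" "u \<le> v" "v \<le> y"
    show "\<zeta> v \<le> \<zeta> u"
    proof (rule DERIV_nonpos_imp_nonincreasing[OF u(2)])
      fix x assume x: "u \<le> x" "x \<le> v"
      have "x powr q \<le> y powr q" using x u q by (intro powr_mono2) auto
      then have "(1 + q) * x powr q - 1 \<le> 0" using q unfolding yq by (simp add: field_simps)
      then have "q / x * ((1 + q) * x powr q - 1) \<le> 0" using x u q by (intro mult_nonneg_nonpos) auto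
      then show "\<exists>d. (\<zeta> has_real_derivative d) (at x) \<and> d \<le> 0" using \<zeta>_der[of x] x u by auto
    qed
  next
    fix u v :: real assume u: "y \<le> u" "u \<le> v" "v \<le> 1"
    show "\<zeta> u \<le> \<zeta> v"
    proof (rule DERIV_nonneg_imp_nondecreasing[OF u(2)])
      fix x assume x: "u \<le> x" "x \<le> v"
      have "y powr q \<le> x powr q" using x u q y by (intro powr_mono2) auto
      then have "0 \<le> (1 + q) * x powr q - 1" using q unfolding yq by (simp add: field_simps)
      then have "0 \<le> q / x * ((1 + q) * x powr q - 1)" using x u q y by (intro mult_nonneg_nonneg) auto
      then show "\<exists>d. (\<zeta> has_real_derivative d) (at x) \<and> 0 \<le> d" using \<zeta>_der[of x] x u y by auto
    qed
  next
    fix u :: real assume u: "0 < u"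
    show "((\<lambda>u. u powr (1 + q) - q * (u * ln u) + q * u) has_real_derivative \<zeta> u) (at u)"
      using u q unfolding \<zeta>_def by (auto intro!: derivative_eq_intros simp: field_simps)
  next
    have id: "((\<lambda>u::real. u) \<longlongrightarrow> 0) (at_right 0)" by (rule tendsto_ident_at)
    have ev: "\<forall>\<^sub>F u::real in at_right 0. 0 \<le> u" by (simp add: eventually_at_filter)
    have ln: "((\<lambda>u::real. u * ln u) \<longlongrightarrow> 0) (at_right 0)"
      by (rule tendsto_mult_ln_zero[OF ev id])
    have pw: "((\<lambda>u::real. u powr (1 + q)) \<longlongrightarrow> 0) (at_right 0)"
      by (rule tendsto_zero_powrI[OF id tendsto_const ev]) (use q in auto)
    show "((\<lambda>u. u powr (1 + q) - q * (u * ln u) + q * u) \<longlongrightarrow> 0) (at_right 0)"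
      using tendsto_add[OF tendsto_diff[OF pw tendsto_mult[OF tendsto_const[of q] ln]]
          tendsto_mult[OF tendsto_const[of q] id]] by simp
  next
    fix x assume x: "x \<in> T"
    show "F x = g x * (\<zeta> (g x) - 0)"
      using g_pos[OF x] by (simp add: F_def \<zeta>_def algebra_simps powr_add)
  qed (use y T_pos S_le_g antimono le_1 hazard_mono set_integrable_powr[of "1 + q"] entropy_integrable q
      in \<open>auto simp: F_def \<zeta>_def mult.commute\<close>)
  moreover have "(LINT x:{0<..}|lborel. F x) = (1 + q) * (LINT x:{0<..}|lborel. g x powr (1 + q))
      - q * (LINT x:{0<..}|lborel. g x * ln (g x))"
    unfolding F_def using set_integrable_powr[of "1 + q"] entropy_integrable q by simp
  ultimately show ?thesis by (simp add: \<zeta>_def algebra_simps)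
qed

text \<open>Here \<open>d\<close> is \<open>1 + \<integral> g ln g\<close>. The variance bound follows from \<open>second_moment_le\<close> and
\<open>1 + t \<le> exp t\<close> at \<open>t = 2 (- d - ln E)\<close>, since \<open>E\<^sup>2 exp t = exp (-2 d)\<close>.\<close>

lemma moments_entropy_deficit:
  "\<exists>E W d. 0 \<le> d \<and> d \<le> 1 \<and> 0 \<le> E \<and> E \<le> 1 - d / 2 \<and> W - E\<^sup>2 \<le> exp (- 2 * d) \<and>
    (LINT x:{0<..}|lborel. x * g x) = E \<and> (LINT x:{0<..}|lborel. x\<^sup>2 * g x) = W \<and>
    (\<forall>q>0. (1 + q) * (LINT x:{0<..}|lborel. g x powr (1 + q)) \<le> 1 + q * d)"
proof -
  define d where "d = 1 + (LINT x:{0<..}|lborel. g x * ln (g x))"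
  define W where "W = (LINT x:{0<..}|lborel. x\<^sup>2 * g x)"
  have "g x * ln (g x) \<le> 0" for x
  proof (cases "g x = 0")
    case False
    then show ?thesis using nonneg[of x] le_1[of x] by (simp add: mult_nonneg_nonpos)
  qed simp
  then have "0 \<le> (\<integral>x. - (indicator {0<..} x *\<^sub>R (g x * ln (g x))) \<partial>lborel)"
    by (intro Bochner_Integration.integral_nonneg) (simp add: indicator_def)
  then have "(LINT x:{0<..}|lborel. g x * ln (g x)) \<le> 0"
    by (simp add: set_lebesgue_integral_def)
  then have d: "0 \<le> d" "d \<le> 1" using entropy_le_1 by (auto simp: d_def)
  define m where "m = H 0"
  have m: "0 < m" using H_0_pos by (simp add: m_def)
  have "W \<le> m\<^sup>2 * (1 + 2 * (- d - ln m) + 1)"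
    using second_moment_le by (simp add: W_def d_def m_def algebra_simps)
  moreover have "1 + 2 * (- d - ln m) \<le> exp (2 * (- d - ln m))"
    using exp_ge_add_one_self[of "2 * (- d - ln m)"] by (simp add: add.commute)
  then have "m\<^sup>2 * (1 + 2 * (- d - ln m)) \<le> m\<^sup>2 * exp (2 * (- d - ln m))"
    by (intro mult_left_mono) auto
  moreover have "m\<^sup>2 * exp (2 * (- d - ln m)) = exp (- 2 * d)"
  proof -
    have "exp (2 * (- d - ln m)) = exp (- 2 * d) / (exp (ln m))\<^sup>2"
      by (simp add: power2_eq_square algebra_simps exp_diff flip: exp_add)
    then show ?thesis using m by simp
  qed
  ultimately have "W - m\<^sup>2 \<le> exp (- 2 * d)" by (simp add: algebra_simps)
  moreover have "m \<le> 1 - d / 2" using mean_le_of_entropy unfolding m_def d_def by argo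
  moreover have "(1 + q) * (LINT x:{0<..}|lborel. g x powr (1 + q)) \<le> 1 + q * d" if "0 < q" for q
    using powr_integral_le[OF that] by (simp only: d_def)
  moreover have "(LINT x:{0<..}|lborel. x * g x) = m" using mean_eq by (simp add: m_def)
  ultimately show ?thesis
    using d m by - (rule exI[of _ m], rule exI[of _ W], rule exI[of _ d],
      simp add: W_def less_imp_le)
qed

end

section \<open>Rescaling to arbitrary half-lines\<close>

text \<open>Log-concavity in multiplicative form. As \<open>0 powr t = 0\<close>, points outside of the support impose no condition.\<close>

definition log_concave_fun :: "(real \<Rightarrow> real) \<Rightarrow> bool" where
  "log_concave_fun f \<longleftrightarrow> (\<forall>x. 0 \<le> f x) \<and>
    (\<forall>x y t. 0 < t \<longrightarrow> t < 1 \<longrightarrow> f x powr (1 - t) * f y powr t \<le> f ((1 - t) * x + t * y))"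

lemma log_concave_fun_nonneg: "log_concave_fun f \<Longrightarrow> 0 \<le> f x"
  by (simp add: log_concave_fun_def)

lemma log_concave_funD:
  "log_concave_fun f \<Longrightarrow> 0 < t \<Longrightarrow> t < 1 \<Longrightarrow> f x powr (1 - t) * f y powr t \<le> f ((1 - t) * x + t * y)"
  by (simp add: log_concave_fun_def)

lemma log_concave_fun_affine:
  assumes "log_concave_fun f"
  shows "log_concave_fun (\<lambda>x. f (a + c * x))"
  unfolding log_concave_fun_def
proof (intro conjI allI impI)
  fix x y t :: real assume "0 < t" "t < 1"
  from log_concave_funD[OF assms this, of "a + c * x" "a + c * y"]
  show "f (a + c * x) powr (1 - t) * f (a + c * y) powr t \<le> f (a + c * ((1 - t) * x + t * y))"
    by (simp add: algebra_simps)
qed (rule log_concave_fun_nonneg[OF assms])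

lemma log_concave_fun_ge_min:
  assumes f: "log_concave_fun f" and xz: "x \<le> z" "z \<le> y"
  shows "min (f x) (f y) \<le> f z"
proof (cases "x = z \<or> z = y")
  case False
  define t where "t = (z - x) / (y - x)"
  have t: "0 < t" "t < 1" using False xz by (auto simp: t_def)
  have "t * (y - x) = z - x" using False xz by (simp add: t_def)
  then have z: "(1 - t) * x + t * y = z" by (simp add: algebra_simps)
  have nn: "0 \<le> min (f x) (f y)" using log_concave_fun_nonneg[OF f] by simp
  have "min (f x) (f y) = min (f x) (f y) powr (1 - t + t)" using nn by simp
  also have "\<dots> = min (f x) (f y) powr (1 - t) * min (f x) (f y) powr t"
    by (rule powr_add)
  also have "\<dots> \<le> f x powr (1 - t) * f y powr t"
    using t nn by (intro mult_mono powr_mono2) auto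
  also have "\<dots> \<le> f z" using log_concave_funD[OF f t, of x y] z by simp
  finally show ?thesis .
qed auto

lemma scaled_half_line:
  fixes h :: "real \<Rightarrow> real"
  assumes c: "0 < c"
  shows "set_integrable lborel {0<..} (\<lambda>y. h (c * y)) \<longleftrightarrow> set_integrable lborel {0<..} h"
    and "(LINT x:{0<..}|lborel. h x) = c * (LINT y:{0<..}|lborel. h (c * y))"
proof -
  have eq: "indicator {0<..} (0 + c * y) *\<^sub>R h (0 + c * y) = indicator {0<..} y *\<^sub>R h (c * y)" for y
    using c by (simp add: indicator_def zero_less_mult_iff)
  show "set_integrable lborel {0<..} (\<lambda>y. h (c * y)) \<longleftrightarrow> set_integrable lborel {0<..} h"
    using lborel_integrable_real_affine_iff[of c "\<lambda>x. indicator {0<..} x *\<^sub>R h x" 0] c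
    unfolding eq set_integrable_def by simp
  show "(LINT x:{0<..}|lborel. h x) = c * (LINT y:{0<..}|lborel. h (c * y))"
    using lborel_integral_real_affine[of c "\<lambda>x. indicator {0<..} x *\<^sub>R h x" 0] c
    unfolding eq set_lebesgue_integral_def by simp
qed

text \<open>The statement of \<open>moments_entropy_deficit\<close> for a half-line of mass \<open>A\<close> on which \<open>F\<close> has
supremum \<open>M\<close>: the function \<open>F (A/M * y) / M\<close> is a density as in \<open>decreasing_log_concave\<close>. An empty
half-line, \<open>A = 0\<close>, is included; its supremum is \<open>0\<close>, so \<open>M\<close> is then only an upper bound.\<close>

lemma half_line_moments:
  fixes F :: "real \<Rightarrow> real"
  assumes F: "log_concave_fun F" and [measurable]: "F \<in> borel_measurable borel"
    and int: "set_integrable lborel {0<..} F"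
    and anti: "\<And>x y. 0 < x \<Longrightarrow> x \<le> y \<Longrightarrow> F y \<le> F x"
    and M: "0 < M" "\<And>x. 0 < x \<Longrightarrow> F x \<le> M"
    and A: "A = (LINT x:{0<..}|lborel. F x)"
    and sup: "\<And>c. 0 < A \<Longrightarrow> c < M \<Longrightarrow> \<exists>x>0. c < F x"
  shows "\<exists>E W d. 0 \<le> d \<and> d \<le> 1 \<and> 0 \<le> E \<and> E \<le> 1 - d / 2 \<and> W - E\<^sup>2 \<le> exp (- 2 * d) \<and>
    set_integrable lborel {0<..} (\<lambda>x. x * F x) \<and> set_integrable lborel {0<..} (\<lambda>x. x\<^sup>2 * F x) \<and>
    (LINT x:{0<..}|lborel. x * F x) = A\<^sup>2 / M * E \<and> (LINT x:{0<..}|lborel. x\<^sup>2 * F x) = A ^ 3 / M\<^sup>2 * W \<and>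
    (\<forall>q>0. set_integrable lborel {0<..} (\<lambda>x. F x powr (1 + q)) \<and>
      (1 + q) * (LINT x:{0<..}|lborel. F x powr (1 + q)) \<le> A * M powr q * (1 + q * d))"
proof (cases "A = 0")
  case True
  have "AE x in lborel. indicator {0<..} x *\<^sub>R F x = 0"
    using integral_nonneg_eq_0_iff_AE[OF int[unfolded set_integrable_def]] True A
      log_concave_fun_nonneg[OF F] by (simp add: set_lebesgue_integral_def)
  then have zero: "AE x in lborel. 0 < x \<longrightarrow> F x = 0" by eventually_elim (simp add: indicator_def)
  have "set_integrable lborel {0<..} (\<lambda>x. G x (F x)) \<and> (LINT x:{0<..}|lborel. G x (F x)) = 0"
    if [measurable]: "(\<lambda>x. G x (F x)) \<in> borel_measurable borel" and G: "\<And>x. G x 0 = 0"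
    for G :: "real \<Rightarrow> real \<Rightarrow> real"
  proof -
    have ae: "AE x in lborel. indicator {0<..} x *\<^sub>R G x (F x) = 0"
      using zero by eventually_elim (auto simp: indicator_def G)
    have "integrable lborel (\<lambda>x. indicator {0<..} x *\<^sub>R G x (F x)) \<longleftrightarrow> integrable lborel (\<lambda>x::real. 0::real)"
      by (rule integrable_cong_AE) (use ae in auto)
    moreover have "(LINT x:{0<..}|lborel. G x (F x)) = 0"
      unfolding set_lebesgue_integral_def using ae by (rule integral_eq_zero_AE)
    ultimately show ?thesis by (simp add: set_integrable_def)
  qed
  note Z = this
  show ?thesis
    by (intro exI[of _ 0])
       (use True Z[of "\<lambda>x y. x * y"] Z[of "\<lambda>x y. x\<^sup>2 * y"] Z[of "\<lambda>x y. y powr (1 + q)" for q] in auto)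
next
  case False
  have "0 \<le> A" unfolding A set_lebesgue_integral_def
    by (intro Bochner_Integration.integral_nonneg) (simp add: log_concave_fun_nonneg[OF F])
  with False have A0: "0 < A" by simp
  define c where "c = A / M"
  have c: "0 < c" using A0 M by (simp add: c_def)
  define g where "g y = indicator {0<..} y * (F (c * y) / M)" for y
  have g: "g y = F (c * y) / M" if "0 < y" for y using that by (simp add: g_def)
  have ind: "indicator {0<..} y *\<^sub>R (F (c * y) / M) = g y" for y by (simp add: g_def)
  interpret decreasing_log_concave g
  proof
    have "set_integrable lborel {0<..} (\<lambda>y. F (c * y) / M)"
      using int scaled_half_line(1)[OF c, of F] by simp
    then show "integrable lborel g" unfolding set_integrable_def ind .
    have "c * M = A" using M by (simp add: c_def)
    then have "(LINT y:{0<..}|lborel. F (c * y)) = M"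
      using scaled_half_line(2)[OF c, of F, folded A] c by (metis mult_left_cancel less_irrefl)
    then have "(LINT y:{0<..}|lborel. F (c * y) / M) = 1" using M by simp
    then show "(\<integral>y. g y \<partial>lborel) = 1" unfolding set_lebesgue_integral_def ind .
    fix x :: real
    show "0 \<le> g x" using M log_concave_fun_nonneg[OF F] by (simp add: g_def)
    show "g x = 0" if "x \<le> 0" using that by (simp add: g_def)
    show "g x \<le> 1" using M(1) M(2)[of "c * x"] c by (cases "0 < x") (auto simp: g_def)
    show "g y \<le> g x" if "0 < x" "x \<le> y" for y
      using that anti[of "c * x" "c * y"] c M by (simp add: g divide_right_mono)
    show "\<exists>x>0. b < g x" if "b < 1" for b
    proof -
      obtain z where z: "0 < z" "b * M < F z" using sup[OF A0, of "b * M"] \<open>b < 1\<close> M(1) by auto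
      then have "0 < z / c" "b < g (z / c)" using c M by (simp_all add: g field_simps)
      then show ?thesis by blast
    qed
    show "g x powr (1 - t) * g y powr t \<le> g ((1 - t) * x + t * y)"
      if xy: "0 < x" "0 < y" and t: "0 < t" "t < 1" for y t
    proof -
      have pos: "0 < (1 - t) * x + t * y" using xy t by (intro add_pos_pos) auto
      have "g x powr (1 - t) * g y powr t
          = F (c * x) powr (1 - t) * F (c * y) powr t / (M powr (1 - t) * M powr t)"
        using xy M log_concave_fun_nonneg[OF F] by (simp add: g powr_divide)
      also have "M powr (1 - t) * M powr t = M" using M by (simp flip: powr_add)
      also have "F (c * x) powr (1 - t) * F (c * y) powr t / M \<le> F ((1 - t) * (c * x) + t * (c * y)) / M"
        using M log_concave_funD[OF F t] by (intro divide_right_mono) auto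
      also have "\<dots> = g ((1 - t) * x + t * y)" using pos by (simp add: g algebra_simps)
      finally show ?thesis .
    qed
  qed
  have Fg: "F (c * y) = M * g y" if "0 < y" for y using that M by (simp add: g)
  obtain E W d where Ed: "0 \<le> d" "d \<le> 1" "0 \<le> E" "E \<le> 1 - d / 2" "W - E\<^sup>2 \<le> exp (- 2 * d)"
    and EW: "(LINT x:{0<..}|lborel. x * g x) = E" "(LINT x:{0<..}|lborel. x\<^sup>2 * g x) = W"
    and pw: "\<forall>q>0. (1 + q) * (LINT x:{0<..}|lborel. g x powr (1 + q)) \<le> 1 + q * d"
    using moments_entropy_deficit by blast
  have tr: "(LINT x:{0<..}|lborel. h x) = c * (LINT y:{0<..}|lborel. k y)"
    "set_integrable lborel {0<..} k \<Longrightarrow> set_integrable lborel {0<..} h"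
    if "\<And>y. 0 < y \<Longrightarrow> h (c * y) = k y" for h k :: "real \<Rightarrow> real"
  proof -
    have ind: "indicator {0<..} y *\<^sub>R h (c * y) = indicator {0<..} y *\<^sub>R k y" for y
      using that by (simp add: indicator_def)
    show "(LINT x:{0<..}|lborel. h x) = c * (LINT y:{0<..}|lborel. k y)"
      by (subst scaled_half_line(2)[OF c, of h]) (simp only: set_lebesgue_integral_def ind)
    show "set_integrable lborel {0<..} k \<Longrightarrow> set_integrable lborel {0<..} h"
      using scaled_half_line(1)[OF c, of h] unfolding set_integrable_def ind by simp
  qed
  show ?thesis
  proof (rule exI[of _ E], rule exI[of _ W], rule exI[of _ d], intro conjI allI impI Ed)
    show "set_integrable lborel {0<..} (\<lambda>x. x * F x)"
      by (rule tr(2)[where k = "\<lambda>y. (c * M) * (y * g y)"]) (use moment_integrable[of 1] in \<open>auto simp: Fg\<close>)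
    show "set_integrable lborel {0<..} (\<lambda>x. x\<^sup>2 * F x)"
      by (rule tr(2)[where k = "\<lambda>y. (c\<^sup>2 * M) * (y\<^sup>2 * g y)"])
         (use moment_integrable[of 2] in \<open>auto simp: Fg power_mult_distrib\<close>)
    have "(LINT x:{0<..}|lborel. x * F x) = c * (LINT y:{0<..}|lborel. (c * M) * (y * g y))"
      by (rule tr(1)) (simp add: Fg)
    also have "\<dots> = A\<^sup>2 / M * E" using EW M by (simp add: c_def power2_eq_square)
    finally show "(LINT x:{0<..}|lborel. x * F x) = A\<^sup>2 / M * E" .
    have "(LINT x:{0<..}|lborel. x\<^sup>2 * F x) = c * (LINT y:{0<..}|lborel. (c\<^sup>2 * M) * (y\<^sup>2 * g y))"
      by (rule tr(1)) (simp add: Fg power_mult_distrib)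
    also have "\<dots> = A ^ 3 / M\<^sup>2 * W" using EW M by (simp add: c_def power2_eq_square power3_eq_cube)
    finally show "(LINT x:{0<..}|lborel. x\<^sup>2 * F x) = A ^ 3 / M\<^sup>2 * W" .
    fix q :: real assume q: "0 < q"
    show "set_integrable lborel {0<..} (\<lambda>x. F x powr (1 + q))"
      by (rule tr(2)[where k = "\<lambda>y. M powr (1 + q) * g y powr (1 + q)"])
         (use set_integrable_powr[of "1 + q"] q M nonneg in \<open>auto simp: Fg powr_mult\<close>)
    have "(LINT x:{0<..}|lborel. F x powr (1 + q)) = c * (LINT y:{0<..}|lborel. M powr (1 + q) * g y powr (1 + q))"
      by (rule tr(1)) (use M nonneg in \<open>simp add: Fg powr_mult\<close>)
    then have "(1 + q) * (LINT x:{0<..}|lborel. F x powr (1 + q))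
        = c * M powr (1 + q) * ((1 + q) * (LINT y:{0<..}|lborel. g y powr (1 + q)))" by simp
    also have "\<dots> \<le> c * M powr (1 + q) * (1 + q * d)"
      using pw q c by (intro mult_left_mono) auto
    also have "\<dots> = A * M powr q * (1 + q * d)" using M by (simp add: c_def powr_add)
    finally show "(1 + q) * (LINT x:{0<..}|lborel. F x powr (1 + q)) \<le> A * M powr q * (1 + q * d)" .
  qed
qed

section \<open>Log-concave densities on the whole line\<close>

text \<open>If \<open>F z > 0\<close>, then \<open>F x F (z - x) \<le> (F (z/2))\<^sup>2\<close>, and \<open>F (z - x) \<ge> F z\<close> for \<open>x\<close> near \<open>0\<close>.\<close>

lemma half_line_bounded:
  fixes F :: "real \<Rightarrow> real"
  assumes F: "log_concave_fun F" and anti: "\<And>x y. 0 < x \<Longrightarrow> x \<le> y \<Longrightarrow> F y \<le> F x"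
  shows "\<exists>B. \<forall>x>0. F x \<le> B"
proof (cases "\<exists>z>0. 0 < F z")
  case True
  then obtain z where z: "0 < z" "0 < F z" by blast
  have "F x \<le> max (F (z / 2)) ((F (z / 2))\<^sup>2 / F z)" if x: "0 < x" for x
  proof (cases "z / 2 \<le> x")
    case True
    then show ?thesis using anti[of "z / 2" x] z by simp
  next
    case False
    have "F z \<le> F (z - x)" using x False z by (intro anti) auto
    have "F x powr (1 - 1 / 2) * F (z - x) powr (1 / 2) \<le> F ((1 - 1 / 2) * x + 1 / 2 * (z - x))"
      by (rule log_concave_funD[OF F]) auto
    then have le: "sqrt (F x * F (z - x)) \<le> F (z / 2)"
      using log_concave_fun_nonneg[OF F] by (simp add: powr_half_sqrt real_sqrt_mult field_simps)
    have "F x * F z \<le> F x * F (z - x)"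
      using \<open>F z \<le> F (z - x)\<close> log_concave_fun_nonneg[OF F] by (intro mult_left_mono)
    also have "\<dots> \<le> (F (z / 2))\<^sup>2"
      using power_mono[OF le, of 2] log_concave_fun_nonneg[OF F] by simp
    finally have "F x \<le> (F (z / 2))\<^sup>2 / F z" using z by (simp add: field_simps)
    then show ?thesis by simp
  qed
  then show ?thesis by blast
next
  case False
  then show ?thesis by (intro exI[of _ 0]) force
qed

text \<open>Log-concavity on the short interval \<open>[- e, e]\<close>, continued to \<open>p\<close>, forbids a jump at \<open>0\<close>: the weight
of \<open>p\<close> in \<open>e\<close> tends to \<open>0\<close> with \<open>e\<close>. Hence \<open>F\<close> has the same supremum on both sides of its mode
as long as both carry mass.\<close>

lemma sup_across_mode:
  fixes F :: "real \<Rightarrow> real"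
  assumes F: "log_concave_fun F" and mono: "\<And>x y. x \<le> y \<Longrightarrow> y < 0 \<Longrightarrow> F x \<le> F y"
    and p: "0 < p" "0 < F p" and z: "z < 0" "c < F z"
  shows "\<exists>x>0. c < F x"
proof (cases "0 < F z")
  case True
  define t where "t e = 2 * e / (p + e)" for e
  have "((\<lambda>e. F z powr (1 - t e) * F p powr t e) \<longlongrightarrow> F z powr (1 - 2 * 0 / (p + 0)) * F p powr (2 * 0 / (p + 0))) (at_right 0)"
    unfolding t_def using True p by (intro tendsto_intros) auto
  then have "((\<lambda>e. F z powr (1 - t e) * F p powr t e) \<longlongrightarrow> F z) (at_right 0)"
    using True p by simp
  then have "\<forall>\<^sub>F e in at_right 0. c < F z powr (1 - t e) * F p powr t e"
    using z(2) by (rule order_tendstoD)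
  moreover have "\<forall>\<^sub>F e in at_right 0. e < min p (- z)"
    using p z by (intro order_tendstoD(2)[OF tendsto_ident_at]) auto
  ultimately have "\<forall>\<^sub>F e in at_right 0. 0 < e \<and> e < min p (- z) \<and> c < F z powr (1 - t e) * F p powr t e"
    using eventually_at_right_less[of "0::real"] by eventually_elim simp
  then have "\<exists>e. 0 < e \<and> e < min p (- z) \<and> c < F z powr (1 - t e) * F p powr t e"
    by (rule eventually_happens'[rotated]) simp
  then obtain e where e: "0 < e" "e < p" "e < - z" "c < F z powr (1 - t e) * F p powr t e"
    by auto
  have t: "0 < t e" "t e < 1" using e by (auto simp: t_def)
  have "t e * (p + e) = 2 * e" using e p by (simp add: t_def)
  then have eq: "(1 - t e) * (- e) + t e * p = e" by (simp add: algebra_simps)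
  have "F z powr (1 - t e) * F p powr t e \<le> F (- e) powr (1 - t e) * F p powr t e"
    using mono[of z "- e"] e t True by (intro mult_right_mono powr_mono2) auto
  also have "\<dots> \<le> F e" using log_concave_funD[OF F t, of "- e" p] unfolding eq .
  finally have "c < F e" using e(4) by linarith
  with e(1) show ?thesis by blast
next
  case False
  then have "c < F p" using p z by linarith
  with p(1) show ?thesis by blast
qed

lemma integral_split_at_zero:
  fixes h :: "real \<Rightarrow> real"
  assumes "set_integrable lborel {0<..} h" "set_integrable lborel {0<..} (\<lambda>x. h (- x))"
    and [measurable]: "h \<in> borel_measurable borel"
  shows "integrable lborel h"
    and "(\<integral>x. h x \<partial>lborel) = (LINT x:{0<..}|lborel. h x) + (LINT x:{0<..}|lborel. h (- x))"
proof -
  have eq: "indicator {..<0} (0 + -1 * x) *\<^sub>R h (0 + -1 * x) = indicator {0<..} x *\<^sub>R h (- x)" for x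
    by (simp add: indicator_def)
  have neg: "integrable lborel (\<lambda>x. indicator {..<0} x *\<^sub>R h x)"
    using lborel_integrable_real_affine_iff[of "-1" "\<lambda>x. indicator {..<0} x *\<^sub>R h x" 0] assms(2)
    unfolding eq set_integrable_def by simp
  have neg': "(\<integral>x. indicator {..<0} x *\<^sub>R h x \<partial>lborel) = (LINT x:{0<..}|lborel. h (- x))"
    using lborel_integral_real_affine[of "-1" "\<lambda>x. indicator {..<0} x *\<^sub>R h x" 0]
    unfolding eq set_lebesgue_integral_def by simp
  have ae: "AE x in lborel. h x = indicator {0<..} x *\<^sub>R h x + indicator {..<0} x *\<^sub>R h x"
    using AE_lborel_singleton[of 0] by eventually_elim (auto simp: indicator_def)
  show "integrable lborel h"
    using integrable_cong_AE[OF _ _ ae] Bochner_Integration.integrable_add[OF assms(1)[unfolded set_integrable_def] neg]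
    by simp
  have "(\<integral>x. h x \<partial>lborel) = (\<integral>x. indicator {0<..} x *\<^sub>R h x + indicator {..<0} x *\<^sub>R h x \<partial>lborel)"
    by (rule integral_cong_AE[OF _ _ ae]) auto
  also have "\<dots> = (LINT x:{0<..}|lborel. h x) + (LINT x:{0<..}|lborel. h (- x))"
    using Bochner_Integration.integral_add[OF assms(1)[unfolded set_integrable_def] neg]
    unfolding neg' by (simp add: set_lebesgue_integral_def)
  finally show "(\<integral>x. h x \<partial>lborel) = (LINT x:{0<..}|lborel. h x) + (LINT x:{0<..}|lborel. h (- x))" .
qed

text \<open>A density is not concentrated at one point.\<close>

lemma density_variance_pos:
  fixes f :: "real \<Rightarrow> real"
  assumes nonneg: "\<And>x. 0 \<le> f x" and int: "integrable lborel f" "integrable lborel (\<lambda>x. x * f x)"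
      "integrable lborel (\<lambda>x. x\<^sup>2 * f x)" and total: "(\<integral>x. f x \<partial>lborel) = 1"
  defines "m \<equiv> \<integral>x. x * f x \<partial>lborel"
  shows "integrable lborel (\<lambda>x. (x - m)\<^sup>2 * f x)"
    and "(\<integral>x. (x - m)\<^sup>2 * f x \<partial>lborel) = (\<integral>x. x\<^sup>2 * f x \<partial>lborel) - m\<^sup>2"
    and "0 < (\<integral>x. x\<^sup>2 * f x \<partial>lborel) - m\<^sup>2"
proof -
  have eq: "(\<lambda>x. (x - m)\<^sup>2 * f x) = (\<lambda>x. x\<^sup>2 * f x - 2 * m * (x * f x) + m\<^sup>2 * f x)"
    by (auto simp: power2_eq_square algebra_simps)
  show i: "integrable lborel (\<lambda>x. (x - m)\<^sup>2 * f x)"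
    unfolding eq using int by simp
  show v: "(\<integral>x. (x - m)\<^sup>2 * f x \<partial>lborel) = (\<integral>x. x\<^sup>2 * f x \<partial>lborel) - m\<^sup>2"
    unfolding eq using int by (simp add: total m_def[symmetric] power2_eq_square)
  have "0 \<le> (\<integral>x. (x - m)\<^sup>2 * f x \<partial>lborel)"
    by (intro Bochner_Integration.integral_nonneg) (simp add: nonneg)
  moreover have "(\<integral>x. (x - m)\<^sup>2 * f x \<partial>lborel) \<noteq> 0"
  proof
    assume "(\<integral>x. (x - m)\<^sup>2 * f x \<partial>lborel) = 0"
    then have "AE x in lborel. (x - m)\<^sup>2 * f x = 0"
      using integral_nonneg_eq_0_iff_AE[OF i] nonneg by simp
    then have "AE x in lborel. f x = 0"
      using AE_lborel_singleton[of m] by eventually_elim simp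
    then have "(\<integral>x. f x \<partial>lborel) = 0" by (rule integral_eq_zero_AE)
    then show False using total by simp
  qed
  ultimately show "0 < (\<integral>x. x\<^sup>2 * f x \<partial>lborel) - m\<^sup>2" unfolding v by simp
qed

text \<open>The case of \<open>log_concave_renyi_variance\<close> in which the mode is at the origin.\<close>

lemma centred_renyi_variance:
  fixes f :: "real \<Rightarrow> real"
  assumes f: "log_concave_fun f" and int: "integrable lborel f" and total: "(\<integral>x. f x \<partial>lborel) = 1"
    and mono: "\<And>x y. x \<le> y \<Longrightarrow> y < 0 \<Longrightarrow> f x \<le> f y"
    and anti: "\<And>x y. 0 < x \<Longrightarrow> x \<le> y \<Longrightarrow> f y \<le> f x"
    and q: "0 < q"
  shows "integrable lborel (\<lambda>x. x * f x)" "integrable lborel (\<lambda>x. x\<^sup>2 * f x)"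
    "integrable lborel (\<lambda>x. f x powr (1 + q))"
    "((\<integral>x. x\<^sup>2 * f x \<partial>lborel) - (\<integral>x. x * f x \<partial>lborel)\<^sup>2) powr (q / 2)
       * ((1 + q) * (\<integral>x. f x powr (1 + q) \<partial>lborel)) \<le> 1"
proof -
  have [measurable]: "f \<in> borel_measurable borel" using int by simp
  note nonneg = log_concave_fun_nonneg[OF f]
  define G where "G x = f (- x)" for x
  have G: "log_concave_fun G" using log_concave_fun_affine[OF f, of 0 "-1"] by (simp add: G_def[abs_def])
  have [measurable]: "G \<in> borel_measurable borel" unfolding G_def[abs_def] by simp
  have G_mono: "x \<le> y \<Longrightarrow> y < 0 \<Longrightarrow> G x \<le> G y" for x y using anti[of "- y" "- x"] by (simp add: G_def)
  have G_anti: "0 < x \<Longrightarrow> x \<le> y \<Longrightarrow> G y \<le> G x" for x y using mono[of "- y" "- x"] by (simp add: G_def)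
  have intG: "integrable lborel G"
    using lborel_integrable_real_affine[OF int, of "-1" 0] by (simp add: G_def[abs_def])
  have si: "set_integrable lborel {0<..} f" "set_integrable lborel {0<..} G"
    using integrable_mult_indicator[OF _ int, of "{0<..}"] integrable_mult_indicator[OF _ intG, of "{0<..}"]
    by (simp_all add: set_integrable_def)
  define b where "b = (LINT x:{0<..}|lborel. f x)"
  define a where "a = (LINT x:{0<..}|lborel. G x)"
  have ab: "0 \<le> a" "0 \<le> b" "a + b = 1"
    using integral_split_at_zero(2)[OF si(1) si(2)[unfolded G_def[abs_def]]] total nonneg
    by (auto simp: a_def b_def G_def set_lebesgue_integral_def intro!: Bochner_Integration.integral_nonneg)
  obtain Bf BG where B: "\<And>x. 0 < x \<Longrightarrow> f x \<le> Bf" "\<And>x. 0 < x \<Longrightarrow> G x \<le> BG"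
    using half_line_bounded[OF f anti] half_line_bounded[OF G G_anti] by blast
  define M where "M = Sup (f ` (- {0}))"
  have bdd: "bdd_above (f ` (- {0}))"
  proof (rule bdd_aboveI2)
    fix x :: real assume "x \<in> - {0}"
    then show "f x \<le> max Bf BG" using B(1)[of x] B(2)[of "- x"] by (cases "0 < x") (auto simp: G_def)
  qed
  have fM: "f x \<le> M" if "x \<noteq> 0" for x
    unfolding M_def by (rule cSup_upper[OF _ bdd]) (use that in auto)
  have less_M: "\<exists>x. x \<noteq> 0 \<and> c < f x" if "c < M" for c
  proof -
    have "f ` (- {0}) \<noteq> {}" by (auto intro!: exI[of _ 1])
    then show ?thesis using less_cSup_iff[OF _ bdd, of c] that unfolding M_def by auto
  qed
  have f_pos: "\<exists>x>0. 0 < f x" if "0 < b"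
  proof (rule ccontr)
    assume "\<not> ?thesis"
    then have "indicator {0<..} x *\<^sub>R f x = 0" for x using nonneg[of x] by (auto simp: indicator_def not_less intro: antisym)
    then have "b = 0" unfolding b_def set_lebesgue_integral_def
      by (intro integral_eq_zero_AE AE_I2)
    then show False using that by simp
  qed
  have G_pos: "\<exists>x>0. 0 < G x" if "0 < a"
  proof (rule ccontr)
    assume "\<not> ?thesis"
    then have "indicator {0<..} x *\<^sub>R G x = 0" for x
      using log_concave_fun_nonneg[OF G, of x] by (auto simp: indicator_def not_less intro: antisym)
    then have "a = 0" unfolding a_def set_lebesgue_integral_def
      by (intro integral_eq_zero_AE AE_I2)
    then show False using that by simp
  qed
  have M: "0 < M"
  proof -
    have "0 < a \<or> 0 < b" using ab by linarith
    then obtain x where "x \<noteq> 0" "0 < f x" using f_pos G_pos unfolding G_def by (metis less_irrefl neg_0_equal_iff_equal)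
    then show ?thesis using fM[of x] by simp
  qed
  have f_sup: "\<exists>x>0. c < f x" if side: "0 < b" and below: "c < M" for c
  proof -
    obtain p where p: "0 < p" "0 < f p" using f_pos[OF side] by blast
    obtain z where z: "z \<noteq> 0" "c < f z" using less_M[OF below] by blast
    show ?thesis
    proof (cases "0 < z")
      case False
      then show ?thesis using sup_across_mode[OF f mono p _ z(2)] z by simp
    qed (use z in blast)
  qed
  have G_sup: "\<exists>x>0. c < G x" if side: "0 < a" and below: "c < M" for c
  proof -
    obtain p where p: "0 < p" "0 < G p" using G_pos[OF side] by blast
    obtain z where z: "z \<noteq> 0" "c < f z" using less_M[OF below] by blast
    then have z': "- z \<noteq> 0" "c < G (- z)" by (simp_all add: G_def)
    show ?thesis
    proof (cases "0 < - z")
      case False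
      then show ?thesis using sup_across_mode[OF G G_mono p _ z'(2)] z' by simp
    qed (use z' in blast)
  qed
  have GM: "G x \<le> M" if "0 < x" for x using fM[of "- x"] that by (simp add: G_def)
  obtain ER WR dR where R: "0 \<le> dR" "dR \<le> 1" "0 \<le> ER" "ER \<le> 1 - dR / 2" "WR - ER\<^sup>2 \<le> exp (- 2 * dR)"
    "set_integrable lborel {0<..} (\<lambda>x. x * f x)" "set_integrable lborel {0<..} (\<lambda>x. x\<^sup>2 * f x)"
    "(LINT x:{0<..}|lborel. x * f x) = b\<^sup>2 / M * ER" "(LINT x:{0<..}|lborel. x\<^sup>2 * f x) = b ^ 3 / M\<^sup>2 * WR"
    "\<forall>q>0. set_integrable lborel {0<..} (\<lambda>x. f x powr (1 + q)) \<and>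
      (1 + q) * (LINT x:{0<..}|lborel. f x powr (1 + q)) \<le> b * M powr q * (1 + q * dR)"
    using half_line_moments[OF f _ si(1) anti M fM b_def f_sup] by auto
  obtain EL WL dL where L: "0 \<le> dL" "dL \<le> 1" "0 \<le> EL" "EL \<le> 1 - dL / 2" "WL - EL\<^sup>2 \<le> exp (- 2 * dL)"
    "set_integrable lborel {0<..} (\<lambda>x. x * G x)" "set_integrable lborel {0<..} (\<lambda>x. x\<^sup>2 * G x)"
    "(LINT x:{0<..}|lborel. x * G x) = a\<^sup>2 / M * EL" "(LINT x:{0<..}|lborel. x\<^sup>2 * G x) = a ^ 3 / M\<^sup>2 * WL"
    "\<forall>q>0. set_integrable lborel {0<..} (\<lambda>x. G x powr (1 + q)) \<and>
      (1 + q) * (LINT x:{0<..}|lborel. G x powr (1 + q)) \<le> a * M powr q * (1 + q * dL)"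
    using half_line_moments[OF G _ si(2) G_anti M GM a_def G_sup] by auto
  have si1: "set_integrable lborel {0<..} (\<lambda>x. - x * f (- x))"
    using L(6) unfolding set_integrable_def G_def by simp
  show i1: "integrable lborel (\<lambda>x. x * f x)"
    by (rule integral_split_at_zero(1)[OF R(6)]) (use si1 in auto)
  have m1: "(\<integral>x. x * f x \<partial>lborel) = b\<^sup>2 / M * ER - a\<^sup>2 / M * EL"
    using integral_split_at_zero(2)[OF R(6)] si1 R(8) L(8)
    by (simp add: G_def set_integral_uminus[OF L(6)[unfolded G_def]])
  show i2: "integrable lborel (\<lambda>x. x\<^sup>2 * f x)"
    by (rule integral_split_at_zero(1)[OF R(7)]) (use L(7) in \<open>simp_all add: G_def\<close>)
  have m2: "(\<integral>x. x\<^sup>2 * f x \<partial>lborel) = b ^ 3 / M\<^sup>2 * WR + a ^ 3 / M\<^sup>2 * WL"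
    using integral_split_at_zero(2)[OF R(7)] L(7) R(9) L(9) by (simp add: G_def)
  have pR: "set_integrable lborel {0<..} (\<lambda>x. f x powr (1 + q))"
    "(1 + q) * (LINT x:{0<..}|lborel. f x powr (1 + q)) \<le> b * M powr q * (1 + q * dR)"
    using R(10) q by auto
  have pL: "set_integrable lborel {0<..} (\<lambda>x. f (- x) powr (1 + q))"
    "(1 + q) * (LINT x:{0<..}|lborel. f (- x) powr (1 + q)) \<le> a * M powr q * (1 + q * dL)"
    using L(10) q by (auto simp: G_def)
  show "integrable lborel (\<lambda>x. f x powr (1 + q))"
    by (rule integral_split_at_zero(1)[OF pR(1) pL(1)]) simp
  \<comment> \<open>The deficits of the two halves enter every bound through their weighted mean.\<close>
  define D where "D = a * dL + b * dR"
  define J where "J = (1 + q) * (\<integral>x. f x powr (1 + q) \<partial>lborel)"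
  define v where "v = (\<integral>x. x\<^sup>2 * f x \<partial>lborel) - (\<integral>x. x * f x \<partial>lborel)\<^sup>2"
  have "J \<le> b * M powr q * (1 + q * dR) + a * M powr q * (1 + q * dL)"
    using integral_split_at_zero(2)[OF pR(1) pL(1)] pR(2) pL(2) by (simp add: J_def distrib_left)
  also have "\<dots> = M powr q * ((a + b) + q * D)" by (simp add: D_def algebra_simps)
  also have "\<dots> \<le> M powr q * exp (q * D)"
    unfolding ab(3) by (intro mult_left_mono) auto
  finally have J: "J \<le> M powr q * exp (q * D)" .
  have J0: "0 \<le> J" unfolding J_def using q
    by (intro mult_nonneg_nonneg Bochner_Integration.integral_nonneg) auto
  have b: "b = 1 - a" using ab by simp
  have "v = (a ^ 3 * WL + b ^ 3 * WR - (b\<^sup>2 * ER - a\<^sup>2 * EL)\<^sup>2) / M\<^sup>2"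
    using M unfolding v_def m1 m2 by (simp add: field_simps power2_eq_square)
  also have "a ^ 3 * WL + b ^ 3 * WR - (b\<^sup>2 * ER - a\<^sup>2 * EL)\<^sup>2
      = a ^ 3 * (WL - EL\<^sup>2) + b ^ 3 * (WR - ER\<^sup>2) + a * b * (a * EL + b * ER)\<^sup>2"
    unfolding b by (simp add: algebra_simps power2_eq_square power3_eq_cube)
  also have "\<dots> / M\<^sup>2 \<le> exp (- 2 * D) / M\<^sup>2"
    unfolding D_def by (intro divide_right_mono split_variance_bound ab R L) auto
  finally have v: "v \<le> exp (- 2 * D) / M\<^sup>2" .
  have "0 < v" unfolding v_def by (rule density_variance_pos[OF nonneg int i1 i2 total])
  have "exp (- 2 * D) / M\<^sup>2 = (exp (- D) / M) powr 2"
    using M by (simp add: powr_realpow power_divide flip: exp_of_nat_mult)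
  with v \<open>0 < v\<close> q have "v powr (q / 2) \<le> ((exp (- D) / M) powr 2) powr (q / 2)"
    by (intro powr_mono2) auto
  then have "v powr (q / 2) \<le> (exp (- D) / M) powr q" by (simp add: powr_powr)
  then have "v powr (q / 2) * J \<le> (exp (- D) / M) powr q * (M powr q * exp (q * D))"
    using J J0 by (intro mult_mono) auto
  also have "\<dots> = 1" using M by (simp add: powr_divide exp_powr_real mult.commute flip: exp_add)
  finally show "((\<integral>x. x\<^sup>2 * f x \<partial>lborel) - (\<integral>x. x * f x \<partial>lborel)\<^sup>2) powr (q / 2)
       * ((1 + q) * (\<integral>x. f x powr (1 + q) \<partial>lborel)) \<le> 1"
    by (simp add: v_def J_def)
qed

text \<open>For the length \<open>L = (I + 1)/c\<close>, where \<open>I\<close> is the integral of \<open>f\<close>, the plateau alone has area at least \<open>I + 1\<close>.\<close>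

lemma no_wide_plateau:
  fixes f :: "real \<Rightarrow> real"
  assumes nonneg: "\<And>x. 0 \<le> f x" and int: "integrable lborel f" and c: "0 < c"
    and wide: "\<And>L. \<exists>a. \<forall>x\<in>{a..a + L}. c \<le> f x"
  shows False
proof -
  define I where "I = (\<integral>x. f x \<partial>lborel)"
  have "0 \<le> I" unfolding I_def using nonneg by (intro Bochner_Integration.integral_nonneg)
  define L where "L = (I + 1) / c"
  have L: "0 < L" using \<open>0 \<le> I\<close> c by (simp add: L_def)
  obtain a where a: "\<And>x. x \<in> {a..a + L} \<Longrightarrow> c \<le> f x" using wide by blast
  have "(\<integral>x. indicator {a..a + L} x * c \<partial>lborel) \<le> I"
    unfolding I_def
  proof (intro integral_mono int integrable_mult_left integrable_real_indicator)
    show "indicator {a..a + L} x * c \<le> f x" for x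
      using a[of x] nonneg[of x] by (auto simp: indicator_def)
  qed (use L in auto)
  then have "L * c \<le> I" using L by simp
  then show False using c by (simp add: L_def)
qed

text \<open>Let \<open>U\<close> be the set of points to the right of which \<open>f\<close> takes a larger value. By quasi-concavity \<open>f\<close> is nondecreasing on
\<open>U\<close>, which is an initial segment, and it is nonincreasing off \<open>U\<close>. As \<open>f\<close> is integrable, \<open>U\<close> is
neither empty nor everything, and its supremum is a mode.\<close>

lemma mode_exists:
  fixes f :: "real \<Rightarrow> real"
  assumes f: "log_concave_fun f" and int: "integrable lborel f" and total: "(\<integral>x. f x \<partial>lborel) = 1"
  shows "\<exists>m. (\<forall>x y. x \<le> y \<longrightarrow> y < m \<longrightarrow> f x \<le> f y) \<and> (\<forall>x y. m < x \<longrightarrow> x \<le> y \<longrightarrow> f y \<le> f x)"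
proof -
  note nonneg = log_concave_fun_nonneg[OF f]
  obtain p where p: "0 < f p"
  proof -
    have "\<not> (\<forall>x. f x = 0)" using total by (metis (no_types) integral_zero zero_neq_one Bochner_Integration.integral_cong)
    then show thesis using that nonneg by (auto simp: less_le)
  qed
  define U where "U = {x. \<exists>y>x. f x < f y}"
  have U_mono: "f x \<le> f y" if "x \<le> y" "y \<in> U" for x y
  proof -
    obtain z where z: "y < z" "f y < f z" using \<open>y \<in> U\<close> by (auto simp: U_def)
    then have "min (f x) (f z) \<le> f y" using that by (intro log_concave_fun_ge_min[OF f]) auto
    with z show ?thesis by auto
  qed
  have U_down: "x \<in> U" if "x \<le> y" "y \<in> U" for x y
  proof (cases "x = y")
    case False
    obtain z where z: "y < z" "f y < f z" using \<open>y \<in> U\<close> by (auto simp: U_def)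
    then have "x < z" "f x < f z" using U_mono[OF that] that by auto
    then show ?thesis by (auto simp: U_def)
  qed (use that in simp)
  have off_U: "f y \<le> f x" if "x \<le> y" "x \<notin> U" for x y
  proof (cases "x = y")
    case False
    with that have "x < y" by simp
    with that(2) have "\<not> f x < f y" unfolding U_def by blast
    then show ?thesis by simp
  qed simp
  have "U \<noteq> {}"
  proof
    assume "U = {}"
    then have "f p \<le> f x" if "x \<le> p" for x using off_U that by blast
    then have "\<forall>x\<in>{p - L..p - L + L}. f p \<le> f x" for L by auto
    then show False using no_wide_plateau[OF nonneg int p] by blast
  qed
  have "\<exists>b. b \<notin> U"
  proof (rule ccontr)
    assume "\<not> ?thesis"
    then have "f p \<le> f x" if "p \<le> x" for x using U_mono that by blast
    then have "\<forall>x\<in>{p..p + L}. f p \<le> f x" for L by auto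
    then show False using no_wide_plateau[OF nonneg int p] by blast
  qed
  then obtain b where b: "b \<notin> U" by blast
  have bdd: "bdd_above U"
  proof (rule bdd_aboveI[of _ b])
    fix x assume "x \<in> U"
    with b U_down show "x \<le> b" by (meson linear)
  qed
  have "f x \<le> f y" if "x \<le> y" "y < Sup U" for x y
  proof -
    obtain u where "u \<in> U" "y < u" using less_cSupE[OF \<open>y < Sup U\<close> \<open>U \<noteq> {}\<close>] by blast
    then have "y \<in> U" using U_down by (meson less_imp_le)
    then show ?thesis using U_mono that by blast
  qed
  moreover have "f y \<le> f x" if "Sup U < x" "x \<le> y" for x y
  proof -
    have "x \<notin> U" using that cSup_upper[OF _ bdd, of x] by auto
    then show ?thesis using off_U that by blast
  qed
  ultimately show ?thesis by blast
qed

text \<open>The minimum of the Renyi entropy of order \<open>1 + q\<close> for given variance; equality holds for the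
exponential density, whose variance is \<open>1\<close> and whose power integral is \<open>1 / (1 + q)\<close>.\<close>

lemma log_concave_renyi_variance:
  fixes f :: "real \<Rightarrow> real"
  assumes f: "log_concave_fun f" and int: "integrable lborel f" and total: "(\<integral>x. f x \<partial>lborel) = 1"
    and q: "0 < q"
  shows "integrable lborel (\<lambda>x. x * f x)" "integrable lborel (\<lambda>x. x\<^sup>2 * f x)"
    "integrable lborel (\<lambda>x. f x powr (1 + q))"
    "((\<integral>x. x\<^sup>2 * f x \<partial>lborel) - (\<integral>x. x * f x \<partial>lborel)\<^sup>2) powr (q / 2)
       * ((1 + q) * (\<integral>x. f x powr (1 + q) \<partial>lborel)) \<le> 1"
proof -
  obtain m where m: "\<And>x y. x \<le> y \<Longrightarrow> y < m \<Longrightarrow> f x \<le> f y" "\<And>x y. m < x \<Longrightarrow> x \<le> y \<Longrightarrow> f y \<le> f x"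
    using mode_exists[OF f int total] by blast
  define F where "F x = f (m + x)" for x
  have F: "log_concave_fun F" using log_concave_fun_affine[OF f, of m 1] by (simp add: F_def[abs_def])
  have shift: "integrable lborel (\<lambda>x. h (m + x)) \<longleftrightarrow> integrable lborel h"
    "(\<integral>x. h x \<partial>lborel) = (\<integral>x. h (m + x) \<partial>lborel)" for h :: "real \<Rightarrow> real"
    using lborel_integrable_real_affine_iff[of 1 h m] lborel_integral_real_affine[of 1 h m] by simp_all
  have intF: "integrable lborel F" and totF: "(\<integral>x. F x \<partial>lborel) = 1"
    using int total shift[of f] by (simp_all add: F_def[abs_def])
  note C = centred_renyi_variance[OF F intF totF _ _ q]
  have mono: "x \<le> y \<Longrightarrow> y < 0 \<Longrightarrow> F x \<le> F y" and anti: "0 < x \<Longrightarrow> x \<le> y \<Longrightarrow> F y \<le> F x" for x y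
    using m(1)[of "m + x" "m + y"] m(2)[of "m + x" "m + y"] by (simp_all add: F_def)
  note C = C[OF mono anti]
  have 1: "(\<lambda>x. (m + x) * f (m + x)) = (\<lambda>x. m * F x + x * F x)"
    "(\<lambda>x. (m + x)\<^sup>2 * f (m + x)) = (\<lambda>x. m\<^sup>2 * F x + 2 * m * (x * F x) + x\<^sup>2 * F x)"
    by (auto simp: F_def power2_eq_square algebra_simps)
  show "integrable lborel (\<lambda>x. x * f x)"
    using C(1) intF by (subst shift(1)[symmetric]) (simp add: 1)
  show "integrable lborel (\<lambda>x. x\<^sup>2 * f x)"
    using C(1,2) intF by (subst shift(1)[symmetric]) (simp add: 1)
  show "integrable lborel (\<lambda>x. f x powr (1 + q))"
    using C(3) by (subst shift(1)[symmetric]) (simp add: F_def)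
  have m1: "(\<integral>x. x * f x \<partial>lborel) = m + (\<integral>x. x * F x \<partial>lborel)"
    using C(1) intF by (subst shift(2)) (simp add: 1 totF)
  have m2: "(\<integral>x. x\<^sup>2 * f x \<partial>lborel) = m\<^sup>2 + 2 * m * (\<integral>x. x * F x \<partial>lborel) + (\<integral>x. x\<^sup>2 * F x \<partial>lborel)"
    using C(1,2) intF by (subst shift(2)) (simp add: 1 totF)
  have m3: "(\<integral>x. f x powr (1 + q) \<partial>lborel) = (\<integral>x. F x powr (1 + q) \<partial>lborel)"
    by (subst shift(2)) (simp add: F_def)
  have "(\<integral>x. x\<^sup>2 * f x \<partial>lborel) - (\<integral>x. x * f x \<partial>lborel)\<^sup>2 = (\<integral>x. x\<^sup>2 * F x \<partial>lborel) - (\<integral>x. x * F x \<partial>lborel)\<^sup>2"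
    unfolding m1 m2 by (simp add: power2_eq_square algebra_simps)
  with C(4) show "((\<integral>x. x\<^sup>2 * f x \<partial>lborel) - (\<integral>x. x * f x \<partial>lborel)\<^sup>2) powr (q / 2)
       * ((1 + q) * (\<integral>x. f x powr (1 + q) \<partial>lborel)) \<le> 1"
    by (simp add: m3)
qed

section \<open>Maximal Renyi entropy for given variance\<close>

text \<open>The substitution \<open>t = x\<^sup>2\<close> in the integral that defines the Beta function.\<close>

lemma integral_power_of_parabola:
  fixes p :: real
  assumes p: "0 < p"
  shows "integrable lborel (\<lambda>x. max 0 (1 - x\<^sup>2) powr p)"
    and "(\<integral>x. max 0 (1 - x\<^sup>2) powr p \<partial>lborel) = Beta (1 / 2) (p + 1)"
proof -
  define h :: "real \<Rightarrow> real" where "h x = max 0 (1 - x\<^sup>2) powr p" for x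
  define k :: "real \<Rightarrow> real" where "k t = t powr (- 1 / 2) * (1 - t) powr p" for t
  have [measurable]: "h \<in> borel_measurable borel" "k \<in> borel_measurable borel"
    unfolding h_def[abs_def] k_def[abs_def] by measurable
  have "(k has_integral Beta (1 / 2) (p + 1)) {0..1}"
    using has_integral_Beta_real[of "1 / 2" "p + 1"] p by (simp add: k_def[abs_def])
  from nn_integral_has_integral_lebesgue[OF _ this]
  have "ennreal (Beta (1 / 2) (p + 1)) = (\<integral>\<^sup>+t. ennreal (k t * indicator {0\<^sup>2..1\<^sup>2} t) \<partial>lborel)"
    by (simp add: k_def mult.commute)
  also have "\<dots> = (\<integral>\<^sup>+x. ennreal (k (x\<^sup>2) * (2 * x) * indicator {0..1} x) \<partial>lborel)"
    by (subst nn_integral_substitution[where g = "\<lambda>x. x\<^sup>2" and g' = "\<lambda>x. 2 * x"])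
       (auto intro!: derivative_eq_intros continuous_intros simp: set_borel_measurable_def)
  also have "\<dots> = (\<integral>\<^sup>+x. ennreal (2 * (indicator {0<..} x * h x)) \<partial>lborel)"
  proof (rule nn_integral_cong)
    fix x :: real
    have "k (x\<^sup>2) * (2 * x) * indicator {0..1} x = 2 * (indicator {0<..} x * h x)"
    proof (cases "0 < x \<and> x \<le> 1")
      case True
      then have "(x\<^sup>2) powr (- 1 / 2) = 1 / x"
        by (simp add: powr_powr powr_minus_divide flip: powr_numeral)
      moreover have "x\<^sup>2 \<le> 1" using True by (simp add: power_le_one)
      ultimately show ?thesis using True by (simp add: k_def h_def)
    next
      case False
      then have "x \<le> 0 \<or> 1 < x" by auto
      moreover have "1 \<le> x\<^sup>2" if "1 < x" using that by (simp add: one_le_power)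
      ultimately show ?thesis by (auto simp: k_def h_def indicator_def)
    qed
    then show "ennreal (k (x\<^sup>2) * (2 * x) * indicator {0..1} x) = ennreal (2 * (indicator {0<..} x * h x))"
      by (rule arg_cong)
  qed
  finally have "(\<integral>\<^sup>+x. ennreal (2 * (indicator {0<..} x * h x)) \<partial>lborel) = ennreal (Beta (1 / 2) (p + 1))" ..
  then have "has_bochner_integral lborel (\<lambda>x. 2 * (indicator {0<..} x * h x)) (Beta (1 / 2) (p + 1))"
    using p by (intro has_bochner_integral_nn_integral) (auto simp: h_def Beta_def intro!: Gamma_real_pos less_imp_le)
  then have "has_bochner_integral lborel (\<lambda>x. 1 / 2 * (2 * (indicator {0<..} x * h x))) (1 / 2 * Beta (1 / 2) (p + 1))"
    by (rule has_bochner_integral_mult_right)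
  then have half: "set_integrable lborel {0<..} h" "(LINT x:{0<..}|lborel. h x) = Beta (1 / 2) (p + 1) / 2"
    by (auto simp: has_bochner_integral_iff set_integrable_def set_lebesgue_integral_def)
  have even: "h (- x) = h x" for x by (simp add: h_def)
  show "integrable lborel (\<lambda>x. max 0 (1 - x\<^sup>2) powr p)"
    using integral_split_at_zero(1)[of h] half(1) by (simp add: even h_def[abs_def])
  show "(\<integral>x. max 0 (1 - x\<^sup>2) powr p \<partial>lborel) = Beta (1 / 2) (p + 1)"
    using integral_split_at_zero(2)[of h] half by (simp add: even h_def[abs_def])
qed

lemma young_power:
  fixes y s :: real
  assumes q: "0 < q" and ys: "0 \<le> y" "0 \<le> s"
  shows "(1 + q) * (y * s) \<le> y powr (1 + q) + q * s powr ((1 + q) / q)"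
proof -
  have "y * s \<le> y powr (1 + q) / (1 + q) + s powr ((1 + q) / q) / ((1 + q) / q)"
    by (rule Youngs_inequality) (use q ys in \<open>auto simp: field_simps\<close>)
  then have "(1 + q) * (y * s) \<le> (1 + q) * (y powr (1 + q) / (1 + q) + s powr ((1 + q) / q) / ((1 + q) / q))"
    using q by (intro mult_left_mono) auto
  also have "\<dots> = y powr (1 + q) + q * s powr ((1 + q) / q)" using q by (simp add: distrib_left)
  finally show ?thesis .
qed

text \<open>Equality holds for the density \<open>f\<^sub>0 x = (w x) powr (1/q) / (R B)\<close>, where \<open>w\<close> is the truncated parabola
and \<open>R\<close>, \<open>B\<close>, \<open>k\<close> are the constants of the proof. Young's inequality compares \<open>f\<close> with \<open>k * w = f\<^sub>0 powr q\<close>; since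
\<open>w x \<ge> 1 - (x - m)\<^sup>2 / R\<^sup>2\<close>, the mixed term is bounded below by the variance of \<open>f\<close> alone.\<close>

lemma power_integral_lower_bound:
  fixes f :: "real \<Rightarrow> real" and \<alpha> :: real
  assumes nonneg: "\<And>x. 0 \<le> f x" and int: "integrable lborel f" "integrable lborel (\<lambda>x. x * f x)"
      "integrable lborel (\<lambda>x. x\<^sup>2 * f x)" "integrable lborel (\<lambda>x. f x powr \<alpha>)"
    and total: "(\<integral>x. f x \<partial>lborel) = 1" and \<alpha>: "1 < \<alpha>"
  defines "J \<equiv> \<integral>x. f x powr \<alpha> \<partial>lborel"
    and "v \<equiv> (\<integral>x. x\<^sup>2 * f x \<partial>lborel) - (\<integral>x. x * f x \<partial>lborel)\<^sup>2"
  shows "0 < J" and "J powr (2 / (1 - \<alpha>)) \<le> C_plus \<alpha> * v"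
proof -
  define m where "m = (\<integral>x. x * f x \<partial>lborel)"
  have v: "0 < v" and var: "integrable lborel (\<lambda>x. (x - m)\<^sup>2 * f x)" "(\<integral>x. (x - m)\<^sup>2 * f x \<partial>lborel) = v"
    using density_variance_pos[OF nonneg int(1,2,3) total] by (simp_all add: v_def m_def)
  define q where "q = \<alpha> - 1"
  have q: "0 < q" "\<alpha> = 1 + q" using \<alpha> by (simp_all add: q_def)
  define p where "p = \<alpha> / (\<alpha> - 1)"
  have p: "p = (1 + q) / q" "0 < p" using q by (simp_all add: p_def)
  define B where "B = Beta (1 / 2) p"
  have B: "0 < B" unfolding B_def Beta_def using p by (intro divide_pos_pos mult_pos_pos Gamma_real_pos) auto
  define \<theta> where "\<theta> = 2 * \<alpha> / (3 * \<alpha> - 1)"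
  have \<theta>: "0 < \<theta>" using \<alpha> by (simp add: \<theta>_def)
  have Beta: "Beta (1 / 2) (p + 1) = \<theta> * B"
  proof -
    have "(1 / 2 + p) * Beta (1 / 2) (p + 1) = p * B"
      unfolding B_def by (rule Beta_plus1_right) (use p in \<open>auto elim!: nonpos_Ints_cases\<close>)
    moreover have "p = \<theta> * (1 / 2 + p)"
    proof -
      have "1 / 2 + p = (2 + 3 * q) / (2 * q)" "\<theta> = 2 * (1 + q) / (2 + 3 * q)"
        using q by (simp_all add: p(1) \<theta>_def field_simps)
      then have "\<theta> * (1 / 2 + p) = 2 * (1 + q) / (2 * q)" using q(1) by simp
      also have "\<dots> = p" unfolding p(1) by (rule mult_divide_mult_cancel_left) simp
      finally show ?thesis ..
    qed
    ultimately have "(1 / 2 + p) * Beta (1 / 2) (p + 1) = (1 / 2 + p) * (\<theta> * B)"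
      by (metis mult.assoc mult.commute)
    then show ?thesis using p by simp
  qed
  \<comment> \<open>With this radius \<open>f\<^sub>0\<close> has variance \<open>v\<close>.\<close>
  define R where "R = sqrt (v * ((3 * \<alpha> - 1) / (\<alpha> - 1)))"
  have R: "0 < R" "R\<^sup>2 = v * ((3 * \<alpha> - 1) / (\<alpha> - 1))" using v \<alpha> by (simp_all add: R_def)
  have vR: "1 - v / R\<^sup>2 = \<theta>" using v \<alpha> unfolding R(2) \<theta>_def by (simp add: field_simps)
  define k where "k = (R * B) powr (- q)"
  have k: "0 < k" using R B by (simp add: k_def)
  have kp: "k powr p * (R * B) = k"
  proof -
    have "k powr p = (R * B) powr (- (1 + q))" unfolding k_def powr_powr using q by (simp add: p)
    then have "k powr p * (R * B) = (R * B) powr (- (1 + q)) * (R * B) powr 1" using R B by simp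
    also have "\<dots> = k" unfolding k_def by (subst powr_add[symmetric]) simp
    finally show ?thesis .
  qed
  define w where "w x = max 0 (1 - ((x - m) / R)\<^sup>2)" for x
  have w: "integrable lborel (\<lambda>x. w x powr p)" "(\<integral>x. w x powr p \<partial>lborel) = R * (\<theta> * B)"
  proof -
    define h :: "real \<Rightarrow> real" where "h x = max 0 (1 - x\<^sup>2) powr p" for x
    have h: "integrable lborel h" "(\<integral>x. h x \<partial>lborel) = \<theta> * B"
      using integral_power_of_parabola[OF p(2)] by (simp_all add: h_def[abs_def] Beta)
    have eq: "h (x / R - m / R) = w x powr p" for x
      by (simp add: h_def w_def diff_divide_distrib)
    show "integrable lborel (\<lambda>x. w x powr p)"
      using lborel_integrable_real_affine[OF h(1), of "1 / R" "- (m / R)"] R by (simp add: eq)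
    show "(\<integral>x. w x powr p \<partial>lborel) = R * (\<theta> * B)"
      using lborel_integral_real_affine[of "1 / R" h "- (m / R)"] R h(2) by (simp add: eq)
  qed
  have "(\<integral>x. \<alpha> * k * (f x - (x - m)\<^sup>2 * f x / R\<^sup>2) - q * k powr p * w x powr p \<partial>lborel) \<le> J"
    unfolding J_def
  proof (intro integral_mono)
    show "integrable lborel (\<lambda>x. \<alpha> * k * (f x - (x - m)\<^sup>2 * f x / R\<^sup>2) - q * k powr p * w x powr p)"
      using int(1) var(1) w(1) by simp
    show "integrable lborel (\<lambda>x. f x powr \<alpha>)" by (rule int)
    fix x
    have "f x - (x - m)\<^sup>2 * f x / R\<^sup>2 = f x * (1 - ((x - m) / R)\<^sup>2)"
      by (simp add: power_divide algebra_simps)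
    also have "\<dots> \<le> f x * w x" unfolding w_def by (intro mult_left_mono nonneg) simp
    finally have "\<alpha> * k * (f x - (x - m)\<^sup>2 * f x / R\<^sup>2) \<le> \<alpha> * k * (f x * w x)"
      using \<alpha> k by (intro mult_left_mono) auto
    also have "\<dots> = (1 + q) * (f x * (k * w x))" using q by simp
    also have "\<dots> \<le> f x powr (1 + q) + q * (k * w x) powr ((1 + q) / q)"
      by (rule young_power[OF q(1) nonneg]) (use k in \<open>simp add: w_def\<close>)
    also have "\<dots> = f x powr \<alpha> + q * k powr p * w x powr p"
      using k by (simp add: q(2) p(1) powr_mult w_def)
    finally show "\<alpha> * k * (f x - (x - m)\<^sup>2 * f x / R\<^sup>2) - q * k powr p * w x powr p \<le> f x powr \<alpha>" by simp
  qed
  also have "(\<integral>x. \<alpha> * k * (f x - (x - m)\<^sup>2 * f x / R\<^sup>2) - q * k powr p * w x powr p \<partial>lborel)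
      = \<alpha> * k * (1 - v / R\<^sup>2) - q * k powr p * (R * (\<theta> * B))"
    using int(1) var w by (simp add: total)
  also have "\<dots> = k * \<theta>"
  proof -
    have "q * k powr p * (R * (\<theta> * B)) = q * \<theta> * (k powr p * (R * B))" by (simp add: algebra_simps)
    also have "\<dots> = q * \<theta> * k" unfolding kp ..
    finally have "q * k powr p * (R * (\<theta> * B)) = q * \<theta> * k" .
    moreover have "\<alpha> * k * \<theta> - q * \<theta> * k = k * \<theta>" by (simp add: q(2) algebra_simps)
    ultimately show ?thesis unfolding vR by (simp only:)
  qed
  finally have J: "k * \<theta> \<le> J" .
  moreover have "0 < k * \<theta>" using k \<theta> by simp
  ultimately show "0 < J" by linarith
  have "J powr (2 / (1 - \<alpha>)) \<le> (k * \<theta>) powr (2 / (1 - \<alpha>))"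
    using J \<alpha> \<open>0 < k * \<theta>\<close> by (intro powr_mono2') (auto simp: divide_nonneg_neg divide_nonneg_nonpos)
  also have "\<dots> = k powr (2 / (1 - \<alpha>)) * \<theta> powr (2 / (1 - \<alpha>))"
    using k \<theta> by (simp add: powr_mult)
  also have "k powr (2 / (1 - \<alpha>)) = (R * B)\<^sup>2"
  proof -
    have "- q * (2 / (1 - \<alpha>)) = 2" using q by (simp add: q(2))
    then show ?thesis unfolding k_def powr_powr using R B by (simp add: powr_numeral)
  qed
  also have "(R * B)\<^sup>2 * \<theta> powr (2 / (1 - \<alpha>)) = C_plus \<alpha> * v"
    unfolding C_plus_def power_mult_distrib R(2) by (simp add: B_def p_def \<theta>_def)
  finally show "J powr (2 / (1 - \<alpha>)) \<le> C_plus \<alpha> * v" .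
qed

section \<open>Renyi entropy power of sums of random variables\<close>

text \<open>The convention \<open>f = 0\<close> where \<open>V = \<infinity>\<close> makes the density real-valued; the values of \<open>V\<close> are
never \<open>- \<infinity>\<close>, so nothing is lost.\<close>

lemma log_concave_rv_density:
  assumes "prob_space M" "log_concave_rv M X"
  obtains f where "log_concave_fun f" "distributed M lborel X (\<lambda>x. ennreal (f x))"
proof -
  obtain V where V: "convex_extended V" "distributed M lborel X (\<lambda>x. exp_ereal (- V x))"
    using assms(2) by (auto simp: log_concave_rv_def)
  define f where "f x = (case V x of ereal r \<Rightarrow> exp (- r) | _ \<Rightarrow> 0)" for x
  have V_cases: "(\<exists>r. V x = ereal r \<and> f x = exp (- r)) \<or> (V x = \<infinity> \<and> f x = 0)" for x
    using V(1) by (cases "V x") (auto simp: f_def convex_extended_def)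
  have "exp_ereal (- V x) = ennreal (f x)" for x
    using V_cases[of x] by (auto simp: exp_ereal_def uminus_ereal.simps)
  then have d: "distributed M lborel X (\<lambda>x. ennreal (f x))" using V(2) by simp
  have "log_concave_fun f"
    unfolding log_concave_fun_def
  proof (intro conjI allI impI)
    show nonneg: "0 \<le> f x" for x using V_cases[of x] by auto
    fix x y t :: real assume t: "0 < t" "t < 1"
    show "f x powr (1 - t) * f y powr t \<le> f ((1 - t) * x + t * y)"
    proof (cases "f x = 0 \<or> f y = 0")
      case True
      then show ?thesis using nonneg by auto
    next
      case False
      then obtain r s where r: "V x = ereal r" "f x = exp (- r)" and s: "V y = ereal s" "f y = exp (- s)"
        using V_cases[of x] V_cases[of y] by auto
      have "V ((1 - t) * x + t * y) \<le> ereal (1 - t) * V x + ereal t * V y"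
        using V(1) t unfolding convex_extended_def by (meson less_imp_le)
      then have le: "V ((1 - t) * x + t * y) \<le> ereal ((1 - t) * r + t * s)" using r s by simp
      then obtain u where u: "V ((1 - t) * x + t * y) = ereal u" "f ((1 - t) * x + t * y) = exp (- u)"
        using V_cases[of "(1 - t) * x + t * y"] by auto
      have "f x powr (1 - t) * f y powr t = exp (- ((1 - t) * r + t * s))"
        using r s by (simp add: powr_def algebra_simps flip: exp_add)
      also have "\<dots> \<le> exp (- u)" using le u by simp
      finally show ?thesis using u by simp
    qed
  qed
  with d that show ?thesis by blast
qed

lemma (in prob_space) renyi_entropy_power_density:
  assumes X: "distributed M lborel X (\<lambda>x. ennreal (f x))" and nonneg: "\<And>x. 0 \<le> f x"
    and J: "0 < (\<integral>x. f x powr \<alpha> \<partial>lborel)"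
  shows "renyi_entropy_power M \<alpha> X = (\<integral>x. f x powr \<alpha> \<partial>lborel) powr (2 / (1 - \<alpha>))"
  unfolding renyi_entropy_power_def renyi_entropy_distributed[OF X nonneg]
  using J by (simp add: powr_def)

lemma (in prob_space) density_moments:
  assumes X: "distributed M lborel X (\<lambda>x. ennreal (f x))" and nonneg: "\<And>x. 0 \<le> f x"
  shows "integrable lborel f" "(\<integral>x. f x \<partial>lborel) = 1"
    and "integrable lborel (\<lambda>x. x * f x) \<longleftrightarrow> integrable M X"
    and "(\<integral>x. x * f x \<partial>lborel) = expectation X"
    and "integrable lborel (\<lambda>x. x\<^sup>2 * f x) \<longleftrightarrow> integrable M (\<lambda>\<omega>. (X \<omega>)\<^sup>2)"
    and "(\<integral>x. x\<^sup>2 * f x \<partial>lborel) = expectation (\<lambda>\<omega>. (X \<omega>)\<^sup>2)"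
  using distributed_integrable[OF X, of "\<lambda>x. 1"] distributed_integral[OF X, of "\<lambda>x. 1"]
    distributed_integrable[OF X, of "\<lambda>x. x"] distributed_integral[OF X, of "\<lambda>x. x"]
    distributed_integrable[OF X, of "\<lambda>x. x\<^sup>2"] distributed_integral[OF X, of "\<lambda>x. x\<^sup>2"] nonneg
  by (simp_all add: mult.commute prob_space)

text \<open>The inequality \<open>log_concave_renyi_variance\<close> solved for the power integral and raised to the
negative power \<open>2 / (1 - \<alpha>)\<close>.\<close>

lemma (in prob_space) log_concave_variance_le:
  assumes X: "log_concave_rv M X" and \<alpha>: "1 < \<alpha>"
  shows "integrable M X" "integrable M (\<lambda>\<omega>. (X \<omega>)\<^sup>2)"
    and "C_minus \<alpha> * (expectation (\<lambda>\<omega>. (X \<omega>)\<^sup>2) - (expectation X)\<^sup>2) \<le> renyi_entropy_power M \<alpha> X"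
proof -
  obtain f where f: "log_concave_fun f" and d: "distributed M lborel X (\<lambda>x. ennreal (f x))"
    using log_concave_rv_density[OF prob_space_axioms X] by blast
  note nonneg = log_concave_fun_nonneg[OF f]
  note D = density_moments[OF d nonneg]
  define q where "q = \<alpha> - 1"
  have q: "0 < q" "1 + q = \<alpha>" using \<alpha> by (simp_all add: q_def)
  note L = log_concave_renyi_variance[OF f D(1,2) q(1), unfolded q(2)]
  show "integrable M X" "integrable M (\<lambda>\<omega>. (X \<omega>)\<^sup>2)" using L(1,2) D(3,5) by simp_all
  define v where "v = expectation (\<lambda>\<omega>. (X \<omega>)\<^sup>2) - (expectation X)\<^sup>2"
  define J where "J = (\<integral>x. f x powr \<alpha> \<partial>lborel)"
  have v: "0 < v" using density_variance_pos(3)[OF nonneg D(1) L(1,2) D(2)] by (simp add: v_def D)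
  have J: "0 < J" using power_integral_lower_bound(1)[OF nonneg D(1) L(1,2,3) D(2) \<alpha>] by (simp add: J_def)
  have "v powr (q / 2) * (\<alpha> * J) \<le> 1" using L(4) by (simp add: v_def J_def D)
  then have "J \<le> v powr (- (q / 2)) / \<alpha>" using v \<alpha> by (simp add: powr_minus_divide field_simps)
  then have "(v powr (- (q / 2)) / \<alpha>) powr (2 / (1 - \<alpha>)) \<le> J powr (2 / (1 - \<alpha>))"
    using J \<alpha> by (intro powr_mono2') (auto simp: divide_nonneg_neg divide_nonneg_nonpos)
  also have "(v powr (- (q / 2)) / \<alpha>) powr (2 / (1 - \<alpha>)) = v / \<alpha> powr (2 / (1 - \<alpha>))"
  proof -
    have "- (q / 2) * (2 / (1 - \<alpha>)) = 1" using \<alpha> by (simp add: q_def field_simps)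
    then show ?thesis using v \<alpha> by (simp add: powr_divide powr_powr)
  qed
  also have "\<dots> = C_minus \<alpha> * v"
  proof -
    have "2 / (1 - \<alpha>) = - (2 / (\<alpha> - 1))" using \<alpha> by (simp add: field_simps)
    then show ?thesis by (simp add: C_minus_def powr_minus_divide)
  qed
  finally show "C_minus \<alpha> * (expectation (\<lambda>\<omega>. (X \<omega>)\<^sup>2) - (expectation X)\<^sup>2) \<le> renyi_entropy_power M \<alpha> X"
    using renyi_entropy_power_density[OF d nonneg J[unfolded J_def]] by (simp add: v_def J_def)
qed

theorem corollary2p4:
  fixes M :: "'a measure" and X Y :: "'a \<Rightarrow> real" and \<alpha> :: real
  assumes "prob_space M"
    and "log_concave_rv M X" and "log_concave_rv M Y"
    and "uncorrelated M X Y"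
    and "\<alpha> > 1"
    and "has_renyi_entropy M \<alpha> (\<lambda>\<omega>. X \<omega> + Y \<omega>)"
  shows "renyi_entropy_power M \<alpha> (\<lambda>\<omega>. X \<omega> + Y \<omega>)
    \<le> C_plus \<alpha> / C_minus \<alpha> * (renyi_entropy_power M \<alpha> X + renyi_entropy_power M \<alpha> Y)"
proof -
  interpret prob_space M by fact
  define Z where "Z \<omega> = X \<omega> + Y \<omega>" for \<omega>
  note X = log_concave_variance_le[OF assms(2,5)] and Y = log_concave_variance_le[OF assms(3,5)]
  obtain f where nonneg: "\<And>x. 0 \<le> f x" and d: "distributed M lborel Z (\<lambda>x. ennreal (f x))"
    and pw: "integrable lborel (\<lambda>x. f x powr \<alpha>)"
    using assms(6) by (auto simp: has_renyi_entropy_def Z_def[abs_def])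
  note D = density_moments[OF d nonneg]
  have [measurable]: "random_variable borel X" "random_variable borel Y"
    using X(1) Y(1) by auto
  have XY: "integrable M (\<lambda>\<omega>. X \<omega> * Y \<omega>)"
  proof (rule Bochner_Integration.integrable_bound)
    show "integrable M (\<lambda>\<omega>. (X \<omega>)\<^sup>2 + (Y \<omega>)\<^sup>2)" using X(2) Y(2) by simp
    have "\<bar>X \<omega> * Y \<omega>\<bar> \<le> (X \<omega>)\<^sup>2 + (Y \<omega>)\<^sup>2" for \<omega>
      using sum_squares_bound[of "\<bar>X \<omega>\<bar>" "\<bar>Y \<omega>\<bar>"]
        mult_nonneg_nonneg[OF abs_ge_zero[of "X \<omega>"] abs_ge_zero[of "Y \<omega>"]]
      unfolding abs_mult power2_abs by linarith
    then show "AE \<omega> in M. norm (X \<omega> * Y \<omega>) \<le> norm ((X \<omega>)\<^sup>2 + (Y \<omega>)\<^sup>2)" by simp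
  qed simp
  define vX where "vX = expectation (\<lambda>\<omega>. (X \<omega>)\<^sup>2) - (expectation X)\<^sup>2"
  define vY where "vY = expectation (\<lambda>\<omega>. (Y \<omega>)\<^sup>2) - (expectation Y)\<^sup>2"
  have Z2: "(\<lambda>\<omega>. (Z \<omega>)\<^sup>2) = (\<lambda>\<omega>. (X \<omega>)\<^sup>2 + 2 * (X \<omega> * Y \<omega>) + (Y \<omega>)\<^sup>2)"
    by (auto simp: Z_def power2_eq_square algebra_simps)
  have Z: "integrable M Z" "integrable M (\<lambda>\<omega>. (Z \<omega>)\<^sup>2)"
    unfolding Z2 using X Y XY by (simp_all add: Z_def[abs_def])
  have "(\<lambda>\<omega>. (X \<omega> - expectation X) * (Y \<omega> - expectation Y))
      = (\<lambda>\<omega>. X \<omega> * Y \<omega> - expectation Y * X \<omega> - expectation X * Y \<omega> + expectation X * expectation Y)"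
    by (auto simp: algebra_simps)
  then have "covariance M X Y = expectation (\<lambda>\<omega>. X \<omega> * Y \<omega>) - expectation X * expectation Y"
    unfolding covariance_def using X Y XY by (simp add: prob_space)
  then have cov: "expectation (\<lambda>\<omega>. X \<omega> * Y \<omega>) = expectation X * expectation Y"
    using assms(4) by (simp add: uncorrelated_def)
  have vZ: "expectation (\<lambda>\<omega>. (Z \<omega>)\<^sup>2) - (expectation Z)\<^sup>2 = vX + vY"
  proof -
    have "expectation Z = expectation X + expectation Y" using X Y by (simp add: Z_def[abs_def])
    moreover have "expectation (\<lambda>\<omega>. (Z \<omega>)\<^sup>2) = expectation (\<lambda>\<omega>. (X \<omega>)\<^sup>2)
        + 2 * (expectation X * expectation Y) + expectation (\<lambda>\<omega>. (Y \<omega>)\<^sup>2)"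
      unfolding Z2 using X Y XY by (simp add: cov)
    ultimately show ?thesis by (simp add: vX_def vY_def power2_eq_square algebra_simps)
  qed
  have "integrable lborel (\<lambda>x. x * f x)" "integrable lborel (\<lambda>x. x\<^sup>2 * f x)" using Z D(3,5) by simp_all
  note P = power_integral_lower_bound[OF nonneg D(1) this pw D(2) assms(5)]
  have "renyi_entropy_power M \<alpha> Z \<le> C_plus \<alpha> * (vX + vY)"
    using P(2) renyi_entropy_power_density[OF d nonneg P(1)] by (simp add: D vZ)
  also have "\<dots> = C_plus \<alpha> / C_minus \<alpha> * (C_minus \<alpha> * vX + C_minus \<alpha> * vY)"
    using assms(5) by (simp add: C_minus_def field_simps)
  also have "\<dots> \<le> C_plus \<alpha> / C_minus \<alpha> * (renyi_entropy_power M \<alpha> X + renyi_entropy_power M \<alpha> Y)"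
    using X(3) Y(3) assms(5) unfolding vX_def vY_def
    by (intro mult_left_mono add_mono divide_nonneg_nonneg) (auto simp: C_plus_def C_minus_def)
  finally show ?thesis by (simp add: Z_def[abs_def])
qed

end
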